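(* Let $d\ge2$ be an integer and let $\delta\in\mathcal D_0$ be such that $\Sigma_\delta=\{t\in I:\delta(t)=t\}=\{0,1\}$. a) If $\mathcal J(\delta)=+\infty$, then $\min_{C\in\mathcal C^\delta}\mathcal I(C)=+\infty$. b) If $\mathcal J(\delta)<+\infty$, then $\min_{C\in\mathcal C^\delta}\mathcal I(C)<+\infty$, and $C_\delta$ is the unique copula in $\mathcal C^\delta$ such that $\mathcal I(C_\delta)=\min_{C\in\mathcal C^\delta}\mathcal I(C)$.
   Context: Notation: $I=[0,1]$, and $\max(x)=\max_{1\le i\le d}x_i$ for $x\in\mathbb R^d$. A $d$-dimensional copula is a function $C$ on $I^d$ of the form $C(u)=\mathbb P(U_1\le u_1,\dots,U_d\le u_d)$, where $U=(U_1,\dots,U_d)$ is a random vector with each $U_i$ uniform on $I$; $C$ is absolutely continuous if $U$ has a density with respect to Lebesgue measure, called the density of $C$. The diagonal section of $C$ is $\delta_C(t)=C(t,\dots,t)$, $t\in I$. $\mathcal D_0$ is the set of diagonal sections of absolutely continuous $d$-dimensional copulas, and $\mathcal C^\delta$ is the set of all $d$-dimensional copulas with diagonal section $\delta$. Any $\delta\in\mathcal D_0$ is non-decreasing and $d$-Lipschitz with $\delta(0)=0$, $\delta(1)=1$, $\delta(t)\le t$; so $\delta'$ exists a.e. and $0\le\delta'\le d$ a.e. For a copula $C$, $\mathcal I(C)=\int_{I^d}c(x)\log(c(x))\,dx\in(-\infty,+\infty]$ (with $0\log0=0$) if $C$ is absolutely continuous with density $c$, and $\mathcal I(C)=+\infty$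 otherwise. Also $\mathcal J(\delta)=\int_I|\log(t-\delta(t))|\,dt\in[0,+\infty]$. Definition of $C_\delta$: for $r\in I$ let $h(r)=r-\delta(r)$, $F(r)=\frac{d-1}{d}\int_{1/2}^r\frac{ds}{h(s)}$, $a(r)=\frac{d-\delta'(r)}{d}h(r)^{-1+1/d}e^{F(r)}$ and $b(r)=\frac{\delta'(r)}{d}h(r)^{-1+1/d}e^{-(d-1)F(r)}$. Then $C_\delta$ is the copula with density given a.e. by $c_\delta(x)=b(\max(x))\prod_{x_i\neq\max(x)}a(x_i)$ for $x=(x_1,\dots,x_d)\in I^d$ (when $\Sigma_\delta=\{0,1\}$ this is indeed the density of a copula in $\mathcal C^\delta$). *)

theory Defs
  imports "HOL-Probability.Probability"
begin

text \<open>
  The dimension is \<open>d = CARD('n)\<close>. Functions on \<open>I^d\<close> and on \<open>I\<close> are represented by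
  extensional functions, so that equality in HOL is equality on \<open>I^d\<close> resp. \<open>I\<close>.
\<close>

definition unit_cube :: "(real ^ 'n) set" where
  "unit_cube = {x. \<forall>i. x $ i \<in> {0..1}}"

definition cube_cdf :: "'a measure \<Rightarrow> ('a \<Rightarrow> real ^ 'n) \<Rightarrow> real ^ 'n \<Rightarrow> real" where
  "cube_cdf M U =
     (\<lambda>u\<in>unit_cube. measure M {\<omega> \<in> space M. \<forall>i. U \<omega> $ i \<le> u $ i})"

definition uniform_marginals ::
    "'a measure \<Rightarrow> ('a \<Rightarrow> real ^ 'n::finite) \<Rightarrow> bool" where
  "uniform_marginals M U \<longleftrightarrow>
     prob_space M \<and> U \<in> borel_measurable M \<and>
     (\<forall>i. distributed M lborel (\<lambda>\<omega>. U \<omega> $ i) (indicator {0..1}))"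

text \<open>
  HOL does not allow quantification over the type of the sample space. The type
  \<open>real ^ 'n\<close> suffices, as every random vector has the same law as the identity on
  the space \<open>real ^ 'n\<close> equipped with that law.
\<close>

definition copulas :: "(real ^ 'n::finite \<Rightarrow> real) set" where
  "copulas = {C. \<exists>(M :: (real ^ 'n) measure) U. uniform_marginals M U \<and> C = cube_cdf M U}"

definition has_copula_density ::
    "(real ^ 'n::finite \<Rightarrow> real) \<Rightarrow> (real ^ 'n \<Rightarrow> real) \<Rightarrow> bool" where
  "has_copula_density C c \<longleftrightarrow>
     (\<forall>x. 0 \<le> c x) \<and>
     (\<exists>(M :: (real ^ 'n) measure) U. uniform_marginals M U \<and> C = cube_cdf M U \<and>
        distributed M lborel U (\<lambda>x. ennreal (c x)))"

definition abs_cont_copula :: "(real ^ 'n::finite \<Rightarrow> real) \<Rightarrow> bool" where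
  "abs_cont_copula C \<longleftrightarrow> (\<exists>c. has_copula_density C c)"

definition diag :: "(real ^ 'n \<Rightarrow> real) \<Rightarrow> real \<Rightarrow> real" where
  "diag C = (\<lambda>t\<in>{0..1}. C (\<chi> i. t))"

text \<open>The set \<open>D_0\<close>; the type argument only carries the dimension.\<close>

definition ac_diagonals :: "'n::finite itself \<Rightarrow> (real \<Rightarrow> real) set" where
  "ac_diagonals _ = {diag C |C :: real ^ 'n \<Rightarrow> real. abs_cont_copula C}"

definition copulas_with_diag :: "(real \<Rightarrow> real) \<Rightarrow> (real ^ 'n::finite \<Rightarrow> real) set" where
  "copulas_with_diag \<delta> = {C \<in> copulas. diag C = \<delta>}"

text \<open>
  The convention \<open>0 log 0 = 0\<close> is respected since \<open>ln 0 = 0\<close> in HOL. As \<open>x log x \<ge> -1/e\<close>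
  and the cube has measure 1, the subtracted term is finite, so that the difference is
  never \<open>\<infinity> - \<infinity>\<close>.
\<close>

definition c_log_c_integral :: "(real ^ 'n::finite \<Rightarrow> real) \<Rightarrow> ereal" where
  "c_log_c_integral c =
     enn2ereal (\<integral>\<^sup>+x\<in>unit_cube. ennreal (c x * ln (c x)) \<partial>lborel) -
     enn2ereal (\<integral>\<^sup>+x\<in>unit_cube. ennreal (- (c x * ln (c x))) \<partial>lborel)"

text \<open>
  A density is unique up to null sets, so the choice made by \<open>SOME\<close> does not matter.
\<close>

definition info :: "(real ^ 'n::finite \<Rightarrow> real) \<Rightarrow> ereal" where
  "info C =
     (if abs_cont_copula C then c_log_c_integral (SOME c. has_copula_density C c) else \<infinity>)"

text \<open>The case distinction implements \<open>\<bar>log 0\<bar> = \<infinity>\<close>, since \<open>ln 0 = 0\<close> in HOL.\<close>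

definition log_gap_integral :: "(real \<Rightarrow> real) \<Rightarrow> ennreal" where
  "log_gap_integral \<delta> =
     (\<integral>\<^sup>+t\<in>{0..1}. (if \<delta> t = t then \<infinity> else ennreal \<bar>ln (t - \<delta> t)\<bar>) \<partial>lborel)"

definition h_fun :: "(real \<Rightarrow> real) \<Rightarrow> real \<Rightarrow> real" where
  "h_fun \<delta> r = r - \<delta> r"

text \<open>The integral is oriented, i.e. it changes sign for \<open>r < 1/2\<close>.\<close>

definition F_fun :: "nat \<Rightarrow> (real \<Rightarrow> real) \<Rightarrow> real \<Rightarrow> real" where
  "F_fun d \<delta> r = (real d - 1) / real d * (LBINT s=ereal (1/2)..ereal r. 1 / h_fun \<delta> s)"

definition a_fun :: "nat \<Rightarrow> (real \<Rightarrow> real) \<Rightarrow> real \<Rightarrow> real" where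
  "a_fun d \<delta> r =
     (real d - deriv \<delta> r) / real d * h_fun \<delta> r powr (- 1 + 1 / real d) * exp (F_fun d \<delta> r)"

definition b_fun :: "nat \<Rightarrow> (real \<Rightarrow> real) \<Rightarrow> real \<Rightarrow> real" where
  "b_fun d \<delta> r =
     deriv \<delta> r / real d * h_fun \<delta> r powr (- 1 + 1 / real d) *
     exp (- (real d - 1) * F_fun d \<delta> r)"

definition max_coord :: "real ^ 'n::finite \<Rightarrow> real" where
  "max_coord x = Max (range (\<lambda>i. x $ i))"

definition c_delta :: "(real \<Rightarrow> real) \<Rightarrow> real ^ 'n::finite \<Rightarrow> real" where
  "c_delta \<delta> x =
     b_fun CARD('n) \<delta> (max_coord x) *
     (\<Prod>i | x $ i \<noteq> max_coord x. a_fun CARD('n) \<delta> (x $ i))"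

definition C_delta :: "(real \<Rightarrow> real) \<Rightarrow> real ^ 'n::finite \<Rightarrow> real" where
  "C_delta \<delta> =
     (\<lambda>u\<in>unit_cube. LINT x:{x \<in> unit_cube. \<forall>i. x $ i \<le> u $ i}|lborel. c_delta \<delta> x)"

definition is_minimum :: "('a \<Rightarrow> ereal) \<Rightarrow> 'a set \<Rightarrow> ereal \<Rightarrow> bool" where
  "is_minimum f A m \<longleftrightarrow> m \<in> f ` A \<and> (\<forall>x\<in>A. m \<le> f x)"

end

theory Submission
  imports Defs
begin

text \<open>
  Let \<open>g\<close> be the derivative of \<open>\<delta>\<close> and \<open>M = max x\<close>. For almost every \<open>x\<close>, \<open>ln (c_delta x)\<close> is the
  difference of the two nonnegative terms
  \<open>gain = (1 - 1/d) \<Sum>i. - ln (h (x_i))\<close> and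
  \<open>loss = (\<Sum>i. F M - F (x_i)) - ln (g M / d) - (\<Sum>i with x_i \<noteq> M. ln (1 - g (x_i) / d))\<close>.
  Their integrals against the density of a copula with diagonal \<open>\<delta>\<close> depend on \<open>\<delta>\<close> only, as the
  coordinates are uniform and \<open>M\<close> has density \<open>g\<close>: the gain gives \<open>(d - 1) J(\<delta>)\<close>, and the loss is
  finite. For the \<open>F\<close>-terms this follows from Tonelli's theorem, since
  \<open>F M - F (x_i)\<close> is \<open>(d - 1)/d\<close> times the integral of \<open>1/h\<close> over \<open>[x_i, M]\<close> and \<open>P(x_i \<le> s < M) = s - \<delta> s = h s\<close>.
  The pointwise Gibbs inequality \<open>u ln u \<ge> u ln v + u - v\<close> with \<open>v = c_delta x\<close> then yields both parts, and
  its equality case yields uniqueness.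
\<close>

section \<open>Differentiation of Lipschitz functions\<close>

text \<open>The factors \<open>a\<close> and \<open>b\<close> are forced by the constraints.
  Averaged over the coordinates of a copula with diagonal \<delta>, a coordinate has at level t the
  density g/d while being the maximum and 1 - g/d while lying below it. For the product form b(M)
  times the product of the a(x_i) these become b A^(d-1) = g/d and a Q = 1 - g/d, where A is the
  integral of a over [0, t] and Q that of (d-1) b A^(d-2) over [t, 1]. Then A Q = h, so A'/A = (1 -
  g/d)/h, and as h' = 1 - g this is solved by ln A = (ln h)/d + F; hence the exponents in the
  definitions of \<open>a\<close> and \<open>b\<close>. The obstacle is regularity. \<delta> is only
  Lipschitz, so the derivative in \<open>c_delta\<close> and those of A and Q exist only almost
  everywhere, while F tends to -infinity at 0 and to infinity at 1. Hence the differentiation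
  theorems, an everywhere bounded version g of the derivative, and integration on compact
  subintervals of (0,1) before passing to the end points.\<close>

lemma negligible_upper_derivate_exceeds:
  fixes g G :: "real \<Rightarrow> real"
  assumes g[measurable]: "g \<in> borel_measurable borel"
    and g_range: "\<And>t. 0 \<le> g t" "\<And>t. g t \<le> B"
    and G: "\<And>s t. s \<le> t \<Longrightarrow> (\<integral>\<^sup>+x\<in>{s..t}. ennreal (g x) \<partial>lborel) = ennreal (G t - G s)"
    and ab: "0 \<le> \<alpha>" "\<alpha> < \<beta>"
  shows "negligible {t. g t < \<alpha> \<and>
    (\<forall>e>0. \<exists>u v. u \<le> t \<and> t \<le> v \<and> u < v \<and> v - u < e \<and> \<beta> * (v - u) < G v - G u)}" (is "negligible ?S")
proof -
  have B0: "0 \<le> B" using g_range[of 0] by linarith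
  \<comment> \<open>Vitali covering argument. Intervals on which G has slope above \<beta> cover
    \<open>?S\<close> finely. Disjoint ones, chosen inside an open set U that exceeds {g < \<alpha>}
    by little, have a union W with \<beta>|W| \<le> \<nu>(W) \<le> \<alpha>|W| + B e', which forces
    |W| to be small. Intersecting with a ball keeps |W| finite, so that \<alpha>|W| can be
    subtracted.\<close>
  have "negligible (?S \<inter> ball 0 R)" for R :: real
    unfolding negligible_outer_le
  proof (intro allI impI)
    fix e :: real assume e: "0 < e"
    \<comment> \<open>Tolerance for the part of W outside {g < \<alpha>}: it makes B e' at most
      (\<beta> - \<alpha>) e. The summand 1 covers B = 0.\<close>
    define e' where "e' = e * (\<beta> - \<alpha>) / (B + 1)"
    have e': "0 < e'" using e ab B0 by (simp add: e'_def)
    have eB: "B * e' \<le> (\<beta> - \<alpha>) * e"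
      using e ab B0 by (simp add: e'_def divide_simps mult_ac mult_left_mono)
    define A where "A = {t. g t < \<alpha>}"
    have A[measurable]: "A \<in> sets borel" by (simp add: A_def)
    obtain U where U: "open U" "A \<subseteq> U" "emeasure lborel (U - A) < e'"
      using outer_regular_lborel[OF A e'] by auto
    define V where "V = U \<inter> ball 0 R"
    have V: "open V" using U by (auto simp: V_def)
    define K where "K = {(u, v). u < v \<and> {u..v} \<subseteq> V \<and> \<beta> * (v - u) < G v - G u}"
    define a where "a = (\<lambda>(u, v). (u + v) / 2 :: real)"
    define r where "r = (\<lambda>(u, v). (v - u) / 2 :: real)"
    have cb: "cball (a p) (r p) = {fst p..snd p}" for p
      by (auto simp: a_def r_def cball_eq_atLeastAtMost split: prod.split) (simp_all add: field_simps)
    have pos: "0 < r p" if "p \<in> K" for p using that by (auto simp: K_def r_def)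
    have fine: "\<exists>p. p \<in> K \<and> x \<in> cball (a p) (r p) \<and> r p < d"
      if x: "x \<in> ?S \<inter> ball 0 R" and d: "0 < d" for x d
    proof -
      have "x \<in> V" using x U by (auto simp: V_def A_def)
      with V obtain d' where d': "0 < d'" "ball x d' \<subseteq> V" by (auto simp: open_contains_ball)
      from x d d' obtain u v where uv: "u \<le> x" "x \<le> v" "u < v" "v - u < min d d'" "\<beta> * (v - u) < G v - G u"
        by (auto dest!: spec[of _ "min d d'"])
      have "{u..v} \<subseteq> ball x d'" using uv by (auto simp: dist_real_def)
      then have "(u, v) \<in> K" using uv d' by (auto simp: K_def)
      moreover have "r (u, v) < d" using uv by (auto simp: r_def)
      ultimately show ?thesis using uv by (intro exI[of _ "(u, v)"]) (auto simp: cb)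
    qed
    obtain C where C: "countable C" "C \<subseteq> K" "pairwise (\<lambda>i j. disjnt (cball (a i) (r i)) (cball (a j) (r j))) C"
      "negligible (?S \<inter> ball 0 R - (\<Union>i\<in>C. cball (a i) (r i)))"
      by (rule Vitali_covering_theorem_cballs[OF pos fine])
    define W where "W = (\<Union>i\<in>C. cball (a i) (r i))"
    have W[measurable]: "W \<in> sets borel" using C(1) unfolding W_def by (intro sets.countable_UN') auto
    have WV: "W \<subseteq> V"
    proof
      fix x assume "x \<in> W"
      then obtain p where "p \<in> C" "x \<in> {fst p..snd p}" by (auto simp: W_def cb)
      moreover have "{fst p..snd p} \<subseteq> V" using subsetD[OF C(2) \<open>p \<in> C\<close>] by (auto simp: K_def)
      ultimately show "x \<in> V" by blast
    qed
    have Wfin: "emeasure lborel W < \<infinity>"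
    proof -
      have "emeasure lborel W \<le> emeasure lborel (ball 0 R :: real set)"
        using WV by (intro emeasure_mono) (auto simp: V_def)
      also have "\<dots> < \<infinity>" by (rule emeasure_lborel_ball_finite)
      finally show ?thesis .
    qed
    define \<nu> where "\<nu> = density lborel (\<lambda>x. ennreal (g x))"
    have sets_nu[measurable_cong]: "sets \<nu> = sets borel" by (simp add: \<nu>_def)
    have disj: "disjoint_family_on (\<lambda>i. cball (a i) (r i)) C"
      using C(3) by (auto simp: disjoint_family_on_def pairwise_def disjnt_def)
    have "ennreal \<beta> * emeasure lborel W = (\<integral>\<^sup>+i. ennreal \<beta> * emeasure lborel (cball (a i) (r i)) \<partial>count_space C)"
      unfolding W_def using disj C(1) by (subst emeasure_UN_countable) (auto simp: nn_integral_cmult)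
    also have "\<dots> \<le> (\<integral>\<^sup>+i. emeasure \<nu> (cball (a i) (r i)) \<partial>count_space C)"
    proof (intro nn_integral_mono, simp)
      fix i assume "i \<in> C"
      then obtain u v where i: "i = (u, v)" "u < v" "\<beta> * (v - u) < G v - G u"
        using C(2) by (cases i) (auto simp: K_def)
      have "ennreal \<beta> * emeasure lborel {u..v} = ennreal (\<beta> * (v - u))"
        using i ab by (simp add: ennreal_mult)
      also have "\<dots> \<le> ennreal (G v - G u)" using i by (intro ennreal_leI) simp
      also have "\<dots> = emeasure \<nu> {u..v}" unfolding \<nu>_def using G[of u v] i
        by (simp add: emeasure_density)
      finally show "ennreal \<beta> * emeasure lborel (cball (a i) (r i)) \<le> emeasure \<nu> (cball (a i) (r i))"
        by (simp add: cb i)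
    qed
    also have "\<dots> = emeasure \<nu> W"
      unfolding W_def using disj C(1) by (subst emeasure_UN_countable) (auto simp: sets_nu)
    also have "\<dots> \<le> emeasure \<nu> ((W \<inter> A) \<union> (U - A))"
      using WV U by (intro emeasure_mono) (auto simp: sets_nu V_def)
    also have "\<dots> \<le> emeasure \<nu> (W \<inter> A) + emeasure \<nu> (U - A)"
      using U by (intro emeasure_subadditive) (auto simp: sets_nu)
    also have "emeasure \<nu> (W \<inter> A) = (\<integral>\<^sup>+x. ennreal (g x) * indicator (W \<inter> A) x \<partial>lborel)"
      unfolding \<nu>_def by (subst emeasure_density) auto
    also have "\<dots> \<le> (\<integral>\<^sup>+x. ennreal \<alpha> * indicator W x \<partial>lborel)"
      by (intro nn_integral_mono) (auto simp: A_def split: split_indicator intro!: ennreal_leI)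
    also have "\<dots> = ennreal \<alpha> * emeasure lborel W" by (simp add: nn_integral_cmult_indicator)
    also have "emeasure \<nu> (U - A) = (\<integral>\<^sup>+x. ennreal (g x) * indicator (U - A) x \<partial>lborel)"
      unfolding \<nu>_def using U by (subst emeasure_density) auto
    also have "\<dots> \<le> (\<integral>\<^sup>+x. ennreal B * indicator (U - A) x \<partial>lborel)"
      using g_range by (intro nn_integral_mono) (auto split: split_indicator intro!: ennreal_leI)
    also have "\<dots> = ennreal B * emeasure lborel (U - A)" using U by (subst nn_integral_cmult_indicator) auto
    also have "\<dots> \<le> ennreal B * ennreal e'" using U by (intro mult_left_mono) auto
    also have "\<dots> = ennreal (B * e')" using B0 e' by (simp add: ennreal_mult)
    finally have *: "ennreal \<beta> * emeasure lborel W \<le> ennreal \<alpha> * emeasure lborel W + ennreal (B * e')"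
      by (auto simp: add_left_mono)
    define w where "w = measure lborel W"
    have w: "emeasure lborel W = ennreal w" "0 \<le> w" using Wfin
      by (auto simp: w_def emeasure_eq_ennreal_measure)
    have "\<beta> * w \<le> \<alpha> * w + B * e'"
      using * w ab B0 e' by (simp add: ennreal_mult[symmetric] ennreal_plus[symmetric] ennreal_le_iff del: ennreal_plus)
    then have "(\<beta> - \<alpha>) * w \<le> (\<beta> - \<alpha>) * e" using eB by (simp add: algebra_simps)
    then have we: "w \<le> e" using ab by simp
    \<comment> \<open>\<open>T\<close> is the measurable W plus a negligible remainder; the outer
      criterion for negligibility thereby bypasses the question whether \<open>?S\<close> is
      measurable.\<close>
    define T where "T = W \<union> (?S \<inter> ball 0 R - W)"
    have neg: "negligible (?S \<inter> ball 0 R - W)" using C(4) by (simp add: W_def)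
    have Wl: "W \<in> lmeasurable" using Wfin by (simp add: fmeasurable_def)
    have "T \<in> lmeasurable" unfolding T_def by (rule fmeasurable.Un[OF Wl negligible_imp_measurable[OF neg]])
    moreover have "measure lebesgue T = measure lebesgue W"
      unfolding T_def
      by (rule measure_Un_null_set[OF fmeasurableD[OF Wl] neg[unfolded negligible_iff_null_sets]])
    ultimately show "\<exists>T. ?S \<inter> ball 0 R \<subseteq> T \<and> T \<in> lmeasurable \<and> measure lebesgue T \<le> e"
      using we by (intro exI[of _ T]) (auto simp: T_def w_def)
  qed
  then have "negligible (\<Union>n::nat. ?S \<inter> ball 0 (real n))" by (intro negligible_countable_Union) auto
  moreover have "(\<Union>n::nat. ?S \<inter> ball 0 (real n)) = ?S"
    by (auto simp: dist_norm) (metis reals_Archimedean2)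
  ultimately show ?thesis by (simp only:)
qed


text \<open>If the bound fails at t for some \<epsilon>, rationals with g t < \<alpha> < \<beta> < g
  t + \<epsilon> place t in one of countably many negligible sets. The intervals are only required
  to contain t, so both one-sided difference quotients are covered.\<close>

lemma AE_upper_derivate_le:
  fixes g G :: "real \<Rightarrow> real"
  assumes g[measurable]: "g \<in> borel_measurable borel"
    and g_range: "\<And>t. 0 \<le> g t" "\<And>t. g t \<le> B"
    and G: "\<And>s t. s \<le> t \<Longrightarrow> (\<integral>\<^sup>+x\<in>{s..t}. ennreal (g x) \<partial>lborel) = ennreal (G t - G s)"
  shows "AE t in lborel. \<forall>\<epsilon>>0. \<exists>e>0. \<forall>u v. u \<le> t \<and> t \<le> v \<and> u < v \<and> v - u < e \<longrightarrow>
    G v - G u \<le> (g t + \<epsilon>) * (v - u)"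
proof -
  define S where "S \<alpha> \<beta> = {t. g t < \<alpha> \<and>
    (\<forall>e>0. \<exists>u v. u \<le> t \<and> t \<le> v \<and> u < v \<and> v - u < e \<and> \<beta> * (v - u) < G v - G u)}" for \<alpha> \<beta>
  define Q where "Q = {(\<alpha>, \<beta>). \<alpha> \<in> \<rat> \<and> \<beta> \<in> \<rat> \<and> 0 \<le> \<alpha> \<and> \<alpha> < (\<beta>::real)}"
  have "Q \<subseteq> \<rat> \<times> \<rat>" by (auto simp: Q_def)
  then have Q: "countable Q" by (rule countable_subset) (intro countable_SIGMA countable_rat)
  have neg: "negligible (S \<alpha> \<beta>)" if "(\<alpha>, \<beta>) \<in> Q" for \<alpha> \<beta>
    unfolding S_def using that by (intro negligible_upper_derivate_exceeds[OF g g_range G]) (auto simp: Q_def)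
  have "(\<Union>p\<in>Q. S (fst p) (snd p)) \<in> null_sets lebesgue"
    using Q neg by (intro null_sets_UN') (auto simp: negligible_iff_null_sets)
  then have "AE t in completion lborel. t \<notin> (\<Union>p\<in>Q. S (fst p) (snd p))" by (rule AE_not_in)
  then have "AE t in lborel. t \<notin> (\<Union>p\<in>Q. S (fst p) (snd p))" by (simp only: AE_completion_iff)
  then show ?thesis
  proof (rule AE_mp, intro AE_I2 impI allI)
    fix t \<epsilon> :: real assume t: "t \<notin> (\<Union>p\<in>Q. S (fst p) (snd p))" and \<epsilon>: "0 < \<epsilon>"
    obtain \<beta> where \<beta>: "\<beta> \<in> \<rat>" "g t < \<beta>" "\<beta> < g t + \<epsilon>"
      using Rats_dense_in_real[of "g t" "g t + \<epsilon>"] \<epsilon> by auto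
    obtain \<alpha> where \<alpha>: "\<alpha> \<in> \<rat>" "g t < \<alpha>" "\<alpha> < \<beta>" using Rats_dense_in_real[OF \<beta>(2)] by auto
    have "(\<alpha>, \<beta>) \<in> Q" using \<alpha> \<beta> g_range(1)[of t] by (auto simp: Q_def)
    then have "t \<notin> S \<alpha> \<beta>" using t by force
    then obtain e where e: "e > 0"
      "\<And>u v. u \<le> t \<Longrightarrow> t \<le> v \<Longrightarrow> u < v \<Longrightarrow> v - u < e \<Longrightarrow> G v - G u \<le> \<beta> * (v - u)"
      using \<alpha> unfolding S_def mem_Collect_eq by (metis not_less)
    show "\<exists>e>0. \<forall>u v. u \<le> t \<and> t \<le> v \<and> u < v \<and> v - u < e \<longrightarrow> G v - G u \<le> (g t + \<epsilon>) * (v - u)"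
    proof (intro exI[of _ e] conjI allI impI e(1))
      fix u v assume uv: "u \<le> t \<and> t \<le> v \<and> u < v \<and> v - u < e"
      then have "G v - G u \<le> \<beta> * (v - u)" by (intro e) auto
      also have "\<dots> \<le> (g t + \<epsilon>) * (v - u)" using \<beta> uv by (intro mult_right_mono) auto
      finally show "G v - G u \<le> (g t + \<epsilon>) * (v - u)" .
    qed
  qed
qed

text \<open>Boundedness of g allows a reflection: B - g is again nonnegative and bounded, with
  primitive B t - G t, and its upper estimate is the lower estimate for G.\<close>

theorem AE_has_real_derivative_nn_integral:
  fixes g G :: "real \<Rightarrow> real"
  assumes g[measurable]: "g \<in> borel_measurable borel"
    and g_range: "\<And>t. 0 \<le> g t" "\<And>t. g t \<le> B"
    and mono: "mono G"
    and G: "\<And>s t. s \<le> t \<Longrightarrow> (\<integral>\<^sup>+x\<in>{s..t}. ennreal (g x) \<partial>lborel) = ennreal (G t - G s)"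
  shows "AE t in lborel. (G has_real_derivative g t) (at t)"
proof -
  have B: "0 \<le> B" using g_range[of 0] by linarith
  have G': "(\<integral>\<^sup>+x\<in>{s..t}. ennreal (B - g x) \<partial>lborel) = ennreal ((B * t - G t) - (B * s - G s))"
    if st: "s \<le> t" for s t
  proof -
    have "(\<integral>\<^sup>+x\<in>{s..t}. ennreal (B - g x) \<partial>lborel) + ennreal (G t - G s)
      = (\<integral>\<^sup>+x\<in>{s..t}. ennreal (B - g x) \<partial>lborel) + (\<integral>\<^sup>+x\<in>{s..t}. ennreal (g x) \<partial>lborel)"
      using G[OF st] by simp
    also have "\<dots> = (\<integral>\<^sup>+x. ennreal (B - g x) * indicator {s..t} x + ennreal (g x) * indicator {s..t} x \<partial>lborel)"
      by (subst nn_integral_add) auto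
    also have "\<dots> = (\<integral>\<^sup>+x. ennreal B * indicator {s..t} x \<partial>lborel)"
      using g_range by (intro nn_integral_cong) (auto split: split_indicator simp flip: ennreal_plus)
    also have "\<dots> = ennreal (B * (t - s))" using st B by (simp add: nn_integral_cmult_indicator ennreal_mult)
    finally have *: "(\<integral>\<^sup>+x\<in>{s..t}. ennreal (B - g x) \<partial>lborel) + ennreal (G t - G s) = ennreal (B * (t - s))" .
    have Gst: "0 \<le> G t - G s" using mono st by (simp add: monoD)
    have "ennreal (G t - G s) \<le> ennreal (B * (t - s))" unfolding *[symmetric] by simp
    then have le: "G t - G s \<le> B * (t - s)" using B st by (subst (asm) ennreal_le_iff) auto
    have "(\<integral>\<^sup>+x\<in>{s..t}. ennreal (B - g x) \<partial>lborel) = ennreal (B * (t - s)) - ennreal (G t - G s)"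
      unfolding *[symmetric] by simp
    also have "\<dots> = ennreal ((B * t - G t) - (B * s - G s))" using Gst le
      by (subst ennreal_minus) (auto simp: algebra_simps)
    finally show ?thesis .
  qed
  have "AE t in lborel. \<forall>\<epsilon>>0. \<exists>e>0. \<forall>u v. u \<le> t \<and> t \<le> v \<and> u < v \<and> v - u < e \<longrightarrow>
    G v - G u \<le> (g t + \<epsilon>) * (v - u)"
    by (rule AE_upper_derivate_le[OF g g_range G])
  moreover have "AE t in lborel. \<forall>\<epsilon>>0. \<exists>e>0. \<forall>u v. u \<le> t \<and> t \<le> v \<and> u < v \<and> v - u < e \<longrightarrow>
    (B * v - G v) - (B * u - G u) \<le> (B - g t + \<epsilon>) * (v - u)"
    using g_range by (intro AE_upper_derivate_le[where B=B, OF _ _ _ G']) auto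
  ultimately show ?thesis
  proof eventually_elim
    case (elim t)
    show ?case unfolding has_field_derivative_iff
    proof (rule LIM_I)
      fix r :: real assume r: "0 < r"
      obtain e1 where e1: "e1 > 0" "\<And>u v. u \<le> t \<Longrightarrow> t \<le> v \<Longrightarrow> u < v \<Longrightarrow> v - u < e1 \<Longrightarrow>
        G v - G u \<le> (g t + r/2) * (v - u)" using elim(1)[rule_format, of "r/2"] r by auto
      obtain e2 where e2: "e2 > 0" "\<And>u v. u \<le> t \<Longrightarrow> t \<le> v \<Longrightarrow> u < v \<Longrightarrow> v - u < e2 \<Longrightarrow>
        (B * v - G v) - (B * u - G u) \<le> (B - g t + r/2) * (v - u)"
        using elim(2)[rule_format, of "r/2"] r by auto
      have two: "\<bar>(G v - G u) - g t * (v - u)\<bar> \<le> r/2 * (v - u)"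
        if "u \<le> t" "t \<le> v" "u < v" "v - u < min e1 e2" for u v
      proof -
        have "G v - G u \<le> (g t + r/2) * (v - u)" using e1(2)[OF that(1-3)] that(4) by simp
        moreover have "(g t + r/2) * (v - u) = g t * (v - u) + r/2 * (v - u)" by (simp only: ring_distribs)
        ultimately have le: "(G v - G u) - g t * (v - u) \<le> r/2 * (v - u)" by linarith
        have "(B * v - G v) - (B * u - G u) \<le> (B - g t + r/2) * (v - u)" using e2(2)[OF that(1-3)] that(4) by simp
        moreover have "(B - g t + r/2) * (v - u) = B * v - B * u - g t * (v - u) + r/2 * (v - u)"
          by (simp only: ring_distribs)
        ultimately have "- ((G v - G u) - g t * (v - u)) \<le> r/2 * (v - u)" by linarith
        with le show ?thesis by (rule abs_leI)
      qed
      show "\<exists>s>0. \<forall>x. x \<noteq> t \<and> norm (x - t) < s \<longrightarrow> norm ((G x - G t) / (x - t) - g t) < r"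
      proof (intro exI[of _ "min e1 e2"] conjI allI impI)
        fix x assume x: "x \<noteq> t \<and> norm (x - t) < min e1 e2"
        have "\<bar>(G x - G t) - g t * (x - t)\<bar> \<le> r/2 * \<bar>x - t\<bar>"
        proof (cases "x < t")
          case True
          have "(G x - G t) - g t * (x - t) = - ((G t - G x) - g t * (t - x))" by (simp add: algebra_simps)
          then show ?thesis using two[of x t] x True by (simp only: abs_minus_cancel) simp
        next
          case False
          then show ?thesis using two[of t x] x by simp
        qed
        moreover have "(G x - G t) / (x - t) - g t = ((G x - G t) - g t * (x - t)) / (x - t)"
          using x by (simp add: field_simps)
        ultimately have "norm ((G x - G t) / (x - t) - g t) \<le> r/2"
          using x by (simp add: abs_divide divide_le_eq)
        then show "norm ((G x - G t) / (x - t) - g t) < r" using r by linarith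
      qed (use e1 e2 in auto)
    qed
  qed
qed

text \<open>The forward difference quotients of G are bounded by L and converge to k almost
  everywhere, so their integrals converge to that of k. The same integrals are differences of
  averages of the continuous G over short intervals starting at q and at p, hence tend to G q - G p.
  The margin from q to \<open>q'\<close> is the room for the forward step.\<close>

lemma lipschitz_AE_FTC:
  fixes G k :: "real \<Rightarrow> real"
  assumes L: "L-lipschitz_on {p..q'} G" and pq: "p \<le> q" "q < q'"
    and k[measurable]: "k \<in> borel_measurable borel"
    and deriv: "AE t in lborel. t \<in> {p<..<q} \<longrightarrow> (G has_real_derivative k t) (at t)"
  shows "set_integrable lborel {p..q} k" "(LINT t:{p..q}|lborel. k t) = G q - G p"
proof -
  \<comment> \<open>Constant continuation of G, continuous on the whole line; its antiderivative
    \<Phi> on the enlarged interval has two-sided derivatives even at p and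
    \<open>q'\<close>.\<close>
  define H where "H t = G (max p (min q' t))" for t
  have contH: "continuous_on UNIV H"
    unfolding H_def using pq
    by (intro continuous_on_compose2[OF lipschitz_on_continuous_on[OF L]] continuous_intros) auto
  have [measurable]: "H \<in> borel_measurable borel" by (rule borel_measurable_continuous_onI[OF contH])
  have HG: "H t = G t" if "t \<in> {p..q'}" for t using that by (simp add: H_def)
  obtain \<Phi> where \<Phi>0: "\<And>x. x \<in> {p-1..q'+1} \<Longrightarrow> (\<Phi> has_vector_derivative H x) (at x within {p-1..q'+1})"
    using antiderivative_continuous[of "p-1" "q'+1" H] contH continuous_on_subset by blast
  have \<Phi>: "(\<Phi> has_real_derivative H x) (at x)" if "x \<in> {p..q'}" for x
    using \<Phi>0[of x] that at_within_interior[of x "{p-1..q'+1}"]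
    by (auto simp: has_real_derivative_iff_has_vector_derivative)
  define e where "e n = (q' - q) / real (Suc n)" for n
  have e: "0 < e n" "e n \<le> q' - q" for n using pq by (auto simp: e_def divide_le_eq)
  have elim: "e \<longlonglongrightarrow> 0" unfolding e_def by (rule LIMSEQ_Suc[OF lim_const_over_n])
  have elim': "filterlim e (at 0) sequentially"
    using elim e by (auto simp: filterlim_at eventually_sequentially intro!: exI[of _ 0]) (metis less_irrefl)
  define f where "f n t = indicator {p..q} t * ((H (t + e n) - H t) / e n)" for n t
  have int_f: "(LINT t|lborel. f n t) = (\<Phi> (q + e n) - \<Phi> q) / e n - (\<Phi> (p + e n) - \<Phi> p) / e n" for n
  proof -
    have "(LINT t|lborel. ((H (t + e n) - H t) / e n) * indicator {p..q} t)
      = (\<Phi> (q + e n) - \<Phi> q) / e n - (\<Phi> (p + e n) - \<Phi> p) / e n"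
    proof (rule integral_FTC_Icc_real[OF pq(1)])
      fix x assume x: "p \<le> x" "x \<le> q"
      have "((\<lambda>t. \<Phi> (t + e n)) has_real_derivative H (x + e n)) (at x)"
        using DERIV_shift[of \<Phi> "H (x + e n)" x "e n"] \<Phi>[of "x + e n"] x e[of n] pq by auto
      moreover have "(\<Phi> has_real_derivative H x) (at x)" using \<Phi>[of x] x pq by auto
      ultimately show "((\<lambda>t. (\<Phi> (t + e n) - \<Phi> t) / e n) has_real_derivative (H (x + e n) - H x) / e n) (at x)"
        by (intro DERIV_cdivide DERIV_diff)
      show "isCont (\<lambda>t. (H (t + e n) - H t) / e n) x"
        using contH e(1)[of n] by (intro continuous_intros isCont_o2[of _ "\<lambda>t. t + e n" H]) 
          (auto simp: continuous_on_eq_continuous_at)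
    qed
    then show ?thesis by (simp add: f_def mult.commute)
  qed
  have dq: "(\<lambda>n. (\<Phi> (x + e n) - \<Phi> x) / e n) \<longlonglongrightarrow> H x" if "x \<in> {p..q'}" for x
    using \<Phi>[OF that] unfolding DERIV_def by (rule filterlim_compose[OF _ elim'])
  have lim1: "(\<lambda>n. LINT t|lborel. f n t) \<longlonglongrightarrow> H q - H p"
    unfolding int_f using pq by (intro tendsto_diff dq) auto
  have conv: "AE t in lborel. (\<lambda>n. f n t) \<longlonglongrightarrow> indicator {p..q} t * k t"
  proof -
    have "AE t in lborel. t \<noteq> p \<and> t \<noteq> q"
      using AE_lborel_singleton[of p] AE_lborel_singleton[of q] by auto
    with deriv show ?thesis
    proof eventually_elim
      case (elim t)
      show ?case
      proof (cases "t \<in> {p<..<q}")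
        case True
        then have "(G has_real_derivative k t) (at t)" using elim by auto
        moreover have "eventually (\<lambda>s. s \<in> {p<..<q'}) (nhds t)"
          using True pq by (intro eventually_nhds_in_open) auto
        then have "eventually (\<lambda>s. G s = H s) (nhds t)" by eventually_elim (simp add: HG)
        ultimately have "(H has_real_derivative k t) (at t)"
          using DERIV_cong_ev[of t t G H "k t" "k t"] by auto
        then have "(\<lambda>n. (H (t + e n) - H t) / e n) \<longlonglongrightarrow> k t"
          unfolding DERIV_def by (rule filterlim_compose[OF _ elim'])
        then show ?thesis unfolding f_def by (intro tendsto_intros)
      next
        case False
        then show ?thesis using elim by (auto simp: f_def indicator_def)
      qed
    qed
  qed
  have L0: "0 \<le> L" using lipschitz_on_nonneg[OF L] .
  have bound: "AE t in lborel. norm (f n t) \<le> L * indicator {p..q} t" for n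
  proof (intro AE_I2)
    fix t :: real
    show "norm (f n t) \<le> L * indicator {p..q} t"
    proof (cases "t \<in> {p..q}")
      case True
      then have "dist (G (t + e n)) (G t) \<le> L * dist (t + e n) t"
        using e[of n] by (intro lipschitz_onD[OF L]) auto
      then have "\<bar>G (t + e n) - G t\<bar> \<le> L * e n" using e[of n] by (simp add: dist_real_def)
      then show ?thesis using True e[of n] HG[of t] HG[of "t + e n"] pq by (simp add: f_def divide_le_eq)
    qed (simp add: f_def)
  qed
  have dom: "integrable lborel (\<lambda>t. L * indicator {p..q} t :: real)"
    by (intro integrable_mult_right integrable_real_indicator) (simp_all add: emeasure_lborel_Icc_eq)
  have fm: "f n \<in> borel_measurable lborel" for n unfolding f_def by measurable
  have km: "(\<lambda>t. indicator {p..q} t * k t) \<in> borel_measurable lborel" by measurable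
  have "integrable lborel (\<lambda>t. indicator {p..q} t * k t)"
    by (rule integrable_dominated_convergence[OF km fm dom conv bound])
  then show "set_integrable lborel {p..q} k" by (simp add: set_integrable_def)
  have "(\<lambda>n. LINT t|lborel. f n t) \<longlonglongrightarrow> (LINT t|lborel. indicator {p..q} t * k t)"
    by (rule integral_dominated_convergence[OF km fm dom conv bound])
  then have "(LINT t|lborel. indicator {p..q} t * k t) = H q - H p" using lim1 by (rule LIMSEQ_unique)
  then show "(LINT t:{p..q}|lborel. k t) = G q - G p"
    using pq HG by (simp add: set_lebesgue_integral_def)
qed

text \<open>A countable description: rational slopes and reciprocal integers replace the limit, so
  that for continuous f the set of differentiability points arises from closed sets by countable
  operations. For the converse, the slopes \<open>p n\<close> form a Cauchy sequence whose limit is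
  the derivative.\<close>

lemma differentiable_iff_rational_slopes:
  fixes f :: "real \<Rightarrow> real"
  shows "(\<exists>D. (f has_real_derivative D) (at t)) \<longleftrightarrow>
    (\<forall>n::nat. \<exists>m::nat. \<exists>p\<in>\<rat>. \<forall>h. \<bar>h\<bar> < 1 / Suc m \<longrightarrow> \<bar>f (t + h) - f t - p * h\<bar> \<le> \<bar>h\<bar> / Suc n)"
  (is "?L \<longleftrightarrow> ?R")
proof
  assume ?L
  then obtain D where D: "(f has_real_derivative D) (at t)" by auto
  show ?R
  proof
    fix n :: nat
    define \<epsilon> where "\<epsilon> = 1 / real (Suc n) / 2"
    have \<epsilon>: "0 < \<epsilon>" "1 / real (Suc n) = 2 * \<epsilon>" by (simp_all add: \<epsilon>_def del: of_nat_Suc)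
    obtain s where s: "s > 0" "\<And>h. h \<noteq> 0 \<Longrightarrow> \<bar>h\<bar> < s \<Longrightarrow> \<bar>(f (t + h) - f t) / h - D\<bar> < \<epsilon>"
      using LIM_D[OF D[unfolded DERIV_def] \<epsilon>(1)] by auto
    obtain p where p: "p \<in> \<rat>" "D < p" "p < D + \<epsilon>" using Rats_dense_in_real[of D "D + \<epsilon>"] \<epsilon> by auto
    obtain m where m: "1 / real (Suc m) < s" using s(1) nat_approx_posE by blast
    have "\<bar>f (t + h) - f t - p * h\<bar> \<le> \<bar>h\<bar> / Suc n" if h: "\<bar>h\<bar> < 1 / Suc m" for h
    proof (cases "h = 0")
      case False
      have "f (t + h) - f t - p * h = ((f (t + h) - f t) / h - D - (p - D)) * h" using False by (simp add: field_simps)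
      also have "\<bar>\<dots>\<bar> = \<bar>(f (t + h) - f t) / h - D - (p - D)\<bar> * \<bar>h\<bar>" by (rule abs_mult)
      also have "\<dots> \<le> (2 * \<epsilon>) * \<bar>h\<bar>" using s(2)[of h] False h m p by (intro mult_right_mono) linarith+
      also have "\<dots> = \<bar>h\<bar> / Suc n" using \<epsilon>(2) by (metis times_divide_eq_left mult_1)
      finally show ?thesis .
    qed simp
    then show "\<exists>m::nat. \<exists>p\<in>\<rat>. \<forall>h. \<bar>h\<bar> < 1 / Suc m \<longrightarrow> \<bar>f (t + h) - f t - p * h\<bar> \<le> \<bar>h\<bar> / Suc n"
      using p(1) by (intro exI[of _ m] bexI[of _ p]) auto
  qed
next
  assume ?R
  then obtain m p where mp: "\<And>n h. \<bar>h\<bar> < 1 / real (Suc (m n)) \<Longrightarrow> \<bar>f (t + h) - f t - p n * h\<bar> \<le> \<bar>h\<bar> / real (Suc n)"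
    by metis
  have q: "\<bar>(f (t + h) - f t) / h - p n\<bar> \<le> 1 / real (Suc n)" if "h \<noteq> 0" "\<bar>h\<bar> < 1 / real (Suc (m n))" for h n
  proof -
    have "(f (t + h) - f t) / h - p n = (f (t + h) - f t - p n * h) / h" using that by (simp add: field_simps)
    also have "\<bar>\<dots>\<bar> = \<bar>f (t + h) - f t - p n * h\<bar> / \<bar>h\<bar>" by (rule abs_divide)
    also have "\<dots> \<le> (\<bar>h\<bar> / real (Suc n)) / \<bar>h\<bar>" using mp[OF that(2)] by (intro divide_right_mono) auto
    finally show ?thesis using that by simp
  qed
  \<comment> \<open>Both slopes are compared with the difference quotient at one common small h >
    0.\<close>
  have pp: "\<bar>p n - p k\<bar> \<le> 1 / real (Suc n) + 1 / real (Suc k)" for n k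
  proof -
    have "0 < 1 / real (Suc (m n))" "0 < 1 / real (Suc (m k))" by simp_all
    from field_lbound_gt_zero[OF this] obtain h where
      "0 < h" "h < 1 / real (Suc (m n))" "h < 1 / real (Suc (m k))" by blast
    then have h: "h \<noteq> 0" "\<bar>h\<bar> < 1 / real (Suc (m n))" "\<bar>h\<bar> < 1 / real (Suc (m k))" by (simp_all only: abs_of_pos)
    show ?thesis using q[OF h(1) h(2)] q[OF h(1) h(3)] by linarith
  qed
  have inv0: "(\<lambda>n. 1 / real (Suc n)) \<longlonglongrightarrow> 0" using LIMSEQ_Suc[OF lim_1_over_n] by simp
  have "Cauchy p"
  proof (rule metric_CauchyI)
    fix e :: real assume "0 < e"
    then obtain N where N: "1 / real (Suc N) < e / 2" using nat_approx_posE[of "e/2"] by auto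
    have "dist (p n) (p k) < e" if "n \<ge> N" "k \<ge> N" for n k
    proof -
      have "1 / real (Suc n) \<le> 1 / real (Suc N)" "1 / real (Suc k) \<le> 1 / real (Suc N)"
        using that by (auto simp: divide_simps)
      then show ?thesis using pp[of n k] N by (simp add: dist_real_def)
    qed
    then show "\<exists>M. \<forall>m\<ge>M. \<forall>n\<ge>M. dist (p m) (p n) < e" by blast
  qed
  then obtain D where D: "p \<longlonglongrightarrow> D" by (metis Cauchy_convergent convergent_def)
  have pD: "\<bar>p n - D\<bar> \<le> 1 / real (Suc n)" for n
  proof (rule LIMSEQ_le)
    show "(\<lambda>k. \<bar>p n - p k\<bar>) \<longlonglongrightarrow> \<bar>p n - D\<bar>" by (intro tendsto_intros D)
    show "(\<lambda>k. 1 / real (Suc n) + 1 / real (Suc k)) \<longlonglongrightarrow> 1 / real (Suc n)"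
      using tendsto_add[OF tendsto_const inv0] by simp
  qed (use pp in auto)
  have "(f has_real_derivative D) (at t)" unfolding DERIV_def
  proof (rule LIM_I)
    fix r :: real assume "0 < r"
    then obtain N where N: "1 / real (Suc N) < r / 2" using nat_approx_posE[of "r/2"] by auto
    show "\<exists>s>0. \<forall>h. h \<noteq> 0 \<and> norm (h - 0) < s \<longrightarrow> norm ((f (t + h) - f t) / h - D) < r"
    proof (intro exI[of _ "1 / real (Suc (m N))"] conjI allI impI)
      fix h :: real assume "h \<noteq> 0 \<and> norm (h - 0) < 1 / real (Suc (m N))"
      then show "norm ((f (t + h) - f t) / h - D) < r" using q[of h N] pD[of N] N by auto
    qed simp
  qed
  then show ?L by auto
qed

text \<open>\<open>c_delta\<close> is written with \<open>deriv\<close>, and \<open>lborel\<close>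
  is not complete, so equality almost everywhere with a Borel function does not make it measurable;
  measurability of \<open>deriv\<close> itself is required. On the Borel set of differentiability
  points it is a limit of difference quotients, elsewhere it is constant.\<close>

lemma borel_measurable_deriv:
  fixes f :: "real \<Rightarrow> real"
  assumes f: "continuous_on UNIV f"
  shows "deriv f \<in> borel_measurable borel"
proof -
  have fs: "continuous_on UNIV (\<lambda>t. f (t + h))" for h
    by (intro continuous_on_compose2[OF f] continuous_intros) auto
  define T where "T n m p = {t. \<forall>h. \<bar>h\<bar> < 1 / real (Suc m) \<longrightarrow> \<bar>f (t + h) - f t - p * h\<bar> \<le> \<bar>h\<bar> / real (Suc n)}"
    for n m :: nat and p :: real
  have "closed (T n m p)" for n m p
    unfolding T_def by (intro closed_Collect_all closed_Collect_imp closed_Collect_le continuous_intros fs f) auto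
  then have T[measurable]: "T n m p \<in> sets borel" for n m p by auto
  define D where "D = {t. \<exists>D. (f has_real_derivative D) (at t)}"
  have "D = (\<Inter>n. \<Union>m. \<Union>p\<in>\<rat>. T n m p)"
    by (rule set_eqI)
      (simp only: D_def mem_Collect_eq differentiable_iff_rational_slopes T_def INT_iff UN_iff UNIV_I ball_UNIV bex_UNIV simp_thms)
  moreover have 1: "(\<Union>p\<in>\<rat>. T n m p) \<in> sets borel" for n m
    by (rule sets.countable_UN''[OF countable_rat]) (rule T)
  have 2: "(\<Union>m. \<Union>p\<in>\<rat>. T n m p) \<in> sets borel" for n
    by (rule sets.countable_UN''[OF countableI_type]) (rule 1)
  have "(\<Inter>n. \<Union>m. \<Union>p\<in>\<rat>. T n m p) \<in> sets borel"
    by (rule sets.countable_INT''[OF _ countableI_type]) (simp, rule 2)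
  ultimately have [measurable]: "D \<in> sets borel" by (simp only:)
  define e where "e n = 1 / real (Suc n)" for n
  have "e \<longlonglongrightarrow> 0" unfolding e_def using LIMSEQ_Suc[OF lim_1_over_n] by simp
  then have elim': "filterlim e (at 0) sequentially"
    by (auto simp: filterlim_at e_def eventually_sequentially)
  \<comment> \<open>\<open>SOME D. False\<close> is the value that \<open>deriv\<close> takes where
    no derivative exists: the predicate chosen from is then empty.\<close>
  have "deriv f = (\<lambda>t. if t \<in> D then lim (\<lambda>n. (f (t + e n) - f t) / e n) else (SOME D. False))"
  proof (rule ext)
    fix t show "deriv f t = (if t \<in> D then lim (\<lambda>n. (f (t + e n) - f t) / e n) else (SOME D. False))"
  proof (cases "t \<in> D")
    case True
    then obtain d where d: "(f has_real_derivative d) (at t)" unfolding D_def by blast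
    have "(f has_real_derivative deriv f t) (at t)" unfolding DERIV_imp_deriv[OF d] by (rule d)
    then have "(\<lambda>n. (f (t + e n) - f t) / e n) \<longlonglongrightarrow> deriv f t"
      unfolding DERIV_def by (rule filterlim_compose[OF _ elim'])
    then show ?thesis using True by (simp add: limI)
  next
    case False
    then have "\<And>d. \<not> (f has_real_derivative d) (at t)" unfolding D_def by blast
    then show ?thesis using False by (simp add: deriv_def)
  qed
  qed
  moreover have [measurable]: "f \<in> borel_measurable borel" by (rule borel_measurable_continuous_onI[OF f])
  then have "(\<lambda>t. (f (t + e n) - f t) / e n) \<in> borel_measurable borel" for n by measurable
  then have "(\<lambda>t. if t \<in> D then lim (\<lambda>n. (f (t + e n) - f t) / e n) else (SOME D. False)) \<in> borel_measurable borel"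
    by (intro measurable_If_set borel_measurable_lim_metric) simp_all
  ultimately show ?thesis by (simp only:)
qed

section \<open>The functions a and b and their primitives\<close>

lemma lipschitz_on_real_derivative_bound:
  fixes f f' :: "real \<Rightarrow> real"
  assumes "convex X" "0 \<le> C"
    and "\<And>x. x \<in> X \<Longrightarrow> (f has_real_derivative f' x) (at x)" "\<And>x. x \<in> X \<Longrightarrow> \<bar>f' x\<bar> \<le> C"
  shows "C-lipschitz_on X f"
proof (rule lipschitz_onI)
  fix x y assume "x \<in> X" "y \<in> X"
  then have "norm (f x - f y) \<le> C * norm (x - y)"
    using assms by (intro field_differentiable_bound[of X f f']) (auto intro: has_field_derivative_at_within)
  then show "dist (f x) (f y) \<le> C * dist x y" by (simp add: dist_norm)
qed (rule assms(2))

lemma lipschitz_on_exp_compose: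
  fixes u :: "real \<Rightarrow> real"
  assumes u: "C-lipschitz_on {p..q} u"
  shows "\<exists>L. L-lipschitz_on {p..q} (\<lambda>t. exp (u t))"
proof -
  have "bounded (u ` {p..q})"
    by (intro compact_imp_bounded compact_continuous_image lipschitz_on_continuous_on[OF u]) auto
  then obtain M where "\<forall>x\<in>u ` {p..q}. norm x \<le> M" unfolding bounded_iff by blast
  then have M: "- M \<le> u t" "u t \<le> M" if "t \<in> {p..q}" for t
    using that by (auto simp: abs_le_iff minus_le_iff)
  have "(exp M)-lipschitz_on {-M..M} (exp :: real \<Rightarrow> real)"
    by (rule lipschitz_on_real_derivative_bound[where f'=exp]) (auto intro!: DERIV_exp)
  then have "(exp M)-lipschitz_on (u ` {p..q}) (exp :: real \<Rightarrow> real)"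
    by (rule lipschitz_on_subset) (use M in auto)
  from lipschitz_on_compose2[OF u this] show ?thesis by blast
qed

text \<open>Here g is a Borel version of the derivative of \<delta>; in the application it is also
  the density of the maximum under any absolutely continuous copula with diagonal \<delta>. Its
  bounds hold everywhere, not just almost everywhere, and it is set to 0 off (0,1).\<close>

locale diagonal_density =
  fixes \<delta> g :: "real \<Rightarrow> real" and d :: nat
  assumes d_ge_2: "2 \<le> d"
    and g_measurable[measurable]: "g \<in> borel_measurable borel"
    and g_nonneg: "\<And>t. 0 \<le> g t"
    and g_le: "\<And>t. g t \<le> real d"
    and g_outside: "\<And>t. t \<notin> {0<..<1} \<Longrightarrow> g t = 0"
    and delta_0: "\<delta> 0 = 0"
    and delta_1: "\<delta> 1 = 1"
    and delta_less: "\<And>t. 0 < t \<Longrightarrow> t < 1 \<Longrightarrow> \<delta> t < t"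
    and delta_mono: "\<And>s t. 0 \<le> s \<Longrightarrow> s \<le> t \<Longrightarrow> t \<le> 1 \<Longrightarrow> \<delta> s \<le> \<delta> t"
    and nn_integral_g: "\<And>s t. 0 \<le> s \<Longrightarrow> s \<le> t \<Longrightarrow> t \<le> 1 \<Longrightarrow>
      (\<integral>\<^sup>+x\<in>{s..t}. ennreal (g x) \<partial>lborel) = ennreal (\<delta> t - \<delta> s)"
    and delta_has_derivative: "AE t in lborel. t \<in> {0<..<1} \<longrightarrow> (\<delta> has_real_derivative g t) (at t)"
begin

abbreviation h :: "real \<Rightarrow> real" where "h \<equiv> h_fun \<delta>"
abbreviation F :: "real \<Rightarrow> real" where "F \<equiv> F_fun d \<delta>"

lemma delta_nonneg: "0 \<le> t \<Longrightarrow> t \<le> 1 \<Longrightarrow> 0 \<le> \<delta> t"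
  using delta_mono[of 0 t] delta_0 by simp

lemma h_pos: "0 < t \<Longrightarrow> t < 1 \<Longrightarrow> 0 < h t"
  using delta_less[of t] by (simp add: h_fun_def)

lemma h_le: "0 \<le> t \<Longrightarrow> t \<le> 1 \<Longrightarrow> h t \<le> t"
  using delta_nonneg[of t] by (simp add: h_fun_def)

lemma delta_lipschitz: "(real d)-lipschitz_on {0..1} \<delta>"
proof -
  have le: "\<delta> t - \<delta> s \<le> real d * (t - s)" if "0 \<le> s" "s \<le> t" "t \<le> 1" for s t
  proof -
    have "ennreal (\<delta> t - \<delta> s) = (\<integral>\<^sup>+x\<in>{s..t}. ennreal (g x) \<partial>lborel)" using nn_integral_g[OF that] ..
    also have "\<dots> \<le> (\<integral>\<^sup>+x\<in>{s..t}. ennreal (real d) \<partial>lborel)"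
      by (intro nn_integral_mono mult_right_mono ennreal_leI g_le) auto
    also have "\<dots> = ennreal (real d * (t - s))" using that by (simp add: nn_integral_cmult_indicator ennreal_mult)
    finally show ?thesis using that by (subst (asm) ennreal_le_iff) auto
  qed
  show ?thesis
  proof (rule lipschitz_onI)
    fix s t :: real assume "s \<in> {0..1}" "t \<in> {0..1}"
    then show "dist (\<delta> s) (\<delta> t) \<le> real d * dist s t"
      using le[of s t] le[of t s] delta_mono[of s t] delta_mono[of t s]
      by (cases "s \<le> t") (auto simp: dist_real_def abs_real_def algebra_simps)
  qed simp
qed

lemma h_lipschitz: "(1 + real d)-lipschitz_on {0..1} h"
  unfolding h_fun_def by (intro lipschitz_on_diff delta_lipschitz lipschitz_on_id)

lemma continuous_on_h: "continuous_on {0..1} h"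
  by (rule lipschitz_on_continuous_on[OF h_lipschitz])

lemma F_has_derivative:
  assumes r: "0 < r" "r < 1"
  shows "(F has_real_derivative (real d - 1) / real d / h r) (at r)"
proof -
  \<comment> \<open>A compact subinterval of (0,1) with r in its interior and 1/2 inside: 1/h is
    continuous there, and the oriented integral from 1/2 stays within it.\<close>
  define p q where "p = min r (1/2) / 2" and "q = (max r (1/2) + 1) / 2"
  have pq: "0 < p" "p < r" "p < 1/2" "r < q" "1/2 < q" "q < 1" using r by (auto simp: p_def q_def)
  have "continuous_on {p..q} (\<lambda>s. 1 / h s)"
  proof (intro continuous_intros continuous_on_subset[OF continuous_on_h] ballI)
    show "h s \<noteq> 0" if "s \<in> {p..q}" for s using h_pos[of s] that pq by auto
  qed (use pq in auto)
  then have "((\<lambda>u. LBINT y=(1/2::real)..u. 1 / h y) has_vector_derivative (1 / h r)) (at r within {p..q})"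
    using pq by (intro interval_integral_FTC2) auto
  then have "((\<lambda>u. LBINT y=(1/2::real)..u. 1 / h y) has_real_derivative (1 / h r)) (at r)"
    using pq at_within_interior[of r "{p..q}"] by (auto simp: has_real_derivative_iff_has_vector_derivative)
  then show ?thesis
    unfolding F_fun_def using DERIV_cmult[of "\<lambda>u. LBINT y=(1/2::real)..u. 1 / h y" "1 / h r" r UNIV "(real d - 1) / real d"]
    by simp
qed

lemma continuous_on_F: "continuous_on {0<..<1} F"
proof (rule continuous_at_imp_continuous_on, rule ballI)
  show "isCont F r" if "r \<in> {0<..<1}" for r using that F_has_derivative[of r] by (auto intro: DERIV_isCont)
qed

lemma F_mono:
  assumes "0 < x" "x \<le> y" "y < 1"
  shows "F x \<le> F y"
  using assms h_pos d_ge_2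
  by (intro DERIV_nonneg_imp_nondecreasing[OF assms(2)]) (auto intro!: exI F_has_derivative divide_nonneg_pos)

lemma F_half: "F (1/2) = 0"
  by (simp add: F_fun_def)

text \<open>Equals h^\<alpha> e^(\<beta> F) on (0,1). The functions a, b, A, Q are all of this kind
  up to a factor in g, so that identities between them reduce to arithmetic of the
  exponents.\<close>

definition expo :: "real \<Rightarrow> real \<Rightarrow> real \<Rightarrow> real" where
  "expo \<alpha> \<beta> t = exp (\<alpha> * ln (h t) + \<beta> * F t)"

text \<open>On a compact subinterval h has a positive minimum m; this makes ln Lipschitz on the
  values of h and bounds the derivative of F by 1/m.\<close>

lemma expo_lipschitz:
  assumes pq: "0 < p" "p \<le> q" "q < 1"
  shows "\<exists>L. L-lipschitz_on {p..q} (expo \<alpha> \<beta>)"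
proof -
  have "continuous_on {p..q} h" using pq by (intro continuous_on_subset[OF continuous_on_h]) auto
  then obtain t0 where t0: "t0 \<in> {p..q}" "\<And>t. t \<in> {p..q} \<Longrightarrow> h t0 \<le> h t"
    using continuous_attains_inf[of "{p..q}" h] pq by auto
  define m where "m = h t0"
  have m: "0 < m" "\<And>t. t \<in> {p..q} \<Longrightarrow> m \<le> h t" using t0 pq h_pos[of t0] by (auto simp: m_def)
  have h: "(1 + real d)-lipschitz_on {p..q} h"
    by (rule lipschitz_on_subset[OF h_lipschitz]) (use pq in auto)
  have "(1 / m)-lipschitz_on {m..} ln"
    using m by (intro lipschitz_on_real_derivative_bound[where f'="\<lambda>x. 1 / x"])
      (auto intro!: DERIV_ln_divide divide_left_mono)
  then have "(1 / m)-lipschitz_on (h ` {p..q}) ln"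
    by (rule lipschitz_on_subset) (use m in auto)
  from lipschitz_on_compose2[OF h this]
  have 1: "((1 / m) * (1 + real d))-lipschitz_on {p..q} (\<lambda>t. ln (h t))" .
  have 2: "(1 / m)-lipschitz_on {p..q} F"
  proof (rule lipschitz_on_real_derivative_bound)
    fix t assume t: "t \<in> {p..q}"
    show "(F has_real_derivative (real d - 1) / real d / h t) (at t)"
      using t pq by (intro F_has_derivative) auto
    have "(real d - 1) / real d / h t \<le> 1 / m"
      using m(2)[OF t] m(1) d_ge_2 by (intro frac_le) auto
    then show "\<bar>(real d - 1) / real d / h t\<bar> \<le> 1 / m"
      using m(2)[OF t] m(1) d_ge_2 by (simp add: abs_of_nonneg)
  qed (use m in auto)
  have "(\<bar>\<alpha>\<bar> * ((1 / m) * (1 + real d)) + \<bar>\<beta>\<bar> * (1 / m))-lipschitz_on {p..q} (\<lambda>t. \<alpha> * ln (h t) + \<beta> * F t)"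
    by (intro lipschitz_on_add lipschitz_on_cmult_real 1 2)
  then show ?thesis unfolding expo_def by (rule lipschitz_on_exp_compose)
qed

text \<open>From h' = 1 - g and F' = (d-1)/(d h). For (\<alpha>, \<beta>) = (1/d, 1) the bracket is
  1 - g/d, for (1 - 1/d, -1) it is -(d-1) g/d; these are the cases of A and Q, whose derivatives
  have constant sign.\<close>

lemma expo_has_derivative:
  "AE t in lborel. t \<in> {0<..<1} \<longrightarrow> (expo \<alpha> \<beta> has_real_derivative
     expo \<alpha> \<beta> t * (\<alpha> * (1 - g t) + \<beta> * ((real d - 1) / real d)) / h t) (at t)"
  using delta_has_derivative
proof eventually_elim
  case (elim t)
  show ?case
  proof
    assume t: "t \<in> {0<..<1}"
    then have D: "(\<delta> has_real_derivative g t) (at t)" using elim by auto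
    have h: "0 < h t" using t h_pos by auto
    have hD: "(h has_real_derivative (1 - g t)) (at t)"
      unfolding h_fun_def by (intro DERIV_diff D DERIV_ident)
    have FD: "(F has_real_derivative (real d - 1) / real d / h t) (at t)" using t by (intro F_has_derivative) auto
    show "(expo \<alpha> \<beta> has_real_derivative
        expo \<alpha> \<beta> t * (\<alpha> * (1 - g t) + \<beta> * ((real d - 1) / real d)) / h t) (at t)"
      unfolding expo_def
      by (rule derivative_eq_intros hD FD h refl)+ (use h d_ge_2 in \<open>simp add: field_simps\<close>)
  qed
qed

text \<open>The sign \<sigma> is 1 or -1 and serves both monotone cases, the increasing A and the
  decreasing Q.\<close>

lemma nn_integral_expo_Icc:
  assumes k[measurable]: "k \<in> borel_measurable borel" and k0: "\<And>t. 0 \<le> k t"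
    and eq: "\<And>t. t \<in> {0<..<1} \<Longrightarrow>
      expo \<alpha> \<beta> t * (\<alpha> * (1 - g t) + \<beta> * ((real d - 1) / real d)) / h t = \<sigma> * k t"
    and s: "\<sigma> * \<sigma> = 1"
    and pq: "0 < p" "p \<le> q" "q < 1"
  shows "(\<integral>\<^sup>+t\<in>{p..q}. ennreal (k t) \<partial>lborel) = ennreal (\<sigma> * (expo \<alpha> \<beta> q - expo \<alpha> \<beta> p))"
proof -
  define q' where "q' = (q + 1) / 2"
  have q': "q < q'" "q' < 1" using pq by (auto simp: q'_def)
  obtain L where L: "L-lipschitz_on {p..q'} (expo \<alpha> \<beta>)" using expo_lipschitz[of p q'] q' pq by auto
  have D: "AE t in lborel. t \<in> {p<..<q} \<longrightarrow> (expo \<alpha> \<beta> has_real_derivative \<sigma> * k t) (at t)"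
    using expo_has_derivative[of \<alpha> \<beta>]
  proof eventually_elim
    case (elim t)
    then show ?case using pq eq[of t] by auto
  qed
  have m: "(\<lambda>t. \<sigma> * k t) \<in> borel_measurable borel" by measurable
  note FTC = lipschitz_AE_FTC[OF L pq(2) q'(1) m D]
  have "set_integrable lborel {p..q} (\<lambda>t. \<sigma> * (\<sigma> * k t))"
    by (rule set_integrable_mult_right) (rule FTC)
  then have i: "set_integrable lborel {p..q} k" using s by (simp add: mult.assoc[symmetric])
  have "(LINT t:{p..q}|lborel. k t) = (LINT t:{p..q}|lborel. \<sigma> * (\<sigma> * k t))"
    using s by (simp add: mult.assoc[symmetric])
  also have "\<dots> = \<sigma> * (expo \<alpha> \<beta> q - expo \<alpha> \<beta> p)" using FTC(2) by (simp only: set_integral_mult_right)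
  finally have e: "(LINT t:{p..q}|lborel. k t) = \<sigma> * (expo \<alpha> \<beta> q - expo \<alpha> \<beta> p)" .
  have "(\<integral>\<^sup>+t\<in>{p..q}. ennreal (k t) \<partial>lborel) = (\<integral>\<^sup>+t. ennreal (indicator {p..q} t * k t) \<partial>lborel)"
    by (intro nn_integral_cong) (auto split: split_indicator)
  also have "\<dots> = ennreal (LINT t:{p..q}|lborel. k t)"
    using i k0 by (subst nn_integral_eq_integral)
      (auto simp: set_integrable_def set_lebesgue_integral_def split: split_indicator)
  finally show ?thesis using e by simp
qed

section \<open>Boundary limits and algebra of the functions \<open>expo\<close>\<close>

lemma tendsto_h_0: "(h \<longlongrightarrow> 0) (at_right 0)"
  and tendsto_h_1: "(h \<longlongrightarrow> 0) (at_left 1)"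
proof -
  have "h 0 = 0" "h 1 = 0" by (simp_all add: h_fun_def delta_0 delta_1)
  then show "(h \<longlongrightarrow> 0) (at_right 0)" "(h \<longlongrightarrow> 0) (at_left 1)"
    using continuous_on_h unfolding continuous_on_def
    by (metis (no_types) at_within_Icc_at_right at_within_Icc_at_left atLeastAtMost_iff order_refl zero_less_one zero_le_one)+
qed

text \<open>F is unbounded near both end points, so only the sign of \<beta> F is used: where it is
  \<le> 0, the function is at most h^\<alpha>, which tends to 0 with h.\<close>

lemma tendsto_expo:
  assumes "(h \<longlongrightarrow> 0) G" "\<alpha> > 0" "eventually (\<lambda>t. 0 < t \<and> t < 1 \<and> \<beta> * F t \<le> 0) G"
  shows "(expo \<alpha> \<beta> \<longlongrightarrow> 0) G"
proof (rule tendsto_sandwich[where f="\<lambda>_. 0" and h="\<lambda>t. h t powr \<alpha>"])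
  show "((\<lambda>t. h t powr \<alpha>) \<longlongrightarrow> 0) G"
  proof (rule tendsto_zero_powrI[OF assms(1) tendsto_const])
    show "eventually (\<lambda>t. 0 \<le> h t) G"
      using assms(3) by eventually_elim (blast intro: h_pos less_imp_le)
  qed (use assms in auto)
  show "eventually (\<lambda>t. expo \<alpha> \<beta> t \<le> h t powr \<alpha>) G"
    using assms(3)
  proof eventually_elim
    case (elim t)
    then have "0 < h t" using h_pos[of t] by auto
    then show ?case using elim by (simp add: expo_def powr_def)
  qed
qed (auto simp: expo_def)

lemma tendsto_expo_0:
  assumes "\<alpha> > 0" "\<beta> \<ge> 0"
  shows "(expo \<alpha> \<beta> \<longlongrightarrow> 0) (at_right 0)"
proof (rule tendsto_expo[OF tendsto_h_0 assms(1)])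
  show "eventually (\<lambda>t. 0 < t \<and> t < 1 \<and> \<beta> * F t \<le> 0) (at_right 0)"
    unfolding eventually_at_right_field
    using F_mono[of _ "1/2"] F_half assms(2) by (intro exI[of _ "1/2"]) (auto simp: mult_nonneg_nonpos)
qed

lemma tendsto_expo_1:
  assumes "\<alpha> > 0" "\<beta> \<le> 0"
  shows "(expo \<alpha> \<beta> \<longlongrightarrow> 0) (at_left 1)"
proof (rule tendsto_expo[OF tendsto_h_1 assms(1)])
  show "eventually (\<lambda>t. 0 < t \<and> t < 1 \<and> \<beta> * F t \<le> 0) (at_left 1)"
    unfolding eventually_at_left_field
    using F_mono[of "1/2" ] F_half assms(2) by (intro exI[of _ "1/2"]) (auto simp: mult_nonpos_nonneg)
qed

lemma expo_mult: "expo \<alpha> \<beta> t * expo \<alpha>' \<beta>' t = expo (\<alpha> + \<alpha>') (\<beta> + \<beta>') t"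
  by (simp add: expo_def exp_add[symmetric] algebra_simps)

lemma expo_power: "expo \<alpha> \<beta> t ^ n = expo (real n * \<alpha>) (real n * \<beta>) t"
  by (simp add: expo_def exp_of_nat_mult[symmetric] algebra_simps)

lemma expo_divide_h: "0 < t \<Longrightarrow> t < 1 \<Longrightarrow> expo \<alpha> \<beta> t / h t = expo (\<alpha> - 1) \<beta> t"
  using h_pos[of t] by (simp add: expo_def exp_add exp_diff algebra_simps)

lemma expo_pos: "0 < expo \<alpha> \<beta> t"
  by (simp add: expo_def)

lemma continuous_on_expo: "continuous_on {0<..<1} (expo \<alpha> \<beta>)"
  unfolding expo_def
proof (intro continuous_intros continuous_on_F continuous_on_subset[OF continuous_on_h] ballI)
  show "h s \<noteq> 0" if "s \<in> {0<..<1}" for s using h_pos[of s] that by auto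
qed auto

lemma borel_measurable_expo[measurable]:
  "(\<lambda>t. if t \<in> {0<..<1} then expo \<alpha> \<beta> t else 0) \<in> borel_measurable borel"
  by (intro borel_measurable_continuous_on_if continuous_on_expo continuous_on_const) auto

lemma borel_measurable_h[measurable]:
  "(\<lambda>t. if t \<in> {0<..<1} then h t else 0) \<in> borel_measurable borel"
  by (intro borel_measurable_continuous_on_if continuous_on_subset[OF continuous_on_h] continuous_on_const) auto

lemma borel_measurable_F[measurable]:
  "(\<lambda>t. if t \<in> {0<..<1} then F t else 0) \<in> borel_measurable borel"
  by (intro borel_measurable_continuous_on_if continuous_on_F continuous_on_const) auto

text \<open>
  Up to a null set, \<open>a\<close> and \<open>b\<close> are the functions of the paper, \<open>A\<close> is the primitive of \<open>a\<close> vanishing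
  at \<open>0\<close> and \<open>Q s\<close> is the integral of \<open>(d - 1) * b * A ^ (d - 2)\<close> over \<open>[s, 1]\<close>.
\<close>

definition a :: "real \<Rightarrow> real" where
  "a t = (real d - g t) / real d * (if t \<in> {0<..<1} then expo (1 / real d - 1) 1 t else 0)"

definition b :: "real \<Rightarrow> real" where
  "b t = g t / real d * (if t \<in> {0<..<1} then expo (1 / real d - 1) (- (real d - 1)) t else 0)"

definition A :: "real \<Rightarrow> real" where
  "A = expo (1 / real d) 1"

definition Q :: "real \<Rightarrow> real" where
  "Q = expo (1 - 1 / real d) (-1)"

lemma a_measurable[measurable]: "a \<in> borel_measurable borel"
  unfolding a_def by measurable

lemma b_measurable[measurable]: "b \<in> borel_measurable borel"
  unfolding b_def by measurable

lemma a_nonneg: "0 \<le> a t"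
  using g_le[of t] by (auto simp: a_def intro!: divide_nonneg_nonneg mult_nonneg_nonneg less_imp_le[OF expo_pos])

lemma b_nonneg: "0 \<le> b t"
  using g_nonneg[of t] by (auto simp: b_def intro!: divide_nonneg_nonneg mult_nonneg_nonneg less_imp_le[OF expo_pos])

text \<open>In the product form, a given coordinate is the maximum at level t with density b times
  one factor A for each of the d - 1 others; the d positions together then give density g.\<close>

lemma b_A_power: "0 < t \<Longrightarrow> t < 1 \<Longrightarrow> b t * A t ^ (d - 1) = g t / real d"
  using d_ge_2 by (simp add: b_def A_def expo_power expo_mult of_nat_diff field_simps) (simp add: expo_def)

text \<open>The density at t of a given coordinate lying below the maximum. With g/d from the case
  that it is the maximum, the total is 1, the uniform density.\<close>

lemma a_Q: "0 < t \<Longrightarrow> t < 1 \<Longrightarrow> a t * Q t = (real d - g t) / real d"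
  using d_ge_2 by (simp add: a_def Q_def expo_mult) (simp add: expo_def)

text \<open>The right-hand side is, almost everywhere, minus the derivative of Q.\<close>

lemma b_A_power2:
  assumes t: "0 < t" "t < 1"
  shows "(real d - 1) * (b t * A t ^ (d - 2)) = (real d - 1) / real d * g t * (Q t / h t)"
proof -
  have e: "expo (1 / real d - 1) (- (real d - 1)) t * A t ^ (d - 2) = Q t / h t"
    unfolding A_def Q_def expo_power expo_mult using t d_ge_2
    by (simp add: expo_divide_h of_nat_diff field_simps)
  have "b t * A t ^ (d - 2) = g t / real d * (expo (1 / real d - 1) (- (real d - 1)) t * A t ^ (d - 2))"
    using t by (simp add: b_def)
  then have "b t * A t ^ (d - 2) = g t / real d * (Q t / h t)" by (simp only: e)
  then show ?thesis by (simp only:) (simp add: field_simps)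
qed

lemma nn_integral_of_Icc_limit:
  fixes k :: "real \<Rightarrow> real" and p q v :: "nat \<Rightarrow> real"
  assumes k[measurable]: "k \<in> borel_measurable borel"
    and int: "\<And>n. (\<integral>\<^sup>+t\<in>{p n..q n}. ennreal (k t) \<partial>lborel) = ennreal (v n)"
    and mono: "\<And>n. p (Suc n) \<le> p n" "\<And>n. q n \<le> q (Suc n)"
    and v: "v \<longlonglongrightarrow> V"
  shows "(\<integral>\<^sup>+t\<in>(\<Union>n. {p n..q n}). ennreal (k t) \<partial>lborel) = ennreal V"
proof -
  define M where "M = density lborel (\<lambda>t. ennreal (k t))"
  have em: "emeasure M S = (\<integral>\<^sup>+t\<in>S. ennreal (k t) \<partial>lborel)" if "S \<in> sets borel" for S
    unfolding M_def using that by (intro emeasure_density) auto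
  have "(\<lambda>n. emeasure M {p n..q n}) \<longlonglongrightarrow> emeasure M (\<Union>n. {p n..q n})"
  proof (rule Lim_emeasure_incseq)
    show "incseq (\<lambda>n. {p n..q n})"
      unfolding incseq_Suc_iff using mono by (auto intro: order_trans)
  qed (auto simp: M_def)
  then have "(\<lambda>n. ennreal (v n)) \<longlonglongrightarrow> emeasure M (\<Union>n. {p n..q n})"
    by (simp add: em int)
  moreover have "(\<lambda>n. ennreal (v n)) \<longlonglongrightarrow> ennreal V" by (intro tendsto_ennrealI v)
  ultimately have "emeasure M (\<Union>n. {p n..q n}) = ennreal V" by (rule LIMSEQ_unique)
  moreover have "(\<Union>n. {p n..q n}) \<in> sets borel" by auto
  ultimately show ?thesis by (simp add: em)
qed

lemma nn_integral_lessThan: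
  fixes k \<Psi> :: "real \<Rightarrow> real"
  assumes k[measurable]: "k \<in> borel_measurable borel" and out: "\<And>t. t \<notin> {0<..<1} \<Longrightarrow> k t = 0"
    and int: "\<And>p q. 0 < p \<Longrightarrow> p \<le> q \<Longrightarrow> q < 1 \<Longrightarrow>
      (\<integral>\<^sup>+t\<in>{p..q}. ennreal (k t) \<partial>lborel) = ennreal (\<Psi> q - \<Psi> p)"
    and lim: "(\<Psi> \<longlongrightarrow> 0) (at_right 0)" and r: "0 < r" "r < 1"
  shows "(\<integral>\<^sup>+t\<in>{..<r}. ennreal (k t) \<partial>lborel) = ennreal (\<Psi> r)"
proof -
  define p where "p n = r / real (Suc n)" for n
  have p: "0 < p n" "p n \<le> r" for n using r by (auto simp: p_def divide_le_eq)
  have p_mono: "p (Suc n) \<le> p n" for n using r by (simp add: p_def frac_le)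
  have plim: "p \<longlonglongrightarrow> 0" unfolding p_def by (rule LIMSEQ_Suc[OF lim_const_over_n])
  moreover have "p n \<noteq> 0" for n using p(1)[of n] by simp
  ultimately have "filterlim p (at_right 0) sequentially"
    using p by (simp add: filterlim_at)
  then have "(\<lambda>n. \<Psi> (p n)) \<longlonglongrightarrow> 0" by (rule filterlim_compose[OF lim])
  then have v: "(\<lambda>n. \<Psi> r - \<Psi> (p n)) \<longlonglongrightarrow> \<Psi> r - 0" by (intro tendsto_intros)
  have "(\<Union>n. {p n..r}) = {0<..r}"
  proof (intro equalityI subsetI)
    fix x assume "x \<in> {0<..r}"
    then have "eventually (\<lambda>n. p n < x) sequentially" using plim by (intro order_tendstoD) auto
    then obtain n where "p n < x" by (auto simp: eventually_sequentially)
    then show "x \<in> (\<Union>n. {p n..r})" using \<open>x \<in> {0<..r}\<close> by (auto intro!: exI[of _ n])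
  qed (use p in \<open>auto intro: less_le_trans\<close>)
  then have "(\<integral>\<^sup>+t\<in>{0<..r}. ennreal (k t) \<partial>lborel) = ennreal (\<Psi> r)"
    using nn_integral_of_Icc_limit[OF k _ _ _ v, of p "\<lambda>_. r"] int p p_mono r by simp
  also have "(\<integral>\<^sup>+t\<in>{0<..r}. ennreal (k t) \<partial>lborel) = (\<integral>\<^sup>+t\<in>{..<r}. ennreal (k t) \<partial>lborel)"
    using AE_lborel_singleton[of r]
    by (intro nn_integral_cong_AE, eventually_elim) (use out in \<open>auto split: split_indicator\<close>)
  finally show ?thesis .
qed

lemma nn_integral_greaterThan:
  fixes k \<Psi> :: "real \<Rightarrow> real"
  assumes k[measurable]: "k \<in> borel_measurable borel" and out: "\<And>t. t \<notin> {0<..<1} \<Longrightarrow> k t = 0"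
    and int: "\<And>p q. 0 < p \<Longrightarrow> p \<le> q \<Longrightarrow> q < 1 \<Longrightarrow>
      (\<integral>\<^sup>+t\<in>{p..q}. ennreal (k t) \<partial>lborel) = ennreal (\<Psi> p - \<Psi> q)"
    and lim: "(\<Psi> \<longlongrightarrow> 0) (at_left 1)" and r: "0 < r" "r < 1"
  shows "(\<integral>\<^sup>+t\<in>{r<..}. ennreal (k t) \<partial>lborel) = ennreal (\<Psi> r)"
proof -
  define p where "p n = 1 - (1 - r) / real (Suc n)" for n
  have p: "p n < 1" "r \<le> p n" for n
    using r by (simp_all add: p_def) (simp add: field_simps mult_left_le_one_le)
  have p_mono: "p n \<le> p (Suc n)" for n using r by (simp add: p_def frac_le)
  have "(\<lambda>n. (1 - r) / real (Suc n)) \<longlonglongrightarrow> 0" by (rule LIMSEQ_Suc[OF lim_const_over_n])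
  then have plim: "p \<longlonglongrightarrow> 1" unfolding p_def using tendsto_diff[OF tendsto_const[of 1]] by fastforce
  then have "filterlim p (at_left 1) sequentially"
    using p by (auto simp: filterlim_at less_imp_neq)
  then have "(\<lambda>n. \<Psi> (p n)) \<longlonglongrightarrow> 0" by (rule filterlim_compose[OF lim])
  then have v: "(\<lambda>n. \<Psi> r - \<Psi> (p n)) \<longlonglongrightarrow> \<Psi> r - 0" by (intro tendsto_intros)
  have "(\<Union>n. {r..p n}) = {r..<1}"
  proof (intro equalityI subsetI)
    fix x assume "x \<in> {r..<1}"
    then have "eventually (\<lambda>n. x < p n) sequentially" using plim by (intro order_tendstoD) auto
    then obtain n where "x < p n" by (auto simp: eventually_sequentially)
    then show "x \<in> (\<Union>n. {r..p n})" using \<open>x \<in> {r..<1}\<close> by (auto intro!: exI[of _ n])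
  qed (use p in \<open>auto intro: le_less_trans\<close>)
  then have "(\<integral>\<^sup>+t\<in>{r..<1}. ennreal (k t) \<partial>lborel) = ennreal (\<Psi> r)"
    using nn_integral_of_Icc_limit[OF k _ _ _ v, of "\<lambda>_. r" p] int p p_mono r by simp
  also have "(\<integral>\<^sup>+t\<in>{r..<1}. ennreal (k t) \<partial>lborel) = (\<integral>\<^sup>+t\<in>{r<..}. ennreal (k t) \<partial>lborel)"
    using AE_lborel_singleton[of r]
    by (intro nn_integral_cong_AE, eventually_elim) (use out in \<open>auto split: split_indicator\<close>)
  finally show ?thesis .
qed

lemma nn_integral_a:
  assumes "0 < r" "r < 1"
  shows "(\<integral>\<^sup>+t\<in>{..<r}. ennreal (a t) \<partial>lborel) = ennreal (A r)"
proof (rule nn_integral_lessThan[OF a_measurable _ _ _ assms])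
  show "(A \<longlongrightarrow> 0) (at_right 0)" unfolding A_def using d_ge_2 by (intro tendsto_expo_0) auto
  fix p q :: real assume pq: "0 < p" "p \<le> q" "q < 1"
  have "(\<integral>\<^sup>+t\<in>{p..q}. ennreal (a t) \<partial>lborel) = ennreal (1 * (A q - A p))"
    unfolding A_def
  proof (rule nn_integral_expo_Icc[OF a_measurable a_nonneg _ _ pq])
    fix t :: real assume t: "t \<in> {0<..<1}"
    have "expo (1 / real d) 1 t / h t = expo (1 / real d - 1) 1 t" using t by (simp add: expo_divide_h)
    moreover have "1 / real d * (1 - g t) + 1 * ((real d - 1) / real d) = (real d - g t) / real d"
      using d_ge_2 by (simp add: field_simps)
    moreover have "a t = (real d - g t) / real d * expo (1 / real d - 1) 1 t" using t by (simp add: a_def)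
    ultimately show "expo (1 / real d) 1 t * (1 / real d * (1 - g t) + 1 * ((real d - 1) / real d)) / h t = 1 * a t"
      by (simp only: mult_1) (metis mult.commute times_divide_eq_left)
  qed simp
  then show "(\<integral>\<^sup>+t\<in>{p..q}. ennreal (a t) \<partial>lborel) = ennreal (A q - A p)" by simp
qed (auto simp: a_def)

lemma nn_integral_b_A:
  assumes "0 < r" "r < 1"
  shows "(\<integral>\<^sup>+t\<in>{r<..}. ennreal ((real d - 1) * (b t * A t ^ (d - 2))) \<partial>lborel) = ennreal (Q r)"
proof -
  \<comment> \<open>A is cut off outside (0,1) for measurability; as b vanishes there, the product
    is the same.\<close>
  define k where "k t = (real d - 1) * (b t * (if t \<in> {0<..<1} then A t else 0) ^ (d - 2))" for t
  have km[measurable]: "k \<in> borel_measurable borel" unfolding k_def A_def by measurable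
  have k: "k t = (real d - 1) * (b t * A t ^ (d - 2))" for t by (auto simp: k_def b_def)
  have A0: "0 \<le> A t" for t by (simp add: A_def less_imp_le expo_pos)
  have k0: "0 \<le> k t" for t
    unfolding k using d_ge_2 A0 b_nonneg by simp
  have "(\<integral>\<^sup>+t\<in>{r<..}. ennreal (k t) \<partial>lborel) = ennreal (Q r)"
  proof (rule nn_integral_greaterThan[OF km _ _ _ assms])
    show "(Q \<longlongrightarrow> 0) (at_left 1)" unfolding Q_def using d_ge_2 by (intro tendsto_expo_1) auto
    fix p q :: real assume pq: "0 < p" "p \<le> q" "q < 1"
    have "(\<integral>\<^sup>+t\<in>{p..q}. ennreal (k t) \<partial>lborel) = ennreal (- 1 * (Q q - Q p))"
      unfolding Q_def
    proof (rule nn_integral_expo_Icc[OF km k0 _ _ pq])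
      fix t :: real assume t: "t \<in> {0<..<1}"
      have "(1 - 1 / real d) * (1 - g t) + (- 1) * ((real d - 1) / real d) = - ((real d - 1) / real d * g t)"
        using d_ge_2 by (simp add: field_simps)
      then show "expo (1 - 1 / real d) (- 1) t * ((1 - 1 / real d) * (1 - g t) + (- 1) * ((real d - 1) / real d)) / h t
        = - 1 * k t"
        unfolding k using t by (subst b_A_power2) (auto simp: Q_def)
    qed simp
    then show "(\<integral>\<^sup>+t\<in>{p..q}. ennreal (k t) \<partial>lborel) = ennreal (Q p - Q q)" by simp
  qed (auto simp: k b_def)
  then show ?thesis by (simp only: k)
qed

text \<open>The half-open range is the set of s with x \<le> s < y, the form in which the order of
  integration is later exchanged.\<close>

lemma F_diff:
  assumes "0 < x" "x \<le> y" "y < 1"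
  shows "ennreal (F y - F x) = (\<integral>\<^sup>+s\<in>{x..<y}. ennreal ((real d - 1) / real d / h s) \<partial>lborel)"
proof -
  define k where "k s = (real d - 1) / real d / (if s \<in> {0<..<1} then h s else 0)" for s
  have [measurable]: "k \<in> borel_measurable borel" unfolding k_def by measurable
  have "(\<integral>\<^sup>+s. ennreal (k s) * indicator {x..y} s \<partial>lborel) = F y - F x"
  proof (rule nn_integral_FTC_Icc)
    fix s assume "s \<in> {x..y}"
    then have s: "0 < s" "s < 1" using assms by auto
    then show "(F has_real_derivative k s) (at s)" "0 \<le> k s"
      using F_has_derivative[OF s] h_pos[OF s] d_ge_2 by (auto simp: k_def)
  qed (use assms in auto)
  also have "(\<integral>\<^sup>+s. ennreal (k s) * indicator {x..y} s \<partial>lborel) =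
      (\<integral>\<^sup>+s\<in>{x..<y}. ennreal ((real d - 1) / real d / h s) \<partial>lborel)"
    using AE_lborel_singleton[of y]
    by (intro nn_integral_cong_AE, eventually_elim) (use assms in \<open>auto simp: k_def split: split_indicator\<close>)
  finally show ?thesis by simp
qed

section \<open>The functions \<open>a_fun\<close> and \<open>b_fun\<close> and their agreement with
  \<open>a\<close> and \<open>b\<close>\<close>

lemma borel_measurable_deriv_delta[measurable]:
  "(\<lambda>t. if t \<in> {0<..<1} then deriv \<delta> t else 0) \<in> borel_measurable borel"
proof -
  \<comment> \<open>A continuous function on the whole line that coincides with \<delta> near each
    point of (0,1), so the derivatives there agree, whatever \<delta> does outside [0,1].\<close>
  define \<delta>' where "\<delta>' t = \<delta> (max 0 (min 1 t))" for t
  have "continuous_on UNIV \<delta>'" unfolding \<delta>'_def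
    by (intro continuous_on_compose2[OF lipschitz_on_continuous_on[OF delta_lipschitz]] continuous_intros) auto
  then have [measurable]: "deriv \<delta>' \<in> borel_measurable borel" by (rule borel_measurable_deriv)
  have "deriv \<delta> t = deriv \<delta>' t" if t: "t \<in> {0<..<1}" for t
  proof (rule deriv_cong_ev)
    have "eventually (\<lambda>x. x \<in> {0<..<1}) (nhds t)" using t by (intro eventually_nhds_in_open) auto
    then show "eventually (\<lambda>x. \<delta> x = \<delta>' x) (nhds t)" by eventually_elim (auto simp: \<delta>'_def)
  qed simp
  then have "(\<lambda>t. if t \<in> {0<..<1} then deriv \<delta> t else 0) = (\<lambda>t. if t \<in> {0<..<1} then deriv \<delta>' t else 0)"
    by auto
  then show ?thesis by simp
qed

text \<open>A default value: h vanishes at 0 and 1, and \<open>0 powr y = 0\<close> also for the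
  negative exponent.\<close>

lemma a_fun_outside: "t = 0 \<or> t = 1 \<Longrightarrow> a_fun d \<delta> t = 0"
  by (auto simp: a_fun_def h_fun_def delta_0 delta_1)

lemma b_fun_outside: "t = 0 \<or> t = 1 \<Longrightarrow> b_fun d \<delta> t = 0"
  by (auto simp: b_fun_def h_fun_def delta_0 delta_1)

lemma a_fun_eq: "0 < t \<Longrightarrow> t < 1 \<Longrightarrow> a_fun d \<delta> t = (real d - deriv \<delta> t) / real d * expo (1 / real d - 1) 1 t"
  using h_pos[of t] by (simp add: a_fun_def expo_def powr_def exp_add add.commute)

lemma b_fun_eq: "0 < t \<Longrightarrow> t < 1 \<Longrightarrow>
    b_fun d \<delta> t = deriv \<delta> t / real d * expo (1 / real d - 1) (- (real d - 1)) t"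
  using h_pos[of t] by (simp add: b_fun_def expo_def powr_def exp_add add.commute exp_minus exp_diff divide_inverse)

lemma borel_measurable_a_fun[measurable]:
  "(\<lambda>t. if t \<in> {0..1} then a_fun d \<delta> t else 0) \<in> borel_measurable borel"
proof -
  have eq: "(\<lambda>t. if t \<in> {0..1} then a_fun d \<delta> t else 0) =
    (\<lambda>t. (real d - (if t \<in> {0<..<1} then deriv \<delta> t else 0)) / real d *
       (if t \<in> {0<..<1} then expo (1 / real d - 1) 1 t else 0))"
    by (auto simp: fun_eq_iff a_fun_eq) (use a_fun_outside in \<open>force\<close>)+
  show ?thesis unfolding eq by measurable
qed

lemma borel_measurable_b_fun[measurable]:
  "(\<lambda>t. if t \<in> {0..1} then b_fun d \<delta> t else 0) \<in> borel_measurable borel"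
proof -
  have eq: "(\<lambda>t. if t \<in> {0..1} then b_fun d \<delta> t else 0) =
    (\<lambda>t. (if t \<in> {0<..<1} then deriv \<delta> t else 0) / real d *
       (if t \<in> {0<..<1} then expo (1 / real d - 1) (- (real d - 1)) t else 0))"
    by (auto simp: fun_eq_iff b_fun_eq) (use b_fun_outside in \<open>force\<close>)+
  show ?thesis unfolding eq by measurable
qed

lemma AE_a_fun: "AE t in lborel. t \<in> {0..1} \<longrightarrow> a_fun d \<delta> t = a t \<and> b_fun d \<delta> t = b t"
  using delta_has_derivative
proof eventually_elim
  case (elim t)
  show ?case
  proof
    assume t: "t \<in> {0..1}"
    show "a_fun d \<delta> t = a t \<and> b_fun d \<delta> t = b t"
    proof (cases "t \<in> {0<..<1}")
      case True
      then have "deriv \<delta> t = g t" using elim by (auto intro: DERIV_imp_deriv)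
      then show ?thesis using True by (simp add: a_fun_eq b_fun_eq a_def b_def)
    next
      case False
      then have "t = 0 \<or> t = 1" using t by auto
      then show ?thesis using a_fun_outside b_fun_outside by (auto simp: a_def b_def)
    qed
  qed
qed

end

section \<open>The law with density c_delta\<close>

lemma borel_measurable_vec_nth_real[measurable]:
  "(\<lambda>x :: real ^ 'n. x $ i) \<in> borel_measurable borel"
  by (intro borel_measurable_continuous_onI continuous_intros)

lemma borel_measurable_vec_lambda_PiM:
  "(\<lambda>y. \<chi> i. y i) \<in> (\<Pi>\<^sub>M i\<in>(UNIV :: 'n::finite set). lborel :: real measure) \<rightarrow>\<^sub>M (borel :: (real ^ 'n) measure)"
proof (subst borel_measurable_euclidean_space, intro ballI)
  fix v :: "real ^ 'n" assume "v \<in> Basis"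
  then obtain i where v: "v = axis i 1" by (auto simp: Basis_vec_def)
  show "(\<lambda>y. (\<chi> i. y i) \<bullet> v) \<in> borel_measurable (\<Pi>\<^sub>M i\<in>UNIV. lborel)"
    unfolding v by (simp add: inner_axis)
qed

lemma prod_Basis_vec: "(\<Prod>v\<in>(Basis :: (real ^ 'n::finite) set). f v) = (\<Prod>i\<in>UNIV. f (axis i 1))"
proof -
  have "inj (\<lambda>i :: 'n. axis i (1 :: real))" by (auto simp: inj_on_def axis_eq_axis)
  moreover have "(Basis :: (real ^ 'n) set) = range (\<lambda>i. axis i 1)" by (auto simp: Basis_vec_def)
  ultimately show ?thesis using prod.reindex[of "\<lambda>i :: 'n. axis i (1 :: real)" UNIV f] by (simp only: o_def)
qed

text \<open>Lebesgue measure is determined by the volumes of boxes. The identification with the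
  product measure makes Tonelli's theorem in single coordinates available on
  \<open>real ^ 'n\<close>.\<close>

lemma lborel_vec_eq_distr_PiM:
  "(lborel :: (real ^ 'n) measure) = distr (\<Pi>\<^sub>M i\<in>UNIV. lborel) borel (\<lambda>y. \<chi> i. y i)"
proof (rule lborel_eqI)
  interpret P: product_sigma_finite "\<lambda>_ :: 'n. lborel :: real measure" by standard
  fix l u :: "real ^ 'n" assume le: "\<And>v. v \<in> Basis \<Longrightarrow> l \<bullet> v \<le> u \<bullet> v"
  have le': "l $ i \<le> u $ i" for i using le[of "axis i 1"] by (simp add: inner_axis)
  have "(\<lambda>y. \<chi> i. y i) -` box l u \<inter> space (\<Pi>\<^sub>M i\<in>UNIV. lborel) = (\<Pi>\<^sub>E i\<in>UNIV. {l $ i<..<u $ i})"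
    by (auto simp: space_PiM mem_box_cart PiE_iff)
  then have "emeasure (distr (\<Pi>\<^sub>M i\<in>UNIV. lborel) borel (\<lambda>y. \<chi> i. y i)) (box l u)
    = emeasure (\<Pi>\<^sub>M i\<in>UNIV. lborel) (\<Pi>\<^sub>E i\<in>UNIV. {l $ i<..<u $ i})"
    by (subst emeasure_distr[OF borel_measurable_vec_lambda_PiM]) auto
  also have "\<dots> = (\<Prod>i\<in>UNIV. emeasure lborel {l $ i<..<u $ i})"
    by (rule P.emeasure_PiM) auto
  also have "\<dots> = ennreal (\<Prod>v\<in>Basis. (u - l) \<bullet> v)"
    unfolding prod_Basis_vec using le' by (simp add: inner_axis prod_ennreal)
  finally show "emeasure (distr (\<Pi>\<^sub>M i\<in>UNIV. lborel) borel (\<lambda>y. \<chi> i. y i)) (box l u) = ennreal (\<Prod>v\<in>Basis. (u - l) \<bullet> v)" .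
qed simp

lemma card_Compl_singleton: "card (- {i :: 'n::finite}) = CARD('n) - 1"
  by (simp add: Compl_eq_Diff_UNIV card_Diff_singleton)

lemma borel_measurable_indicator_nth_less[measurable]:
  "(\<lambda>x :: real ^ 'n::finite. indicator {..<x $ i} (x $ j) :: ennreal) \<in> borel_measurable borel"
proof -
  have "(\<lambda>x :: real ^ 'n. indicator {..<x $ i} (x $ j) :: ennreal) = indicator {x. x $ j < x $ i}"
    by (auto simp: fun_eq_iff split: split_indicator)
  moreover have "{x :: real ^ 'n. x $ j < x $ i} \<in> sets borel" by measurable
  ultimately show ?thesis by simp
qed

text \<open>Tonelli with the pivot i as outermost variable: once x_i = r is fixed, the integrand is
  a product over the other coordinates. The pivot is the position of the maximum, and the indicators
  keep the others below it.\<close>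

lemma nn_integral_lborel_vec_pivot:
  fixes i :: "'n::finite" and f :: "real \<Rightarrow> ennreal"
  assumes f[measurable]: "f \<in> borel_measurable borel"
    and k[measurable]: "\<And>j. k j \<in> borel_measurable borel"
  shows "(\<integral>\<^sup>+x. f (x $ i) * (\<Prod>j\<in>-{i}. k j (x $ j) * indicator {..<x $ i} (x $ j)) \<partial>(lborel :: (real ^ 'n) measure))
    = (\<integral>\<^sup>+r. f r * (\<Prod>j\<in>-{i}. \<integral>\<^sup>+s\<in>{..<r}. k j s \<partial>lborel) \<partial>lborel)" (is "(\<integral>\<^sup>+x. ?h x \<partial>lborel) = _")
proof -
  interpret P: product_sigma_finite "\<lambda>_ :: 'n. lborel :: real measure" by standard
  have ins: "insert i (- {i}) = (UNIV :: 'n set)" by auto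
  have hm[measurable]: "?h \<in> borel_measurable borel" by measurable
  have m: "(\<lambda>y. ?h (\<chi> j. y j)) \<in> borel_measurable (\<Pi>\<^sub>M j\<in>insert i (- {i}). lborel)"
    unfolding ins by (rule measurable_compose[OF borel_measurable_vec_lambda_PiM hm])
  have "(\<integral>\<^sup>+x. ?h x \<partial>lborel) = (\<integral>\<^sup>+y. ?h (\<chi> j. y j) \<partial>(\<Pi>\<^sub>M j\<in>insert i (- {i}). lborel))"
    unfolding ins by (subst lborel_vec_eq_distr_PiM, subst nn_integral_distr[OF borel_measurable_vec_lambda_PiM]) auto
  also have "\<dots> = (\<integral>\<^sup>+r. \<integral>\<^sup>+y. ?h (\<chi> j. (y(i := r)) j) \<partial>(\<Pi>\<^sub>M j\<in>-{i}. lborel) \<partial>lborel)"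
    by (rule P.product_nn_integral_insert_rev[OF _ _ m]) auto
  also have "\<dots> = (\<integral>\<^sup>+r. f r * (\<Prod>j\<in>-{i}. \<integral>\<^sup>+s\<in>{..<r}. k j s \<partial>lborel) \<partial>lborel)"
  proof (rule nn_integral_cong)
    fix r :: real
    have "(\<integral>\<^sup>+y. ?h (\<chi> j. (y(i := r)) j) \<partial>(\<Pi>\<^sub>M j\<in>-{i}. lborel)) =
      (\<integral>\<^sup>+y. f r * (\<Prod>j\<in>-{i}. k j (y j) * indicator {..<r} (y j)) \<partial>(\<Pi>\<^sub>M j\<in>-{i}. lborel))"
      by (intro nn_integral_cong arg_cong2[where f="(*)"] prod.cong) auto
    also have "\<dots> = f r * (\<integral>\<^sup>+y. (\<Prod>j\<in>-{i}. k j (y j) * indicator {..<r} (y j)) \<partial>(\<Pi>\<^sub>M j\<in>-{i}. lborel))"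
      by (rule nn_integral_cmult) measurable
    also have "(\<integral>\<^sup>+y. (\<Prod>j\<in>-{i}. k j (y j) * indicator {..<r} (y j)) \<partial>(\<Pi>\<^sub>M j\<in>-{i}. lborel))
      = (\<Prod>j\<in>-{i}. \<integral>\<^sup>+s\<in>{..<r}. k j s \<partial>lborel)"
      by (rule P.product_nn_integral_prod[where f="\<lambda>j s. k j s * indicator {..<r} s"]) auto
    finally show "(\<integral>\<^sup>+y. ?h (\<chi> j. (y(i := r)) j) \<partial>(\<Pi>\<^sub>M j\<in>-{i}. lborel)) =
      f r * (\<Prod>j\<in>-{i}. \<integral>\<^sup>+s\<in>{..<r}. k j s \<partial>lborel)" .
  qed
  finally show ?thesis .
qed

text \<open>Each tie lies in a hyperplane, of which there are finitely many. Almost everywhere the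
  maximum is thus attained at one coordinate only.\<close>

lemma AE_distinct_coords:
  "AE x in (lborel :: (real ^ 'n) measure). \<forall>i j. x $ i = x $ j \<longrightarrow> i = j"
proof -
  have "AE x in (lborel :: (real ^ 'n) measure). x $ i \<noteq> x $ j" if "i \<noteq> j" for i j
  proof -
    define v :: "real ^ 'n" where "v = axis i 1 - axis j 1"
    have "v \<noteq> 0" using that by (simp add: v_def axis_eq_axis)
    then have "negligible {x. v \<bullet> x = 0}" by (intro negligible_hyperplane) auto
    moreover have "{x. v \<bullet> x = 0} = {x :: real ^ 'n. x $ i = x $ j}" by (auto simp: v_def inner_diff_left inner_axis')
    ultimately have "{x :: real ^ 'n. x $ i = x $ j} \<in> null_sets lebesgue" by (simp add: negligible_iff_null_sets)
    moreover have "{x :: real ^ 'n. x $ i = x $ j} \<in> sets lborel" by measurable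
    ultimately have "{x :: real ^ 'n. x $ i = x $ j} \<in> null_sets lborel" by (simp add: null_sets_completion_iff)
    from AE_not_in[OF this] show ?thesis by simp
  qed
  then have "AE x in (lborel :: (real ^ 'n) measure). i \<noteq> j \<longrightarrow> x $ i \<noteq> x $ j" for i j
    by (cases "i = j") auto
  then have "AE x in (lborel :: (real ^ 'n) measure). \<forall>i j. i \<noteq> j \<longrightarrow> x $ i \<noteq> x $ j"
    by (simp only: AE_all_countable) blast
  then show ?thesis by eventually_elim blast
qed

lemma max_coord_le_iff: "max_coord x \<le> t \<longleftrightarrow> (\<forall>i. x $ i \<le> t)"
  by (simp add: max_coord_def)

lemma nth_le_max_coord: "x $ i \<le> max_coord x"
  by (simp add: max_coord_def)

lemma max_coord_attained: "\<exists>i. max_coord x = x $ i"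
proof -
  have "max_coord x \<in> range (\<lambda>i. x $ i)" unfolding max_coord_def by (rule Max_in) auto
  then show ?thesis by auto
qed

lemma borel_measurable_max_coord[measurable]:
  "(max_coord :: real ^ 'n::finite \<Rightarrow> real) \<in> borel_measurable borel"
proof -
  have "{x :: real ^ 'n. \<forall>i. x $ i \<le> t} \<in> sets borel" for t by measurable
  then show ?thesis by (simp add: borel_measurable_iff_le max_coord_le_iff)
qed

lemma borel_measurable_prod_nonmax:
  assumes [measurable]: "f \<in> borel_measurable borel"
  shows "(\<lambda>x :: real ^ 'n::finite. (\<Prod>i | x $ i \<noteq> max_coord x. f (x $ i)) :: real) \<in> borel_measurable borel"
proof -
  have "(\<Prod>i | x $ i \<noteq> max_coord x. f (x $ i)) = (\<Prod>i\<in>UNIV. if x $ i \<noteq> max_coord x then f (x $ i) else 1)"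
    for x :: "real ^ 'n" by (simp add: prod.If_cases)
  then show ?thesis by simp
qed

section \<open>Marginals and maximum under the product-form density\<close>

context diagonal_density
begin

text \<open>A Borel version of \<open>c_delta\<close> with g in place of
  \<open>deriv \<delta>\<close>. It vanishes off the open unit cube, because a and b vanish off
  (0,1).\<close>

definition dens :: "real ^ 'n::finite \<Rightarrow> real" where
  "dens x = b (max_coord x) * (\<Prod>i | x $ i \<noteq> max_coord x. a (x $ i))"

lemma dens_nonneg: "0 \<le> dens x"
  by (auto simp: dens_def intro!: mult_nonneg_nonneg b_nonneg prod_nonneg a_nonneg)

lemma borel_measurable_dens[measurable]: "(dens :: real ^ 'n::finite \<Rightarrow> real) \<in> borel_measurable borel"
  unfolding dens_def by (intro borel_measurable_times borel_measurable_prod_nonmax) measurable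

abbreviation below_prod :: "'n \<Rightarrow> real ^ 'n::finite \<Rightarrow> ennreal" where
  "below_prod i x \<equiv> (\<Prod>j\<in>-{i}. ennreal (a (x $ j)) * indicator {..<x $ i} (x $ j))"

text \<open>The sum runs over the possible positions i of the maximum: without ties, every term but
  the right one has an indicator equal to 0. Each single term has the pivot form.\<close>

lemma dens_eq_sum:
  fixes x :: "real ^ 'n::finite"
  assumes "\<forall>i j. x $ i = x $ j \<longrightarrow> i = j"
  shows "\<phi> (max_coord x) * ennreal (dens x) =
    (\<Sum>i\<in>UNIV. \<phi> (x $ i) * ennreal (b (x $ i)) * below_prod i x)"
    (is "_ = (\<Sum>i\<in>UNIV. ?t i)")
proof -
  obtain k where k: "max_coord x = x $ k" using max_coord_attained by blast
  have nonmax: "{i. x $ i \<noteq> max_coord x} = - {k}" using assms k by auto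
  have lt: "x $ j < x $ k" if "j \<noteq> k" for j
    using nth_le_max_coord[of x j] assms k that by (metis order_le_imp_less_or_eq)
  have "?t i = 0" if "i \<noteq> k" for i
  proof -
    have "below_prod i x = 0"
      using lt[OF that] that by (intro prod_zero) (auto intro!: bexI[of _ k])
    then show ?thesis by simp
  qed
  then have "(\<Sum>i\<in>UNIV. ?t i) = (\<Sum>i\<in>UNIV. if i = k then ?t k else 0)"
    by (intro sum.cong) auto
  also have "\<dots> = ?t k" by simp
  also have "(\<Prod>j\<in>-{k}. ennreal (a (x $ j)) * indicator {..<x $ k} (x $ j)) = (\<Prod>j\<in>-{k}. ennreal (a (x $ j)))"
    using lt by (intro prod.cong) auto
  also have "\<dots> = ennreal (\<Prod>j\<in>-{k}. a (x $ j))"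
    by (rule prod_ennreal) (rule a_nonneg)
  also have "\<phi> (x $ k) * ennreal (b (x $ k)) * ennreal (\<Prod>j\<in>-{k}. a (x $ j)) = \<phi> (max_coord x) * ennreal (dens x)"
    unfolding dens_def nonmax unfolding k by (simp add: ennreal_mult prod_nonneg a_nonneg b_nonneg mult.assoc)
  finally show ?thesis ..
qed

lemma A_nonneg: "0 \<le> A t" and Q_nonneg: "0 \<le> Q t"
  by (simp_all add: A_def Q_def less_imp_le expo_pos)

lemma b_prod_nn_integral_a:
  fixes i :: "'n::finite" and z :: ennreal
  assumes card: "CARD('n) = d"
  shows "z * ennreal (b r) * (\<Prod>j\<in>-{i}. \<integral>\<^sup>+s\<in>{..<r}. ennreal (a s) \<partial>lborel) = z * ennreal (g r / real d)"
proof (cases "r \<in> {0<..<1}")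
  case True
  have "(\<Prod>j\<in>-{i}. \<integral>\<^sup>+s\<in>{..<r}. ennreal (a s) \<partial>lborel) = ennreal (A r ^ (d - 1))"
    using True card by (simp add: nn_integral_a card_Compl_singleton ennreal_power A_nonneg)
  then show ?thesis using True b_A_power[of r]
    by (simp add: mult.assoc ennreal_mult[symmetric] b_nonneg A_nonneg)
qed (auto simp: b_def g_outside)

lemma nn_integral_max_dens:
  assumes card: "CARD('n) = d" and \<phi>[measurable]: "\<phi> \<in> borel_measurable borel"
  shows "(\<integral>\<^sup>+x. \<phi> (max_coord x) * ennreal (dens x) \<partial>(lborel :: (real ^ 'n) measure)) =
    (\<integral>\<^sup>+t. \<phi> t * ennreal (g t) \<partial>lborel)"
proof -
  have "(\<integral>\<^sup>+x. \<phi> (max_coord x) * ennreal (dens x) \<partial>(lborel :: (real ^ 'n) measure)) =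
    (\<integral>\<^sup>+x. (\<Sum>i\<in>UNIV. \<phi> (x $ i) * ennreal (b (x $ i)) * below_prod i x)
      \<partial>(lborel :: (real ^ 'n) measure))"
    using AE_distinct_coords by (intro nn_integral_cong_AE, eventually_elim) (rule dens_eq_sum)
  also have "\<dots> = (\<Sum>i\<in>UNIV. \<integral>\<^sup>+x. \<phi> (x $ i) * ennreal (b (x $ i)) * below_prod i x
      \<partial>(lborel :: (real ^ 'n) measure))"
    by (rule nn_integral_sum) measurable
  also have "\<dots> = (\<Sum>i\<in>(UNIV :: 'n set). \<integral>\<^sup>+r. \<phi> r * ennreal (g r / real d) \<partial>lborel)"
  proof (rule sum.cong)
    fix i :: 'n
    have "(\<integral>\<^sup>+x. \<phi> (x $ i) * ennreal (b (x $ i)) * below_prod i x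
        \<partial>(lborel :: (real ^ 'n) measure)) =
      (\<integral>\<^sup>+r. \<phi> r * ennreal (b r) * (\<Prod>j\<in>-{i}. \<integral>\<^sup>+s\<in>{..<r}. ennreal (a s) \<partial>lborel) \<partial>lborel)"
      by (rule nn_integral_lborel_vec_pivot[where f="\<lambda>r. \<phi> r * ennreal (b r)" and k="\<lambda>j s. ennreal (a s)"]) measurable
    also have "\<dots> = (\<integral>\<^sup>+r. \<phi> r * ennreal (g r / real d) \<partial>lborel)"
      by (intro nn_integral_cong b_prod_nn_integral_a card)
    finally show "(\<integral>\<^sup>+x. \<phi> (x $ i) * ennreal (b (x $ i)) * below_prod i x
        \<partial>(lborel :: (real ^ 'n) measure)) = (\<integral>\<^sup>+r. \<phi> r * ennreal (g r / real d) \<partial>lborel)" .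
  qed simp
  also have "\<dots> = of_nat d * (\<integral>\<^sup>+r. \<phi> r * ennreal (g r / real d) \<partial>lborel)" using card by simp
  also have "\<dots> = (\<integral>\<^sup>+r. of_nat d * (\<phi> r * ennreal (g r / real d)) \<partial>lborel)"
    by (rule nn_integral_cmult[symmetric]) measurable
  also have "\<dots> = (\<integral>\<^sup>+t. \<phi> t * ennreal (g t) \<partial>lborel)"
  proof (rule nn_integral_cong)
    fix t
    have "of_nat d * ennreal (g t / real d) = ennreal (g t)"
      using d_ge_2 g_nonneg[of t] by (simp add: ennreal_of_nat_eq_real_of_nat ennreal_mult[symmetric])
    then show "of_nat d * (\<phi> t * ennreal (g t / real d)) = \<phi> t * ennreal (g t)"
      by (metis mult.left_commute)
  qed
  finally show ?thesis .
qed

text \<open>Coordinate k contributes g/d when it is the maximum. When the maximum sits at another i,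
  integrating out the remaining d - 2 coordinates leaves b A^(d-2) for the level r of the maximum
  and a for the value s < r of coordinate k; exchanging r and s turns this into a Q = 1 - g/d. The
  two densities add up to 1.\<close>

lemma nn_integral_nth_dens:
  fixes k :: "'n::finite"
  assumes card: "CARD('n) = d" and \<phi>[measurable]: "\<phi> \<in> borel_measurable borel"
  shows "(\<integral>\<^sup>+x. \<phi> (x $ k) * ennreal (dens x) \<partial>(lborel :: (real ^ 'n) measure)) = (\<integral>\<^sup>+t\<in>{0..1}. \<phi> t \<partial>lborel)"
proof -
  let ?I = "\<lambda>r. \<integral>\<^sup>+s\<in>{..<r}. \<phi> s * ennreal (a s) \<partial>lborel"
    and ?J = "\<lambda>r. \<integral>\<^sup>+s. (if s < r then \<phi> s * ennreal (a s) else 0) \<partial>lborel"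
  define \<tau> where "\<tau> i x = ennreal (b (x $ i)) * below_prod i x"
    for i and x :: "real ^ 'n"
  have [measurable]: "\<tau> i \<in> borel_measurable borel" for i unfolding \<tau>_def by measurable
  have "(\<integral>\<^sup>+x. \<phi> (x $ k) * ennreal (dens x) \<partial>(lborel :: (real ^ 'n) measure)) =
    (\<integral>\<^sup>+x. (\<Sum>i\<in>UNIV. \<phi> (x $ k) * \<tau> i x) \<partial>lborel)"
    using AE_distinct_coords
  proof (intro nn_integral_cong_AE, eventually_elim)
    fix x :: "real ^ 'n" assume "\<forall>i j. x $ i = x $ j \<longrightarrow> i = j"
    from dens_eq_sum[OF this, of "\<lambda>_. 1"] show "\<phi> (x $ k) * ennreal (dens x) = (\<Sum>i\<in>UNIV. \<phi> (x $ k) * \<tau> i x)"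
      by (simp add: \<tau>_def sum_distrib_left)
  qed
  also have "\<dots> = (\<Sum>i\<in>UNIV. \<integral>\<^sup>+x. \<phi> (x $ k) * \<tau> i x \<partial>lborel)"
    by (rule nn_integral_sum) measurable
  also have "\<dots> = (\<integral>\<^sup>+x. \<phi> (x $ k) * \<tau> k x \<partial>lborel) + (\<Sum>i\<in>-{k}. \<integral>\<^sup>+x. \<phi> (x $ k) * \<tau> i x \<partial>lborel)"
    by (subst sum.remove[of _ k]) (auto simp: Compl_eq_Diff_UNIV)
  also have "(\<integral>\<^sup>+x. \<phi> (x $ k) * \<tau> k x \<partial>lborel) = (\<integral>\<^sup>+t\<in>{0<..<1}. \<phi> t * ennreal (g t / real d) \<partial>lborel)"
  proof -
    have "(\<integral>\<^sup>+x. \<phi> (x $ k) * \<tau> k x \<partial>lborel) =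
      (\<integral>\<^sup>+r. (\<phi> r * ennreal (b r)) * (\<Prod>j\<in>-{k}. \<integral>\<^sup>+s\<in>{..<r}. ennreal (a s) \<partial>lborel) \<partial>lborel)"
      unfolding \<tau>_def mult.assoc[symmetric]
      by (rule nn_integral_lborel_vec_pivot[where f="\<lambda>r. \<phi> r * ennreal (b r)" and k="\<lambda>j s. ennreal (a s)"]) measurable
    also have "\<dots> = (\<integral>\<^sup>+t\<in>{0<..<1}. \<phi> t * ennreal (g t / real d) \<partial>lborel)"
      unfolding b_prod_nn_integral_a[OF card]
      by (intro nn_integral_cong) (simp add: g_outside split: split_indicator)
    finally show ?thesis .
  qed
  also have "(\<Sum>i\<in>-{k}. \<integral>\<^sup>+x. \<phi> (x $ k) * \<tau> i x \<partial>lborel) =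
    (\<Sum>i\<in>-{k}. \<integral>\<^sup>+r. ennreal (b r * A r ^ (d - 2)) * ?I r \<partial>lborel)"
  proof (rule sum.cong)
    fix i assume i: "i \<in> - {k}"
    \<comment> \<open>The test function is absorbed into the factor of coordinate k, so that the
      integrand keeps its product form.\<close>
    define k' where "k' j s = (if j = k then \<phi> s else 1) * ennreal (a s)" for j s
    have eq: "\<phi> (x $ k) * \<tau> i x = ennreal (b (x $ i)) * (\<Prod>j\<in>-{i}. k' j (x $ j) * indicator {..<x $ i} (x $ j))" for x
    proof -
      have "(\<Prod>j\<in>-{i}. k' j (x $ j) * indicator {..<x $ i} (x $ j)) =
        (\<Prod>j\<in>-{i}. (if j = k then \<phi> (x $ j) else 1)) * below_prod i x"
        unfolding k'_def by (simp add: prod.distrib mult.assoc)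
      also have "(\<Prod>j\<in>-{i}. (if j = k then \<phi> (x $ j) else 1)) = \<phi> (x $ k)"
        using i by (subst prod.delta) auto
      finally show ?thesis by (simp add: \<tau>_def mult.left_commute)
    qed
    have "(\<integral>\<^sup>+x. \<phi> (x $ k) * \<tau> i x \<partial>lborel) =
      (\<integral>\<^sup>+r. ennreal (b r) * (\<Prod>j\<in>-{i}. \<integral>\<^sup>+s\<in>{..<r}. k' j s \<partial>lborel) \<partial>lborel)"
      unfolding eq
    proof (rule nn_integral_lborel_vec_pivot[where f="\<lambda>r. ennreal (b r)" and k=k'])
      show "k' j \<in> borel_measurable borel" for j unfolding k'_def by measurable
    qed measurable
    also have "\<dots> = (\<integral>\<^sup>+r. ennreal (b r * A r ^ (d - 2)) * ?I r \<partial>lborel)"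
    proof (rule nn_integral_cong)
      fix r :: real
      show "ennreal (b r) * (\<Prod>j\<in>-{i}. \<integral>\<^sup>+s\<in>{..<r}. k' j s \<partial>lborel) =
        ennreal (b r * A r ^ (d - 2)) * ?I r"
      proof (cases "r \<in> {0<..<1}")
        case True
        have "card (- {i} - {k}) = d - 2"
          using card i by (simp add: card_Diff_singleton card_Compl_singleton)
        then have "(\<Prod>j\<in>-{i} - {k}. \<integral>\<^sup>+s\<in>{..<r}. k' j s \<partial>lborel) = ennreal (A r ^ (d - 2))"
          using True by (simp add: k'_def nn_integral_a ennreal_power A_nonneg)
        moreover have "(\<integral>\<^sup>+s\<in>{..<r}. k' k s \<partial>lborel) = ?I r"
          by (simp add: k'_def)
        moreover have "(\<Prod>j\<in>-{i}. \<integral>\<^sup>+s\<in>{..<r}. k' j s \<partial>lborel) =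
          (\<integral>\<^sup>+s\<in>{..<r}. k' k s \<partial>lborel) * (\<Prod>j\<in>-{i} - {k}. \<integral>\<^sup>+s\<in>{..<r}. k' j s \<partial>lborel)"
          using i by (intro prod.remove) auto
        ultimately show ?thesis by (simp add: ennreal_mult b_nonneg A_nonneg mult_ac)
      qed (auto simp: b_def)
    qed
    finally show "(\<integral>\<^sup>+x. \<phi> (x $ k) * \<tau> i x \<partial>lborel) =
      (\<integral>\<^sup>+r. ennreal (b r * A r ^ (d - 2)) * ?I r \<partial>lborel)" .
  qed simp
  also have "\<dots> = (\<integral>\<^sup>+t\<in>{0<..<1}. \<phi> t * ennreal ((real d - g t) / real d) \<partial>lborel)"
  proof -
    \<comment> \<open>The d - 1 equal contributions are merged; the integral of \<beta> over r > s
      is Q s for s in (0,1).\<close>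
    define \<beta> where "\<beta> r = (real d - 1) * (b r * A r ^ (d - 2))" for r
    have \<beta>_eq: "\<beta> r = (real d - 1) * (b r * (if r \<in> {0<..<1} then A r else 0) ^ (d - 2))" for r
      by (simp add: \<beta>_def b_def)
    have [measurable]: "\<beta> \<in> borel_measurable borel" unfolding \<beta>_eq A_def by measurable
    have [measurable]: "Measurable.pred (borel \<Otimes>\<^sub>M borel) (\<lambda>(r, s). s < (r :: real))" by measurable
    have \<beta>_nonneg: "0 \<le> \<beta> r" for r using d_ge_2 by (simp add: \<beta>_def b_nonneg A_nonneg)
    have "(\<Sum>i\<in>-{k}. \<integral>\<^sup>+r. ennreal (b r * A r ^ (d - 2)) * ?I r \<partial>lborel)
      = of_nat (d - 1) * (\<integral>\<^sup>+r. ennreal (b r * A r ^ (d - 2)) * ?I r \<partial>lborel)"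
      using card by (simp add: card_Compl_singleton)
    also have "\<dots> = (\<integral>\<^sup>+r. ennreal (\<beta> r) * ?J r \<partial>lborel)"
    proof -
      have m1: "(\<lambda>r. ennreal (b r * A r ^ (d - 2))) \<in> borel_measurable borel"
      proof -
        have "(\<lambda>r. ennreal (b r * A r ^ (d - 2))) = (\<lambda>r. ennreal (\<beta> r / (real d - 1)))"
          using d_ge_2 by (simp add: \<beta>_def)
        then show ?thesis by simp
      qed
      have if_eq: "?I r = ?J r"
        for r by (intro nn_integral_cong) auto
      have m2: "?J \<in> borel_measurable borel"
        by measurable
      have "of_nat (d - 1) * (\<integral>\<^sup>+r. ennreal (b r * A r ^ (d - 2)) * ?I r \<partial>lborel)
        = (\<integral>\<^sup>+r. of_nat (d - 1) * (ennreal (b r * A r ^ (d - 2)) * ?I r) \<partial>lborel)"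
        unfolding if_eq using m1 m2 by (intro nn_integral_cmult[symmetric]) simp
      also have "\<dots> = (\<integral>\<^sup>+r. ennreal (\<beta> r) * ?J r \<partial>lborel)"
      proof (rule nn_integral_cong)
        fix r
        have "of_nat (d - 1) * ennreal (b r * A r ^ (d - 2)) = ennreal (\<beta> r)"
          using d_ge_2 by (simp add: \<beta>_def ennreal_of_nat_eq_real_of_nat ennreal_mult[symmetric] b_nonneg A_nonneg of_nat_diff)
        then show "of_nat (d - 1) * (ennreal (b r * A r ^ (d - 2)) * ?I r) =
          ennreal (\<beta> r) * ?J r"
          unfolding if_eq by (simp only: mult.assoc[symmetric])
      qed
      finally show ?thesis .
    qed
    also have "\<dots> = (\<integral>\<^sup>+r. \<integral>\<^sup>+s. ennreal (\<beta> r) * (if s < r then \<phi> s * ennreal (a s) else 0) \<partial>lborel \<partial>lborel)"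
      by (intro nn_integral_cong nn_integral_cmult[symmetric]) measurable
    also have "\<dots> = (\<integral>\<^sup>+s. \<integral>\<^sup>+r. ennreal (\<beta> r) * (if s < r then \<phi> s * ennreal (a s) else 0) \<partial>lborel \<partial>lborel)"
      by (rule lborel_pair.Fubini') measurable
    also have "\<dots> = (\<integral>\<^sup>+s. \<phi> s * ennreal (a s) * (\<integral>\<^sup>+r\<in>{s<..}. ennreal (\<beta> r) \<partial>lborel) \<partial>lborel)"
    proof (rule nn_integral_cong)
      fix s :: real
      have "(\<integral>\<^sup>+r. ennreal (\<beta> r) * (if s < r then \<phi> s * ennreal (a s) else 0) \<partial>lborel) =
        (\<integral>\<^sup>+r. \<phi> s * ennreal (a s) * (ennreal (\<beta> r) * indicator {s<..} r) \<partial>lborel)"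
        by (intro nn_integral_cong) (auto simp: mult_ac)
      also have "\<dots> = \<phi> s * ennreal (a s) * (\<integral>\<^sup>+r\<in>{s<..}. ennreal (\<beta> r) \<partial>lborel)"
        by (rule nn_integral_cmult) measurable
      finally show "(\<integral>\<^sup>+r. ennreal (\<beta> r) * (if s < r then \<phi> s * ennreal (a s) else 0) \<partial>lborel) =
        \<phi> s * ennreal (a s) * (\<integral>\<^sup>+r\<in>{s<..}. ennreal (\<beta> r) \<partial>lborel)" .
    qed
    also have "\<dots> = (\<integral>\<^sup>+t\<in>{0<..<1}. \<phi> t * ennreal ((real d - g t) / real d) \<partial>lborel)"
    proof (rule nn_integral_cong)
      fix s :: real
      show "\<phi> s * ennreal (a s) * (\<integral>\<^sup>+r\<in>{s<..}. ennreal (\<beta> r) \<partial>lborel) =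
        \<phi> s * ennreal ((real d - g s) / real d) * indicator {0<..<1} s"
      proof (cases "s \<in> {0<..<1}")
        case True
        have "(\<integral>\<^sup>+r\<in>{s<..}. ennreal (\<beta> r) \<partial>lborel) = ennreal (Q s)"
          unfolding \<beta>_def using True by (intro nn_integral_b_A) auto
        then show ?thesis using True a_Q[of s]
          by (simp add: mult.assoc ennreal_mult[symmetric] a_nonneg Q_nonneg)
      qed (auto simp: a_def)
    qed
    finally show ?thesis .
  qed
  also have "(\<integral>\<^sup>+t\<in>{0<..<1}. \<phi> t * ennreal (g t / real d) \<partial>lborel) + (\<integral>\<^sup>+t\<in>{0<..<1}. \<phi> t * ennreal ((real d - g t) / real d) \<partial>lborel)
    = (\<integral>\<^sup>+t. \<phi> t * ennreal (g t / real d) * indicator {0<..<1} t + \<phi> t * ennreal ((real d - g t) / real d) * indicator {0<..<1} t \<partial>lborel)"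
    by (rule nn_integral_add[symmetric]) measurable
  also have "\<dots> = (\<integral>\<^sup>+t\<in>{0<..<1}. \<phi> t \<partial>lborel)"
  proof (rule nn_integral_cong)
    fix t
    have "ennreal (g t / real d) + ennreal ((real d - g t) / real d) = ennreal (g t / real d + (real d - g t) / real d)"
      using g_nonneg[of t] g_le[of t] by (simp del: ennreal_plus add: ennreal_plus[symmetric])
    also have "\<dots> = 1" using d_ge_2 by (simp add: add_divide_distrib[symmetric])
    finally have "\<phi> t * ennreal (g t / real d) + \<phi> t * ennreal ((real d - g t) / real d) = \<phi> t"
      by (simp add: distrib_left[symmetric])
    then show "\<phi> t * ennreal (g t / real d) * indicator {0<..<1} t + \<phi> t * ennreal ((real d - g t) / real d) * indicator {0<..<1} t
      = \<phi> t * indicator {0<..<1} t"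
      by (simp add: distrib_right[symmetric])
  qed
  also have "\<dots> = (\<integral>\<^sup>+t\<in>{0..1}. \<phi> t \<partial>lborel)"
    using AE_lborel_singleton[of 0] AE_lborel_singleton[of 1]
    by (intro nn_integral_cong_AE, eventually_elim) (auto split: split_indicator)
  finally show ?thesis .
qed

end

section \<open>Densities of copulas with a given diagonal\<close>

abbreviation law :: "(real ^ 'n::finite \<Rightarrow> real) \<Rightarrow> (real ^ 'n) measure" where
  "law c \<equiv> density lborel (\<lambda>x. ennreal (c x))"

lemma nn_integral_distr_law:
  assumes [measurable]: "c \<in> borel_measurable borel" "T \<in> borel_measurable borel" "f \<in> borel_measurable borel"
  shows "(\<integral>\<^sup>+t. f t \<partial>distr (law c) borel T) = (\<integral>\<^sup>+x. f (T x) * ennreal (c x) \<partial>lborel)"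
  by (subst nn_integral_distr, simp_all) (subst nn_integral_density, simp_all add: mult.commute)

text \<open>Uniformity of the marginals is stated through integrals of all nonnegative Borel
  functions, infinite integrals allowed, since unbounded functions such as -ln h enter later; \<phi>
  = 1 gives total mass 1.\<close>

definition copula_density :: "(real ^ 'n::finite \<Rightarrow> real) \<Rightarrow> bool" where
  "copula_density c \<longleftrightarrow> (\<forall>x. 0 \<le> c x) \<and> c \<in> borel_measurable borel \<and>
    (\<forall>k. \<forall>\<phi>\<in>borel_measurable borel.
      (\<integral>\<^sup>+x. \<phi> (x $ k) * ennreal (c x) \<partial>lborel) = (\<integral>\<^sup>+t\<in>{0..1}. \<phi> t \<partial>lborel))"

lemma copula_densityD:
  assumes "copula_density c"
  shows "0 \<le> c x" "c \<in> borel_measurable borel"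
    and "\<phi> \<in> borel_measurable borel \<Longrightarrow>
      (\<integral>\<^sup>+x. \<phi> (x $ k) * ennreal (c x) \<partial>lborel) = (\<integral>\<^sup>+t\<in>{0..1}. \<phi> t \<partial>lborel)"
  using assms by (auto simp: copula_density_def)

lemma nn_integral_copula_density:
  assumes "copula_density c"
  shows "(\<integral>\<^sup>+x. ennreal (c x) \<partial>lborel) = 1"
  using copula_densityD(3)[OF assms, of "\<lambda>_. 1"] by simp

lemma prob_space_copula_density:
  assumes c: "copula_density c"
  shows "prob_space (law c)"
proof -
  have [measurable]: "c \<in> borel_measurable borel" by (rule copula_densityD(2)[OF c])
  show ?thesis by (rule prob_spaceI) (simp add: emeasure_density nn_integral_copula_density[OF c])
qed

lemma copula_density_if_has_copula_density:
  fixes c :: "real ^ 'n::finite \<Rightarrow> real"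
  assumes "has_copula_density C c"
  shows "copula_density c"
    and "C = (\<lambda>u\<in>unit_cube. measure (law c) {x. \<forall>i. x $ i \<le> u $ i})"
proof -
  from assms obtain M :: "(real ^ 'n) measure" and U where c0: "\<And>x. 0 \<le> c x"
    and um: "uniform_marginals M U" and C: "C = cube_cdf M U"
    and dist: "distributed M lborel U (\<lambda>x. ennreal (c x))"
    by (auto simp: has_copula_density_def)
  have Um: "U \<in> borel_measurable M" using um by (simp add: uniform_marginals_def)
  then have Um': "U \<in> M \<rightarrow>\<^sub>M lborel" by simp
  have U_distr: "distr M lborel U = law c"
    using dist by (simp add: distributed_def)
  have "(\<lambda>x. ennreal (c x)) \<in> borel_measurable borel" using dist by (simp add: distributed_def)
  then have "(\<lambda>x. enn2real (ennreal (c x))) \<in> borel_measurable borel" by (rule borel_measurable_enn2real)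
  then have cm[measurable]: "c \<in> borel_measurable borel" using c0 by simp
  have "(\<integral>\<^sup>+x. \<phi> (x $ k) * ennreal (c x) \<partial>lborel) = (\<integral>\<^sup>+t\<in>{0..1}. \<phi> t \<partial>lborel)"
    if \<phi>[measurable]: "\<phi> \<in> borel_measurable borel" for k and \<phi> :: "real \<Rightarrow> ennreal"
  proof -
    have k: "distr M lborel (\<lambda>\<omega>. U \<omega> $ k) = density lborel (indicator {0..1})"
      using um by (simp add: uniform_marginals_def distributed_def)
    have km: "(\<lambda>\<omega>. U \<omega> $ k) \<in> M \<rightarrow>\<^sub>M lborel"
      using measurable_compose[OF Um borel_measurable_vec_nth_real[of k]] by simp
    have "(\<integral>\<^sup>+x. \<phi> (x $ k) * ennreal (c x) \<partial>lborel) = (\<integral>\<^sup>+x. \<phi> (x $ k) \<partial>law c)"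
      by (subst nn_integral_density) (auto simp: mult.commute)
    also have "\<dots> = (\<integral>\<^sup>+\<omega>. \<phi> (U \<omega> $ k) \<partial>M)"
      unfolding U_distr[symmetric] by (subst nn_integral_distr[OF Um']) auto
    also have "\<dots> = (\<integral>\<^sup>+t. \<phi> t \<partial>distr M lborel (\<lambda>\<omega>. U \<omega> $ k))"
      by (subst nn_integral_distr[OF km]) auto
    also have "\<dots> = (\<integral>\<^sup>+t\<in>{0..1}. \<phi> t \<partial>lborel)"
      unfolding k by (subst nn_integral_density) (auto simp: mult.commute)
    finally show ?thesis .
  qed
  then show "copula_density c" using c0 cm by (auto simp: copula_density_def)
  show "C = (\<lambda>u\<in>unit_cube. measure (law c) {x. \<forall>i. x $ i \<le> u $ i})"
    unfolding C cube_cdf_def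
  proof (rule restrict_ext)
    fix u :: "real ^ 'n"
    have "{x :: real ^ 'n. \<forall>i. x $ i \<le> u $ i} \<in> sets lborel" by measurable
    then have "measure (distr M lborel U) {x. \<forall>i. x $ i \<le> u $ i} = measure M (U -` {x. \<forall>i. x $ i \<le> u $ i} \<inter> space M)"
      by (rule measure_distr[OF Um'])
    also have "U -` {x. \<forall>i. x $ i \<le> u $ i} \<inter> space M = {\<omega> \<in> space M. \<forall>i. U \<omega> $ i \<le> u $ i}" by auto
    finally show "measure M {\<omega> \<in> space M. \<forall>i. U \<omega> $ i \<le> u $ i}
      = measure (law c) {x. \<forall>i. x $ i \<le> u $ i}"
      by (simp add: U_distr)
  qed
qed

text \<open>The sample space is \<open>real ^ 'n\<close> with the law itself, and the random vector
  is the identity.\<close>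

lemma has_copula_densityI:
  fixes c :: "real ^ 'n::finite \<Rightarrow> real"
  assumes c: "copula_density c"
    and C: "C = (\<lambda>u\<in>unit_cube. measure (law c) {x. \<forall>i. x $ i \<le> u $ i})"
  shows "has_copula_density C c" "C \<in> copulas"
proof -
  define M where "M = law c"
  have [measurable]: "c \<in> borel_measurable borel" by (rule copula_densityD(2)[OF c])
  have [measurable_cong]: "sets M = sets borel" by (simp add: M_def)
  have sp: "space M = UNIV" by (simp add: M_def)
  have um: "uniform_marginals M (\<lambda>x. x)"
    unfolding uniform_marginals_def
  proof (intro conjI allI)
    show "prob_space M" unfolding M_def by (rule prob_space_copula_density[OF c])
    fix k :: 'n
    have "distr M lborel (\<lambda>x. x $ k) = density lborel (indicator {0..1})"
    proof (rule measure_eqI)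
      fix S assume "S \<in> sets (distr M lborel (\<lambda>x. x $ k))"
      then have S[measurable]: "S \<in> sets borel" by simp
      have "emeasure (distr M lborel (\<lambda>x. x $ k)) S = (\<integral>\<^sup>+t. indicator S t \<partial>distr M borel (\<lambda>x. x $ k))"
        by (subst nn_integral_indicator) (auto cong: distr_cong)
      also have "\<dots> = (\<integral>\<^sup>+x. indicator S (x $ k) * ennreal (c x) \<partial>lborel)"
        unfolding M_def by (rule nn_integral_distr_law) measurable
      also have "\<dots> = (\<integral>\<^sup>+t\<in>{0..1}. indicator S t \<partial>lborel)"
        by (rule copula_densityD(3)[OF c]) auto
      also have "\<dots> = emeasure (density lborel (indicator {0..1})) S"
        by (subst emeasure_density) (auto simp: mult.commute)
      finally show "emeasure (distr M lborel (\<lambda>x. x $ k)) S = emeasure (density lborel (indicator {0..1})) S" .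
    qed simp
    then show "distributed M lborel (\<lambda>x. x $ k) (indicator {0..1})"
      by (auto simp: distributed_def)
  qed measurable
  have CM: "C = cube_cdf M (\<lambda>x. x)" unfolding C cube_cdf_def by (simp add: sp M_def[symmetric])
  have "distr M lborel (\<lambda>x. x) = M"
    by (rule distr_id2) (simp add: M_def)
  then have "distributed M lborel (\<lambda>x. x) (\<lambda>x. ennreal (c x))"
    unfolding distributed_def by (auto simp: M_def[symmetric])
  then show "has_copula_density C c"
    unfolding has_copula_density_def using um CM copula_densityD(1)[OF c] by blast
  show "C \<in> copulas" unfolding copulas_def using um CM by blast
qed

text \<open>Each coordinate is uniform, so it misses the complement of (0,1) almost surely. This
  makes integrals over the cube and over the whole space interchangeable.\<close>

lemma copula_density_AE_cube:
  fixes c :: "real ^ 'n::finite \<Rightarrow> real"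
  assumes c: "copula_density c"
  shows "AE x in lborel. c x \<noteq> 0 \<longrightarrow> (\<forall>i. 0 < x $ i \<and> x $ i < 1)"
proof -
  have [measurable]: "c \<in> borel_measurable borel" by (rule copula_densityD(2)[OF c])
  have "AE x in lborel. c x \<noteq> 0 \<longrightarrow> 0 < x $ i \<and> x $ i < 1" for i
  proof -
    have "(\<integral>\<^sup>+x. indicator (- {0<..<1}) (x $ i) * ennreal (c x) \<partial>lborel) = (\<integral>\<^sup>+t\<in>{0..1}. indicator (- {0<..<1 :: real}) t \<partial>lborel)"
      by (rule copula_densityD(3)[OF c, of "indicator (- {0<..<1})"]) auto
    also have "\<dots> = (\<integral>\<^sup>+(t::real). 0 \<partial>lborel)"
      using AE_lborel_singleton[of "0::real"] AE_lborel_singleton[of "1::real"]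
      by (intro nn_integral_cong_AE, eventually_elim) (auto split: split_indicator)
    finally have "(\<integral>\<^sup>+x. indicator (- {0<..<1}) (x $ i) * ennreal (c x) \<partial>lborel) = 0" by simp
    then have "AE x in lborel. indicator (- {0<..<1}) (x $ i) * ennreal (c x) = 0"
      by (subst (asm) nn_integral_0_iff_AE) auto
    then show ?thesis
    proof eventually_elim
      case (elim x)
      have "0 \<le> c x" by (rule copula_densityD(1)[OF c])
      then show ?case using elim by (auto simp: indicator_def split: if_splits)
    qed
  qed
  then have "AE x in lborel. \<forall>i. c x \<noteq> 0 \<longrightarrow> 0 < x $ i \<and> x $ i < 1"
    by (simp only: AE_all_countable) blast
  then show ?thesis by eventually_elim blast
qed

text \<open>\<open>info\<close> picks some density, hence the need for uniqueness. The orthants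
  below u form a generator stable under intersection, and C fixes their masses: 0 if some u_i is
  negative, otherwise the value of C at u with its coordinates capped at 1.\<close>

lemma copula_density_unique:
  fixes c c' :: "real ^ 'n::finite \<Rightarrow> real"
  assumes c: "has_copula_density C c" and c': "has_copula_density C c'"
  shows "AE x in lborel. c x = c' x"
proof -
  define N where "N c = law c" for c :: "real ^ 'n \<Rightarrow> real"
  have below: "emeasure (N c) {..u} =
      (if \<exists>i. u $ i < 0 then 0 else ennreal (C (\<chi> i. min 1 (u $ i))))"
    if cd: "has_copula_density C c" for c :: "real ^ 'n \<Rightarrow> real" and u
  proof -
    note c = copula_density_if_has_copula_density[OF cd]
    have [measurable]: "c \<in> borel_measurable borel" by (rule copula_densityD(2)[OF c(1)])
    have AE: "AE x in N c. \<forall>i. 0 < x $ i \<and> x $ i < 1"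
      unfolding N_def using copula_density_AE_cube[OF c(1)]
      by (subst AE_density) (auto elim!: eventually_mono)
    interpret prob_space "N c" unfolding N_def by (rule prob_space_copula_density[OF c(1)])
    have s: "{..v} \<in> sets (N c)" for v by (simp add: N_def)
    show ?thesis
    proof (cases "\<exists>i. u $ i < 0")
      case True
      then obtain i where i: "u $ i < 0" by auto
      have "AE x in N c. x \<notin> {..u}"
        using AE by eventually_elim (use i in \<open>auto simp: less_eq_vec_def not_le intro!: exI[of _ i] intro: less_trans\<close>)
      then have "{..u} \<in> null_sets (N c)" using AE_iff_null_sets[OF s] by blast
      then have "emeasure (N c) {..u} = 0" by auto
      then show ?thesis using True by simp
    next
      case False
      have "emeasure (N c) {..u} = emeasure (N c) {..\<chi> i. min 1 (u $ i)}"
        using AE by (intro emeasure_eq_AE, eventually_elim) (auto simp: less_eq_vec_def less_imp_le s)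
      also have "\<dots> = ennreal (measure (N c) {..\<chi> i. min 1 (u $ i)})" by (rule emeasure_eq_measure)
      also have "measure (N c) {..\<chi> i. min 1 (u $ i)} = C (\<chi> i. min 1 (u $ i))"
        unfolding c(2) using False by (auto simp: N_def unit_cube_def atMost_def less_eq_vec_def not_less)
      finally show ?thesis using False by simp
    qed
  qed
  have "N c = N c'"
  proof (rule measure_eqI_generator_eq[where E="range (\<lambda>u. {..u})" and \<Omega>=UNIV and A="\<lambda>n. {..\<chi> i. real n}"])
    show "Int_stable (range (\<lambda>u :: real ^ 'n. {..u}))"
    proof (rule Int_stableI)
      fix X Y assume "X \<in> range (\<lambda>u :: real ^ 'n. {..u})" "Y \<in> range (\<lambda>u :: real ^ 'n. {..u})"
      then obtain u v :: "real ^ 'n" where "X = {..u}" "Y = {..v}" by auto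
      then have "X \<inter> Y = {..inf u v}" by auto
      then show "X \<inter> Y \<in> range (\<lambda>u :: real ^ 'n. {..u})" by auto
    qed
    show "emeasure (N c) X = emeasure (N c') X" if "X \<in> range (\<lambda>u. {..u})" for X
      using that below[OF c] below[OF c'] by auto
    have "sets (borel :: (real ^ 'n) measure) = sigma_sets UNIV (range (\<lambda>u. {..u}))"
      by (subst borel_eq_atMost) simp
    then show "sets (N c) = sigma_sets UNIV (range (\<lambda>u. {..u}))" "sets (N c') = sigma_sets UNIV (range (\<lambda>u. {..u}))"
      by (simp_all add: N_def)
    show "(\<Union>n. {..(\<chi> i. real n) :: real ^ 'n}) = UNIV"
    proof (intro equalityI subsetI UNIV_I)
      fix x :: "real ^ 'n"
      obtain n where "max_coord x \<le> real n" using real_arch_simple by blast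
      then show "x \<in> (\<Union>n. {..\<chi> i. real n})" by (auto simp: less_eq_vec_def max_coord_le_iff)
    qed
    show "emeasure (N c) {..(\<chi> i. real n) :: real ^ 'n} \<noteq> \<infinity>" for n
      unfolding below[OF c] by simp
  qed auto
  then have eq: "law c = law c'" by (simp add: N_def)
  note c1 = copula_density_if_has_copula_density(1)[OF c] and c2 = copula_density_if_has_copula_density(1)[OF c']
  have [measurable]: "c \<in> borel_measurable borel" "c' \<in> borel_measurable borel"
    using copula_densityD(2)[OF c1] copula_densityD(2)[OF c2] .
  have "AE x in lborel. ennreal (c x) = ennreal (c' x)"
    using eq by (intro sigma_finite_measure.density_unique[OF sigma_finite_lborel]) auto
  then show ?thesis
    by eventually_elim (use copula_densityD(1)[OF c1] copula_densityD(1)[OF c2] in \<open>auto simp: ennreal_inj\<close>)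
qed

lemma diag_eq_measure_max:
  fixes c :: "real ^ 'n::finite \<Rightarrow> real"
  assumes c: "has_copula_density C c" and t: "t \<in> {0..1}"
  shows "ennreal (diag C t) = (\<integral>\<^sup>+x. indicator {..t} (max_coord x) * ennreal (c x) \<partial>lborel)"
    and "0 \<le> diag C t"
proof -
  note c1 = copula_density_if_has_copula_density[OF c]
  have [measurable]: "c \<in> borel_measurable borel" by (rule copula_densityD(2)[OF c1(1)])
  define N where "N = law c"
  interpret prob_space N unfolding N_def by (rule prob_space_copula_density[OF c1(1)])
  have eq: "{x :: real ^ 'n. \<forall>i. x $ i \<le> t} = {x. max_coord x \<le> t}" by (simp add: max_coord_le_iff)
  have "(\<chi> i. t) \<in> (unit_cube :: (real ^ 'n) set)" using t by (simp add: unit_cube_def)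
  then have d: "diag C t = measure N {x. max_coord x \<le> t}"
    using t by (simp add: diag_def c1(2) N_def eq)
  then show "0 \<le> diag C t" by simp
  have [measurable]: "{x :: real ^ 'n. max_coord x \<le> t} \<in> sets borel" by measurable
  have "ennreal (diag C t) = emeasure N {x. max_coord x \<le> t}" unfolding d by (rule emeasure_eq_measure[symmetric])
  also have "\<dots> = (\<integral>\<^sup>+x. indicator {..t} (max_coord x) * ennreal (c x) \<partial>lborel)"
    unfolding N_def by (subst emeasure_density) (auto intro!: nn_integral_cong split: split_indicator)
  finally show "ennreal (diag C t) = (\<integral>\<^sup>+x. indicator {..t} (max_coord x) * ennreal (c x) \<partial>lborel)" .
qed

text \<open>The test set consists of the points where w < f. Finiteness of the integral of w allows
  subtracting it there, which leaves f - w with integral 0.\<close>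

lemma AE_le_of_nn_integral_le:
  fixes f w :: "'a \<Rightarrow> ennreal"
  assumes [measurable]: "f \<in> borel_measurable M" "w \<in> borel_measurable M"
    and le: "\<And>B. B \<in> sets M \<Longrightarrow> (\<integral>\<^sup>+x\<in>B. f x \<partial>M) \<le> (\<integral>\<^sup>+x\<in>B. w x \<partial>M)"
    and fin: "(\<integral>\<^sup>+x. w x \<partial>M) < \<infinity>"
  shows "AE x in M. f x \<le> w x"
proof -
  define B where "B = {x \<in> space M. w x < f x}"
  have B[measurable]: "B \<in> sets M" unfolding B_def by measurable
  define I where "I = (\<integral>\<^sup>+x\<in>B. w x \<partial>M)"
  have I: "I < \<infinity>"
    unfolding I_def by (rule le_less_trans[OF nn_integral_mono fin]) (auto split: split_indicator)
  have "(\<integral>\<^sup>+x\<in>B. (f x - w x) \<partial>M) + I = (\<integral>\<^sup>+x. (f x - w x) * indicator B x + w x * indicator B x \<partial>M)"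
    unfolding I_def by (rule nn_integral_add[symmetric]) measurable
  also have "\<dots> = (\<integral>\<^sup>+x\<in>B. f x \<partial>M)"
    by (intro nn_integral_cong) (auto simp: B_def diff_add_cancel_ennreal less_imp_le split: split_indicator)
  also have "\<dots> \<le> I" unfolding I_def by (rule le) measurable
  finally have "(\<integral>\<^sup>+x\<in>B. (f x - w x) \<partial>M) + I \<le> 0 + I" by simp
  then have "(\<integral>\<^sup>+x\<in>B. (f x - w x) \<partial>M) = 0"
    using I by (auto simp: ennreal_add_left_cancel_le add.commute[of _ I])
  then have "AE x in M. (f x - w x) * indicator B x = 0"
    by (subst (asm) nn_integral_0_iff_AE) auto
  then show ?thesis
  proof (rule AE_mp, intro AE_I2 impI)
    fix x assume x: "x \<in> space M" "(f x - w x) * indicator B x = 0"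
    show "f x \<le> w x"
    proof (rule ccontr)
      assume n: "\<not> f x \<le> w x"
      then have "x \<in> B" using x by (auto simp: B_def)
      then have "f x - w x = 0" using x by simp
      then show False using n by (simp add: ennreal_minus_eq_0)
    qed
  qed
qed

text \<open>The maximum is one of the coordinates, so P(M in B) is at most the sum of the P(x_i in
  B), i.e. at most d times the length of B within [0,1]. The law of M therefore has a density
  bounded by d; \<open>min\<close> and the cut-off to (0,1) turn the almost sure bounds into bounds
  everywhere.\<close>

lemma max_density_exists:
  fixes c :: "real ^ 'n::finite \<Rightarrow> real"
  assumes c: "copula_density c"
  obtains g where "g \<in> borel_measurable borel" "\<And>t. 0 \<le> g t" "\<And>t. g t \<le> real CARD('n)"
    "\<And>t. t \<notin> {0<..<1} \<Longrightarrow> g t = 0"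
    "\<And>B. B \<in> sets borel \<Longrightarrow>
      (\<integral>\<^sup>+x. indicator B (max_coord x) * ennreal (c x) \<partial>lborel) = (\<integral>\<^sup>+t\<in>B. ennreal (g t) \<partial>lborel)"
proof -
  have [measurable]: "c \<in> borel_measurable borel" by (rule copula_densityD(2)[OF c])
  define L where "L = distr (law c) borel max_coord"
  define w :: "real \<Rightarrow> ennreal" where "w t = of_nat CARD('n) * indicator {0<..<1} t" for t
  have [measurable]: "w \<in> borel_measurable borel" unfolding w_def by measurable
  have L: "emeasure L B = (\<integral>\<^sup>+x. indicator B (max_coord x) * ennreal (c x) \<partial>lborel)" if [measurable]: "B \<in> sets borel" for B
  proof -
    have "emeasure L B = (\<integral>\<^sup>+t. indicator B t \<partial>L)" by (subst nn_integral_indicator) (auto simp: L_def)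
    also have "\<dots> = (\<integral>\<^sup>+x. indicator B (max_coord x) * ennreal (c x) \<partial>lborel)"
      unfolding L_def by (rule nn_integral_distr_law) measurable
    finally show ?thesis .
  qed
  have le: "emeasure L B \<le> (\<integral>\<^sup>+t\<in>B. w t \<partial>lborel)" if [measurable]: "B \<in> sets borel" for B
  proof -
    have "emeasure L B \<le> (\<integral>\<^sup>+x. (\<Sum>i\<in>(UNIV :: 'n set). indicator B (x $ i) * ennreal (c x)) \<partial>lborel)"
      unfolding L[OF that]
    proof (rule nn_integral_mono)
      fix x :: "real ^ 'n"
      obtain i where i: "max_coord x = x $ i" using max_coord_attained by blast
      show "indicator B (max_coord x) * ennreal (c x) \<le> (\<Sum>i\<in>UNIV. indicator B (x $ i) * ennreal (c x))"
        unfolding i by (rule member_le_sum[where f="\<lambda>i. indicator B (x $ i) * ennreal (c x)"]) auto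
    qed
    also have "\<dots> = (\<Sum>i\<in>(UNIV :: 'n set). \<integral>\<^sup>+x. indicator B (x $ i) * ennreal (c x) \<partial>lborel)"
      by (rule nn_integral_sum) measurable
    also have "\<dots> = of_nat CARD('n) * (\<integral>\<^sup>+t\<in>{0..1}. indicator B t \<partial>lborel)"
      using copula_densityD(3)[OF c, of "indicator B"] by simp
    also have "\<dots> = (\<integral>\<^sup>+t. of_nat CARD('n) * (indicator B t * indicator {0..1} t) \<partial>lborel)"
      by (rule nn_integral_cmult[symmetric]) measurable
    also have "\<dots> = (\<integral>\<^sup>+t\<in>B. w t \<partial>lborel)"
      using AE_lborel_singleton[of "0::real"] AE_lborel_singleton[of "1::real"]
      by (intro nn_integral_cong_AE, eventually_elim) (auto simp: w_def split: split_indicator)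
    finally show ?thesis .
  qed
  have "absolutely_continuous lborel L"
    unfolding absolutely_continuous_def
  proof
    fix B :: "real set" assume B: "B \<in> null_sets lborel"
    then have [measurable]: "B \<in> sets borel" by auto
    have "(\<integral>\<^sup>+t\<in>B. w t \<partial>lborel) = 0" by (rule nn_integral_null_set[OF B])
    then have "emeasure L B = 0" using le[of B] by simp
    then show "B \<in> null_sets L" by (auto simp: L_def)
  qed
  moreover have "sets L = sets lborel" by (simp add: L_def)
  ultimately obtain f where f[measurable]: "f \<in> borel_measurable lborel" and fL: "density lborel f = L"
    using sigma_finite_measure.Radon_Nikodym[OF sigma_finite_lborel] by blast
  have fL': "(\<integral>\<^sup>+t\<in>B. f t \<partial>lborel) = emeasure L B" if "B \<in> sets borel" for B
    using that by (simp add: fL[symmetric] emeasure_density)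
  have fw: "AE t in lborel. f t \<le> w t"
  proof (rule AE_le_of_nn_integral_le)
    show "(\<integral>\<^sup>+t\<in>B. f t \<partial>lborel) \<le> (\<integral>\<^sup>+t\<in>B. w t \<partial>lborel)" if "B \<in> sets lborel" for B
      using that le[of B] by (simp add: fL')
    have "(\<integral>\<^sup>+t. w t \<partial>lborel) = of_nat CARD('n) * emeasure lborel {0<..<1::real}"
      unfolding w_def by (subst nn_integral_cmult_indicator) auto
    also have "\<dots> < \<infinity>" by (simp add: of_nat_less_top)
    finally show "(\<integral>\<^sup>+t. w t \<partial>lborel) < \<infinity>" .
  qed auto
  define g where "g t = (if t \<in> {0<..<1} then min (real CARD('n)) (enn2real (f t)) else 0)" for t
  have gm: "g \<in> borel_measurable borel" unfolding g_def by measurable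
  have gf: "AE t in lborel. f t = ennreal (g t)"
    using fw
  proof eventually_elim
    case (elim t)
    show ?case
    proof (cases "t \<in> {0<..<1}")
      case True
      then have *: "f t \<le> ennreal (real CARD('n))" using elim by (simp add: w_def ennreal_of_nat_eq_real_of_nat)
      then have "f t < top" by (rule le_less_trans) simp
      moreover have "enn2real (f t) \<le> real CARD('n)" using * by (rule enn2real_leI[rotated]) simp
      ultimately show ?thesis using True by (simp add: g_def min_absorb2)
    next
      case False
      then have "w t = 0" by (auto simp: w_def)
      then show ?thesis using False elim by (auto simp: g_def)
    qed
  qed
  show thesis
  proof (rule that[of g])
    fix B :: "real set" assume B[measurable]: "B \<in> sets borel"
    show "(\<integral>\<^sup>+x. indicator B (max_coord x) * ennreal (c x) \<partial>lborel) = (\<integral>\<^sup>+t\<in>B. ennreal (g t) \<partial>lborel)"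
      unfolding L[OF B, symmetric] fL'[OF B, symmetric]
      using gf by (intro nn_integral_cong_AE, eventually_elim) simp
  qed (use gm in \<open>auto simp: g_def\<close>)
qed

text \<open>Any absolutely continuous witness for \<delta> supplies g. Since M \<ge> x_k, one has
  \<delta> t \<le> t; the hypothesis on the fixed points makes this strict inside (0,1) and fixes
  the values at 0 and 1.\<close>

theorem diagonal_density_exists:
  fixes \<delta> :: "real \<Rightarrow> real"
  assumes card: "CARD('n::finite) \<ge> 2"
    and \<delta>: "\<delta> \<in> ac_diagonals TYPE('n)"
    and fixpoints: "{t \<in> {0..1}. \<delta> t = t} = {0, 1}"
  shows "\<exists>g. diagonal_density \<delta> g CARD('n)"
proof -
  obtain C :: "real ^ 'n \<Rightarrow> real" and c where C: "\<delta> = diag C" "has_copula_density C c"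
    using \<delta> by (auto simp: ac_diagonals_def abs_cont_copula_def)
  note c = copula_density_if_has_copula_density(1)[OF C(2)]
  have [measurable]: "c \<in> borel_measurable borel" by (rule copula_densityD(2)[OF c])
  obtain g where g[measurable]: "g \<in> borel_measurable borel"
    and g0: "\<And>t. 0 \<le> g t" and gd: "\<And>t. g t \<le> real CARD('n)"
    and gout: "\<And>t. t \<notin> {0<..<1} \<Longrightarrow> g t = 0"
    and gB: "\<And>B. B \<in> sets borel \<Longrightarrow>
      (\<integral>\<^sup>+x. indicator B (max_coord x) * ennreal (c x) \<partial>lborel) = (\<integral>\<^sup>+t\<in>B. ennreal (g t) \<partial>lborel)"
    by (rule max_density_exists[OF c]) blast
  have \<delta>g: "ennreal (\<delta> t) = (\<integral>\<^sup>+s\<in>{..t}. ennreal (g s) \<partial>lborel)" if "t \<in> {0..1}" for t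
    using diag_eq_measure_max(1)[OF C(2) that] gB[of "{..t}"] by (simp add: C(1))
  have \<delta>_nonneg: "0 \<le> \<delta> t" if "t \<in> {0..1}" for t
    using diag_eq_measure_max(2)[OF C(2) that] by (simp add: C(1))
  have split: "ennreal (\<delta> t) = ennreal (\<delta> s) + (\<integral>\<^sup>+x\<in>{s..t}. ennreal (g x) \<partial>lborel)"
    if st: "0 \<le> s" "s \<le> t" "t \<le> 1" for s t
  proof -
    have t01: "t \<in> {0..1}" using st by auto
    have "ennreal (\<delta> t) = (\<integral>\<^sup>+x. ennreal (g x) * indicator {..s} x + ennreal (g x) * indicator {s..t} x \<partial>lborel)"
      unfolding \<delta>g[OF t01] using AE_lborel_singleton[of s]
      by (intro nn_integral_cong_AE, eventually_elim) (use st in \<open>auto split: split_indicator\<close>)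
    also have "\<dots> = ennreal (\<delta> s) + (\<integral>\<^sup>+x\<in>{s..t}. ennreal (g x) \<partial>lborel)"
      using st \<delta>g[of s] by (subst nn_integral_add) auto
    finally show ?thesis .
  qed
  have mono: "\<delta> s \<le> \<delta> t" if st: "0 \<le> s" "s \<le> t" "t \<le> 1" for s t
  proof -
    have "ennreal (\<delta> s) \<le> ennreal (\<delta> t)" unfolding split[OF st] by simp
    then show ?thesis using \<delta>_nonneg[of t] st by (subst (asm) ennreal_le_iff) auto
  qed
  have int: "(\<integral>\<^sup>+x\<in>{s..t}. ennreal (g x) \<partial>lborel) = ennreal (\<delta> t - \<delta> s)" if st: "0 \<le> s" "s \<le> t" "t \<le> 1" for s t
  proof -
    have "(\<integral>\<^sup>+x\<in>{s..t}. ennreal (g x) \<partial>lborel) = ennreal (\<delta> t) - ennreal (\<delta> s)"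
      unfolding split[OF st] by simp
    then show ?thesis using \<delta>_nonneg[of s] st by (simp add: ennreal_minus)
  qed
  have fp: "\<delta> t = t \<longleftrightarrow> t = 0 \<or> t = 1" if "t \<in> {0..1}" for t using fixpoints that by auto
  have \<delta>01: "\<delta> 0 = 0" "\<delta> 1 = 1" using fp[of 0] fp[of 1] by auto
  have less: "\<delta> t < t" if t: "0 < t" "t < 1" for t
  proof -
    fix k :: 'n
    have "ennreal (\<delta> t) \<le> (\<integral>\<^sup>+x. indicator {..t} (x $ k) * ennreal (c x) \<partial>lborel)"
      using diag_eq_measure_max(1)[OF C(2), of t] t unfolding C(1)
      by (auto intro!: nn_integral_mono split: split_indicator dest: order_trans[OF nth_le_max_coord])
    also have "\<dots> = (\<integral>\<^sup>+s\<in>{0..1}. indicator {..t} s \<partial>lborel)"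
      by (rule copula_densityD(3)[OF c]) auto
    also have "\<dots> = (\<integral>\<^sup>+s. indicator {0..t} s \<partial>lborel)"
      using t by (intro nn_integral_cong) (auto split: split_indicator)
    also have "\<dots> = ennreal t" using t by simp
    finally have "\<delta> t \<le> t" using t by (subst (asm) ennreal_le_iff) auto
    then show ?thesis using fp[of t] t by auto
  qed
  have der: "AE t in lborel. t \<in> {0<..<1} \<longrightarrow> (\<delta> has_real_derivative g t) (at t)"
  proof -
    \<comment> \<open>Constant continuation of \<delta>: as g vanishes off (0,1), it is a primitive
      of g on the whole line.\<close>
    define G where "G t = \<delta> (max 0 (min 1 t))" for t
    have "AE t in lborel. (G has_real_derivative g t) (at t)"
    proof (rule AE_has_real_derivative_nn_integral[OF g g0 gd])
      show "mono G" unfolding G_def by (intro monoI mono) auto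
      fix s t :: real assume st: "s \<le> t"
      have "(\<integral>\<^sup>+x\<in>{s..t}. ennreal (g x) \<partial>lborel) = (\<integral>\<^sup>+x\<in>{max 0 (min 1 s)..max 0 (min 1 t)}. ennreal (g x) \<partial>lborel)"
      proof (rule nn_integral_cong)
        fix x
        have "x \<in> {s..t} \<longleftrightarrow> x \<in> {max 0 (min 1 s)..max 0 (min 1 t)}" if "x \<in> {0<..<1}"
          using that by auto
        then show "ennreal (g x) * indicator {s..t} x = ennreal (g x) * indicator {max 0 (min 1 s)..max 0 (min 1 t)} x"
          using gout[of x] by (cases "x \<in> {0<..<1}") (simp_all add: indicator_def)
      qed
      also have "\<dots> = ennreal (G t - G s)" unfolding G_def using st by (intro int) auto
      finally show "(\<integral>\<^sup>+x\<in>{s..t}. ennreal (g x) \<partial>lborel) = ennreal (G t - G s)" .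
    qed
    then show ?thesis
    proof (eventually_elim, intro impI)
      fix t assume D: "(G has_real_derivative g t) (at t)" and t: "t \<in> {0<..<1}"
      have "eventually (\<lambda>x. x \<in> {0<..<1}) (nhds t)" using t by (intro eventually_nhds_in_open) auto
      then have "eventually (\<lambda>x. G x = \<delta> x) (nhds t)" by eventually_elim (auto simp: G_def)
      then show "(\<delta> has_real_derivative g t) (at t)"
        using D DERIV_cong_ev[of t t G \<delta> "g t" "g t"] by auto
    qed
  qed
  have "diagonal_density \<delta> g CARD('n)"
    by unfold_locales (fact card g g0 gd gout \<delta>01 less mono int der)+
  then show ?thesis by blast
qed

text \<open>A cylinder over a null set is null: in the product of the coordinate integrals the
  factor of i is 0, and 0 times infinity is 0.\<close>

lemma AE_lborel_nth:
  assumes "AE t in lborel. P (t :: real)"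
  shows "AE x in (lborel :: (real ^ 'n::finite) measure). P (x $ i)"
proof -
  interpret P: product_sigma_finite "\<lambda>_ :: 'n. lborel :: real measure" by standard
  obtain N where N: "{t. \<not> P t} \<subseteq> N" "N \<in> null_sets lborel"
    using assms by (auto elim!: AE_E2 simp: eventually_ae_filter)
  have [measurable]: "N \<in> sets borel" using N(2) by auto
  have "(\<integral>\<^sup>+x. indicator N (x $ i) \<partial>(lborel :: (real ^ 'n) measure)) = (\<integral>\<^sup>+y. indicator N (y i) \<partial>(\<Pi>\<^sub>M j\<in>UNIV. lborel))"
    by (subst lborel_vec_eq_distr_PiM, subst nn_integral_distr[OF borel_measurable_vec_lambda_PiM]) auto
  also have "\<dots> = (\<integral>\<^sup>+y. (\<Prod>j\<in>UNIV. if j = i then indicator N (y j) else 1) \<partial>(\<Pi>\<^sub>M j\<in>UNIV. lborel))"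
    by simp
  also have "\<dots> = (\<Prod>j\<in>(UNIV :: 'n set). \<integral>\<^sup>+t. (if j = i then indicator N t else 1) \<partial>lborel)"
    by (rule P.product_nn_integral_prod[where f="\<lambda>j t. if j = i then indicator N t else 1"]) auto
  also have "\<dots> = 0" using N(2) by (intro prod_zero bexI[of _ i]) auto
  finally have "AE x in (lborel :: (real ^ 'n) measure). indicator N (x $ i) = (0 :: ennreal)"
    by (subst (asm) nn_integral_0_iff_AE) auto
  then show ?thesis by eventually_elim (use N(1) in \<open>auto simp: indicator_eq_0_iff\<close>)
qed

section \<open>The copula \<open>C_delta\<close> and the law of the maximum within the class\<close>

context diagonal_density
begin

lemma copula_density_dens:
  assumes "CARD('n) = d"
  shows "copula_density (dens :: real ^ 'n::finite \<Rightarrow> real)"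
  unfolding copula_density_def using dens_nonneg nn_integral_nth_dens[OF assms] by auto

text \<open>Restricted to the cube, because outside [0,1] the formulas for \<open>a_fun\<close> and
  \<open>b_fun\<close> involve uncontrolled values of \<delta>.\<close>

lemma c_delta_eq_dens:
  assumes "CARD('n) = d"
  shows "AE x in (lborel :: (real ^ 'n::finite) measure). x \<in> unit_cube \<longrightarrow> c_delta \<delta> x = dens x"
proof -
  have "AE x in (lborel :: (real ^ 'n) measure). \<forall>i. x $ i \<in> {0..1} \<longrightarrow>
      a_fun d \<delta> (x $ i) = a (x $ i) \<and> b_fun d \<delta> (x $ i) = b (x $ i)"
    by (simp only: AE_all_countable) (intro allI AE_lborel_nth[OF AE_a_fun])
  then show ?thesis
  proof (eventually_elim, intro impI)
    fix x :: "real ^ 'n"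
    assume *: "\<forall>i. x $ i \<in> {0..1} \<longrightarrow> a_fun d \<delta> (x $ i) = a (x $ i) \<and> b_fun d \<delta> (x $ i) = b (x $ i)"
      and x: "x \<in> unit_cube"
    obtain k where k: "max_coord x = x $ k" using max_coord_attained by blast
    have "x $ i \<in> {0..1}" for i using x by (simp add: unit_cube_def)
    then have ab: "a_fun d \<delta> (x $ i) = a (x $ i)" "b_fun d \<delta> (x $ i) = b (x $ i)" for i using * by blast+
    have "b_fun d \<delta> (max_coord x) = b (max_coord x)" unfolding k by (rule ab)
    then show "c_delta \<delta> x = dens x"
      unfolding c_delta_def dens_def assms by (simp add: ab)
  qed
qed

text \<open>\<open>C_delta\<close> is a Bochner integral, and replacing its integrand almost
  everywhere requires measurability; hence the Borel functions \<open>\<alpha>\<close> and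
  \<open>\<beta>\<close> that agree with \<open>a_fun\<close> and \<open>b_fun\<close> on [0,1]. The
  passage from \<open>S\<close> to the whole orthant uses that \<open>dens\<close> lives on the
  cube.\<close>

lemma C_delta_eq:
  assumes card: "CARD('n) = d"
  shows "(C_delta \<delta> :: real ^ 'n::finite \<Rightarrow> real) =
    (\<lambda>u\<in>unit_cube. measure (law dens) {x. \<forall>i. x $ i \<le> u $ i})"
  unfolding C_delta_def
proof (rule restrict_ext)
  fix u :: "real ^ 'n"
  define S where "S = {x \<in> unit_cube. \<forall>i. x $ i \<le> u $ i}"
  have cube[measurable]: "(unit_cube :: (real ^ 'n) set) \<in> sets borel"
  proof -
    have "{x :: real ^ 'n. \<forall>i. x $ i \<in> {0..1}} \<in> sets borel" by measurable
    then show ?thesis by (simp add: unit_cube_def)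
  qed
  have le[measurable]: "{x :: real ^ 'n. \<forall>i. x $ i \<le> u $ i} \<in> sets borel" by measurable
  have S_eq: "S = unit_cube \<inter> {x. \<forall>i. x $ i \<le> u $ i}" by (auto simp: S_def)
  have S[measurable]: "S \<in> sets borel" unfolding S_eq using cube le by (rule sets.Int)
  define \<alpha> \<beta> where "\<alpha> t = (if t \<in> {0..1} then a_fun d \<delta> t else 0)" and "\<beta> t = (if t \<in> {0..1} then b_fun d \<delta> t else 0)" for t
  have [measurable]: "\<alpha> \<in> borel_measurable borel" "\<beta> \<in> borel_measurable borel" unfolding \<alpha>_def \<beta>_def by measurable
  have eq: "indicator S x *\<^sub>R c_delta \<delta> x = indicator S x *\<^sub>R (\<beta> (max_coord x) * (\<Prod>i | x $ i \<noteq> max_coord x. \<alpha> (x $ i)))" for x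
  proof (cases "x \<in> S")
    case True
    obtain k where k: "max_coord x = x $ k" using max_coord_attained by blast
    have "x $ i \<in> {0..1}" for i using True by (simp add: S_def unit_cube_def)
    then have ab: "a_fun d \<delta> (x $ i) = \<alpha> (x $ i)" "b_fun d \<delta> (x $ i) = \<beta> (x $ i)" for i by (simp_all add: \<alpha>_def \<beta>_def)
    have "b_fun d \<delta> (max_coord x) = \<beta> (max_coord x)" unfolding k by (rule ab)
    then show ?thesis unfolding c_delta_def card by (simp add: ab)
  qed simp
  have "(\<lambda>x :: real ^ 'n. indicator S x *\<^sub>R (\<beta> (max_coord x) * (\<Prod>i | x $ i \<noteq> max_coord x. \<alpha> (x $ i)))) \<in> borel_measurable borel"
    using borel_measurable_prod_nonmax[of \<alpha>] by measurable
  then have m: "(\<lambda>x :: real ^ 'n. indicator S x *\<^sub>R c_delta \<delta> x) \<in> borel_measurable lborel" unfolding eq by simp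
  have "(LINT x:S|lborel. c_delta \<delta> x) = (LINT x|lborel. indicator S x *\<^sub>R dens x)"
    unfolding set_lebesgue_integral_def
  proof (rule integral_cong_AE[OF m])
    show "AE x in lborel. indicator S x *\<^sub>R c_delta \<delta> x = indicator S x *\<^sub>R dens x"
      using c_delta_eq_dens[OF card] by eventually_elim (auto simp: S_def split: split_indicator)
  qed measurable
  also have "\<dots> = enn2real (\<integral>\<^sup>+x. ennreal (indicator S x *\<^sub>R dens x) \<partial>lborel)"
    by (rule integral_eq_nn_integral) (auto simp: dens_nonneg)
  also have "(\<integral>\<^sup>+x. ennreal (indicator S x *\<^sub>R dens x) \<partial>lborel) = (\<integral>\<^sup>+x\<in>{x. \<forall>i. x $ i \<le> u $ i}. ennreal (dens x) \<partial>lborel)"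
    using copula_density_AE_cube[OF copula_density_dens[OF card]]
    by (intro nn_integral_cong_AE, eventually_elim)
      (auto simp: S_def unit_cube_def less_imp_le split: split_indicator)
  also have "\<dots> = emeasure (law dens) {x. \<forall>i. x $ i \<le> u $ i}"
    by (subst emeasure_density) auto
  finally show "(LINT x:{x \<in> unit_cube. \<forall>i. x $ i \<le> u $ i}|lborel. c_delta \<delta> x) =
    measure (law dens) {x. \<forall>i. x $ i \<le> u $ i}"
    by (simp add: S_def measure_def)
qed

lemma has_copula_density_C_delta:
  assumes card: "CARD('n) = d"
  shows "has_copula_density (C_delta \<delta> :: real ^ 'n::finite \<Rightarrow> real) dens" "(C_delta \<delta> :: real ^ 'n \<Rightarrow> real) \<in> copulas"
  using has_copula_densityI[OF copula_density_dens[OF card] C_delta_eq[OF card]] by auto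

lemma nn_integral_g_atMost:
  assumes "t \<in> {0..1}"
  shows "(\<integral>\<^sup>+s\<in>{..t}. ennreal (g s) \<partial>lborel) = ennreal (\<delta> t)"
proof -
  have "(\<integral>\<^sup>+s\<in>{..t}. ennreal (g s) \<partial>lborel) = (\<integral>\<^sup>+s\<in>{0..t}. ennreal (g s) \<partial>lborel)"
    using assms g_outside by (intro nn_integral_cong) (auto split: split_indicator)
  also have "\<dots> = ennreal (\<delta> t)" using assms nn_integral_g[of 0 t] delta_0 by simp
  finally show ?thesis .
qed

lemma diag_C_delta:
  assumes card: "CARD('n) = d" and ext: "\<delta> \<in> extensional {0..1}"
  shows "diag (C_delta \<delta> :: real ^ 'n::finite \<Rightarrow> real) = \<delta>"
proof (rule extensionalityI[OF _ ext])
  show "diag (C_delta \<delta> :: real ^ 'n \<Rightarrow> real) \<in> extensional {0..1}" by (simp add: diag_def)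
  fix t :: real assume t: "t \<in> {0..1}"
  note D = diag_eq_measure_max[OF has_copula_density_C_delta(1)[OF card] t]
  have "ennreal (diag (C_delta \<delta> :: real ^ 'n \<Rightarrow> real) t) = ennreal (\<delta> t)"
    unfolding D(1) using nn_integral_g_atMost[OF t] nn_integral_max_dens[OF card, of "indicator {..t}"]
    by (simp add: mult.commute)
  then show "diag (C_delta \<delta> :: real ^ 'n \<Rightarrow> real) t = \<delta> t"
    using D(2) delta_nonneg[of t] t by (subst (asm) ennreal_inj) auto
qed

text \<open>g was obtained from one particular copula; here it is seen to serve every competitor
  with a density. The diagonal is the distribution function of M on [0,1], outside it is 0 or 1, and
  a distribution function determines the law.\<close>

lemma nn_integral_max_copula:
  fixes c :: "real ^ 'n::finite \<Rightarrow> real"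
  assumes c: "has_copula_density C c" and diag: "diag C = \<delta>" and \<phi>[measurable]: "\<phi> \<in> borel_measurable borel"
  shows "(\<integral>\<^sup>+x. \<phi> (max_coord x) * ennreal (c x) \<partial>lborel) = (\<integral>\<^sup>+t. \<phi> t * ennreal (g t) \<partial>lborel)"
proof -
  note c1 = copula_density_if_has_copula_density[OF c]
  have [measurable]: "c \<in> borel_measurable borel" by (rule copula_densityD(2)[OF c1(1)])
  define N where "N = law c"
  have [measurable_cong]: "sets N = sets borel" by (simp add: N_def)
  interpret N: prob_space N unfolding N_def by (rule prob_space_copula_density[OF c1(1)])
  define L where "L = distr N borel max_coord"
  define L' where "L' = density lborel (\<lambda>t. ennreal (g t))"
  interpret L: prob_space L unfolding L_def by (rule N.prob_space_distr) measurable
  have L: "(\<integral>\<^sup>+t. f t \<partial>L) = (\<integral>\<^sup>+x. f (max_coord x) * ennreal (c x) \<partial>lborel)" if "f \<in> borel_measurable borel" for f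
    unfolding L_def N_def using that by (intro nn_integral_distr_law) measurable
  have L': "(\<integral>\<^sup>+t. f t \<partial>L') = (\<integral>\<^sup>+t. f t * ennreal (g t) \<partial>lborel)" if [measurable]: "f \<in> borel_measurable borel" for f
    unfolding L'_def by (subst nn_integral_density) (auto simp: mult.commute)
  have g1: "(\<integral>\<^sup>+s\<in>{..t}. ennreal (g s) \<partial>lborel) = 1" if "1 \<le> t" for t
  proof -
    have "(\<integral>\<^sup>+s\<in>{..t}. ennreal (g s) \<partial>lborel) = (\<integral>\<^sup>+s\<in>{..1}. ennreal (g s) \<partial>lborel)"
      using that g_outside by (intro nn_integral_cong) (auto split: split_indicator)
    then show ?thesis using nn_integral_g_atMost[of 1] delta_1 by simp
  qed
  have "emeasure L' UNIV = (\<integral>\<^sup>+s\<in>{..1}. ennreal (g s) \<partial>lborel)"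
    unfolding L'_def using g_outside by (subst emeasure_density) (auto intro!: nn_integral_cong split: split_indicator)
  then have "emeasure L' (space L') = 1" using g1[of 1] by (simp add: L'_def)
  then interpret L': prob_space L' by (rule prob_spaceI)
  have cube: "AE x in lborel. c x \<noteq> 0 \<longrightarrow> (\<forall>i. 0 < x $ i \<and> x $ i < 1)" by (rule copula_density_AE_cube[OF c1(1)])
  have "emeasure L {..t} = emeasure L' {..t}" for t
  proof -
    have "emeasure L {..t} = (\<integral>\<^sup>+s. indicator {..t} s \<partial>L)" by (subst nn_integral_indicator) (auto simp: L_def)
    then have at_L: "emeasure L {..t} = (\<integral>\<^sup>+x. indicator {..t} (max_coord x) * ennreal (c x) \<partial>lborel)" by (simp add: L)
    have at_L': "emeasure L' {..t} = (\<integral>\<^sup>+s\<in>{..t}. ennreal (g s) \<partial>lborel)"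
      unfolding L'_def by (subst emeasure_density) auto
    consider "t < 0" | "t \<in> {0..1}" | "1 < t" by force
    then show ?thesis
    proof cases
      case 1
      have "(\<integral>\<^sup>+x. indicator {..t} (max_coord x) * ennreal (c x) \<partial>lborel) = (\<integral>\<^sup>+(x :: real ^ 'n). 0 \<partial>lborel)"
        using cube
      proof (intro nn_integral_cong_AE, eventually_elim)
        case (elim x)
        obtain k where "max_coord x = x $ k" using max_coord_attained by blast
        then show ?case using elim 1 by (auto split: split_indicator dest!: spec[of _ k])
      qed
      moreover have "(\<integral>\<^sup>+s\<in>{..t}. ennreal (g s) \<partial>lborel) = (\<integral>\<^sup>+(s :: real). 0 \<partial>lborel)"
        using 1 g_outside by (intro nn_integral_cong) (auto split: split_indicator)
      ultimately show ?thesis using at_L at_L' by simp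
    next
      case 2
      then show ?thesis unfolding at_L at_L'
        using diag_eq_measure_max(1)[OF c 2] nn_integral_g_atMost[OF 2] diag by simp
    next
      case 3
      have "(\<integral>\<^sup>+x. indicator {..t} (max_coord x) * ennreal (c x) \<partial>lborel) = (\<integral>\<^sup>+x. ennreal (c x) \<partial>lborel)"
        using cube
      proof (intro nn_integral_cong_AE, eventually_elim)
        case (elim x)
        obtain k where "max_coord x = x $ k" using max_coord_attained by blast
        then show ?case using elim 3 by (auto split: split_indicator dest!: spec[of _ k])
      qed
      then show ?thesis unfolding at_L at_L' using g1[of t] 3 nn_integral_copula_density[OF c1(1)] by simp
    qed
  qed
  then have "cdf L = cdf L'" by (auto simp: cdf_def measure_def fun_eq_iff)
  then have "L = L'"
  proof (rule cdf_unique[rotated 2])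
    show "real_distribution L"
      by (rule real_distribution.intro[OF L.prob_space_axioms]) (simp add: real_distribution_axioms_def L_def)
    show "real_distribution L'"
      by (rule real_distribution.intro[OF L'.prob_space_axioms]) (simp add: real_distribution_axioms_def L'_def)
  qed
  then show ?thesis using L[OF \<phi>] L'[OF \<phi>] by simp
qed

end

section \<open>Entropy\<close>

text \<open>This is ln w \<le> w - 1 at w = v/u, with equality only for w = 1. For u = 0 the claim
  is -v \<le> 0, by 0 * ln 0 = 0, and equality is excluded by v > 0.\<close>

lemma mult_ln_ge:
  fixes u v :: real
  assumes u: "0 \<le> u" and v: "0 < v"
  shows "u * ln v + u - v \<le> u * ln u" and "u * ln u = u * ln v + u - v \<longleftrightarrow> u = v"
proof -
  have "u * ln v + u - v \<le> u * ln u \<and> (u * ln u = u * ln v + u - v \<longrightarrow> u = v)"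
  proof (cases "u = 0")
    case False
    then have u: "0 < u" using u by simp
    have ln: "ln (v / u) = ln v - ln u" using u v by (simp add: ln_div)
    have vu: "0 < v / u" using u v by simp
    have "ln (v / u) \<le> v / u - 1" by (rule ln_le_minus_one[OF vu])
    then have "u * ln (v / u) \<le> u * (v / u - 1)" using u by (intro mult_left_mono) auto
    also have "\<dots> = v - u" using u by (simp add: field_simps)
    finally have le: "u * ln v - u * ln u \<le> v - u" unfolding ln by (simp add: right_diff_distrib)
    moreover have "u = v" if eq: "u * ln u = u * ln v + u - v"
    proof -
      have "u * ln (v / u) = v - u" unfolding ln using eq by (simp add: right_diff_distrib)
      also have "\<dots> = u * (v / u - 1)" using u by (simp add: field_simps)
      finally have "u * ln (v / u) = u * (v / u - 1)" .
      then have "ln (v / u) = v / u - 1" using u by simp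
      then have "v / u = 1" by (rule ln_eq_minus_one[OF vu])
      then show ?thesis using u by simp
    qed
    ultimately show ?thesis by auto
  qed (use v in auto)
  then show "u * ln v + u - v \<le> u * ln u" "u * ln u = u * ln v + u - v \<longleftrightarrow> u = v" by auto
qed

lemma neg_mult_ln_le_1:
  fixes u :: real
  assumes "0 \<le> u"
  shows "- (u * ln u) \<le> 1"
  using mult_ln_ge(1)[of u 1] assms by simp

lemma unit_cube_eq_cbox: "(unit_cube :: (real ^ 'n::finite) set) = cbox 0 (\<chi> i. 1)"
  by (auto simp: unit_cube_def mem_box_cart)

abbreviation nonmax_sum :: "(real \<Rightarrow> real) \<Rightarrow> real ^ 'n::finite \<Rightarrow> ennreal" where
  "nonmax_sum \<phi> x \<equiv> (\<Sum>i\<in>UNIV. ennreal (\<phi> (x $ i)) * (if x $ i \<noteq> max_coord x then 1 else 0))"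

text \<open>The negative part of c ln c is at most 1 and lives on the cube, so its integral is
  finite; hence only the positive part decides between integrability and the value infinity.\<close>

lemma c_log_c_integral_eq:
  fixes c :: "real ^ 'n::finite \<Rightarrow> real"
  assumes c: "copula_density c"
  shows "integrable lborel (\<lambda>x. c x * ln (c x)) \<Longrightarrow>
      c_log_c_integral c = ereal (LINT x|lborel. c x * ln (c x))"
    and "\<not> integrable lborel (\<lambda>x. c x * ln (c x)) \<Longrightarrow> c_log_c_integral c = \<infinity>"
    and "(\<integral>\<^sup>+x. ennreal (c x * ln (c x)) \<partial>lborel) < \<infinity> \<Longrightarrow> integrable lborel (\<lambda>x. c x * ln (c x))"
proof -
  have [measurable]: "c \<in> borel_measurable borel" by (rule copula_densityD(2)[OF c])
  have c0: "0 \<le> c x" for x by (rule copula_densityD(1)[OF c])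
  let ?P = "\<integral>\<^sup>+x. ennreal (c x * ln (c x)) \<partial>lborel" and ?N = "\<integral>\<^sup>+x. ennreal (- (c x * ln (c x))) \<partial>lborel"
  have cube: "AE x in lborel. x \<notin> unit_cube \<longrightarrow> c x = 0"
    using copula_density_AE_cube[OF c] by eventually_elim (auto simp: unit_cube_def less_imp_le)
  have P: "(\<integral>\<^sup>+x\<in>unit_cube. ennreal (c x * ln (c x)) \<partial>lborel) = ?P"
    using cube by (intro nn_integral_cong_AE, eventually_elim) (auto split: split_indicator)
  have N: "(\<integral>\<^sup>+x\<in>unit_cube. ennreal (- (c x * ln (c x))) \<partial>lborel) = ?N"
    using cube by (intro nn_integral_cong_AE, eventually_elim) (auto split: split_indicator)
  have "?N \<le> (\<integral>\<^sup>+x. indicator (unit_cube :: (real ^ 'n) set) x \<partial>lborel)"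
    unfolding N[symmetric] using neg_mult_ln_le_1[OF c0]
    by (intro nn_integral_mono) (auto split: split_indicator simp: ennreal_le_1)
  also have "\<dots> = emeasure lborel (unit_cube :: (real ^ 'n) set)"
    by (subst nn_integral_indicator) (auto simp: unit_cube_eq_cbox)
  also have "\<dots> < \<infinity>" unfolding unit_cube_eq_cbox by (rule emeasure_lborel_cbox_finite)
  finally have Nfin: "?N < \<infinity>" .
  have meas: "(\<lambda>x. c x * ln (c x)) \<in> borel_measurable lborel" by measurable
  have int_iff: "integrable lborel (\<lambda>x. c x * ln (c x)) \<longleftrightarrow> ?P < \<infinity>"
    unfolding real_integrable_def using Nfin meas by (auto simp: less_top)
  then show "?P < \<infinity> \<Longrightarrow> integrable lborel (\<lambda>x. c x * ln (c x))" by simp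
  have "?N = ennreal (enn2real ?N)" using Nfin by simp
  then obtain n where n: "?N = ennreal n" "0 \<le> n" by (metis enn2real_nonneg)
  show "c_log_c_integral c = ereal (LINT x|lborel. c x * ln (c x))" if int: "integrable lborel (\<lambda>x. c x * ln (c x))"
  proof -
    have "?P = ennreal (enn2real ?P)" using int int_iff by simp
    then obtain p where p: "?P = ennreal p" "0 \<le> p" by (metis enn2real_nonneg)
    show ?thesis
      unfolding c_log_c_integral_def P N real_lebesgue_integral_def[OF int] p(1) n(1) using p n by simp
  qed
  show "c_log_c_integral c = \<infinity>" if "\<not> integrable lborel (\<lambda>x. c x * ln (c x))"
  proof -
    have "?P = top" using that int_iff by (simp add: less_top[symmetric])
    then show ?thesis unfolding c_log_c_integral_def P N n(1) using n by (simp add: top_ereal_def)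
  qed
qed

section \<open>The gain, the loss and the finiteness of the loss integral\<close>

context diagonal_density
begin

text \<open>Off (0,1) the value is -ln 0 = 0, so the function is Borel and nonnegative on the whole
  line.\<close>

definition neg_ln_h :: "real \<Rightarrow> real" where
  "neg_ln_h t = - ln (if t \<in> {0<..<1} then h t else 0)"

definition F0 :: "real \<Rightarrow> real" where
  "F0 t = (if t \<in> {0<..<1} then F t else 0)"

text \<open>Where g t = 0 the default ln 0 = 0 gives 0 instead of infinity; such t carry no mass of
  M. Likewise \<open>l2\<close> is 0 where g t = d, and there the coordinates below the maximum have
  no mass.\<close>

definition l1 :: "real \<Rightarrow> real" where
  "l1 t = - ln (g t / real d)"

definition l2 :: "real \<Rightarrow> real" where
  "l2 t = - ln (1 - g t / real d)"

definition gain :: "real ^ 'n::finite \<Rightarrow> real" where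
  "gain x = (1 - 1 / real d) * (\<Sum>i\<in>UNIV. neg_ln_h (x $ i))"

definition loss :: "real ^ 'n::finite \<Rightarrow> real" where
  "loss x = (\<Sum>i\<in>UNIV. F0 (max_coord x) - F0 (x $ i)) + l1 (max_coord x)
     + (\<Sum>i\<in>UNIV. if x $ i \<noteq> max_coord x then l2 (x $ i) else 0)"

text \<open>The summands belong to the three parts of \<open>loss\<close>: d coordinates with
  (d-1)/d each, then M with density g, then the coordinates below the maximum, whose densities add
  up to d - g on [0,1].\<close>

definition loss_integral :: ennreal where
  "loss_integral = ennreal (real d - 1) + (\<integral>\<^sup>+t. ennreal (l1 t) * ennreal (g t) \<partial>lborel)
     + (\<integral>\<^sup>+t\<in>{0..1}. ennreal (l2 t) * ennreal (real d - g t) \<partial>lborel)"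

lemma neg_ln_h_nonneg: "0 \<le> neg_ln_h t"
  using h_pos[of t] h_le[of t] by (auto simp: neg_ln_h_def)

lemma g_div_range: "0 \<le> g t / real d" "g t / real d \<le> 1"
  using g_nonneg[of t] g_le[of t] d_ge_2 by (auto simp: divide_le_eq)

lemma l1_nonneg: "0 \<le> l1 t"
  using g_div_range[of t] by (cases "g t / real d = 0") (auto simp: l1_def simp del: divide_eq_0_iff)

lemma l2_nonneg: "0 \<le> l2 t"
proof -
  have "ln u \<le> 0" if "0 \<le> u" "u \<le> 1" for u :: real using that by (cases "u = 0") auto
  then show ?thesis using g_div_range[of t] by (simp add: l2_def)
qed

lemma borel_measurable_terms[measurable]:
  "neg_ln_h \<in> borel_measurable borel" "F0 \<in> borel_measurable borel"
  "l1 \<in> borel_measurable borel" "l2 \<in> borel_measurable borel"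
  unfolding neg_ln_h_def F0_def l1_def l2_def by measurable

lemma borel_measurable_gain[measurable]: "(gain :: real ^ 'n::finite \<Rightarrow> real) \<in> borel_measurable borel"
  unfolding gain_def by measurable

lemma borel_measurable_loss[measurable]: "(loss :: real ^ 'n::finite \<Rightarrow> real) \<in> borel_measurable borel"
  unfolding loss_def by measurable

lemma log_gap_integral_eq: "log_gap_integral \<delta> = (\<integral>\<^sup>+t\<in>{0..1}. ennreal (neg_ln_h t) \<partial>lborel)"
  unfolding log_gap_integral_def
  using AE_lborel_singleton[of "0::real"] AE_lborel_singleton[of "1::real"]
proof (intro nn_integral_cong_AE, eventually_elim)
  case (elim t)
  show ?case
  proof (cases "t \<in> {0<..<1}")
    case True
    then have "0 < h t" "h t \<le> 1" using h_pos[of t] h_le[of t] by auto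
    then have "ln (h t) \<le> 0" "\<delta> t \<noteq> t" by (auto simp: h_fun_def)
    then show ?thesis using True by (simp add: neg_ln_h_def h_fun_def)
  next
    case False
    then show ?thesis using elim by auto
  qed
qed

text \<open>With u = g/d and w = 1 - u, the integrands are d times -(u ln u) and d times -(w ln w),
  both at most d on [0,1]. Thus the loss is finite whether or not J(\<delta>) is.\<close>

lemma loss_integral_finite: "loss_integral < \<infinity>"
proof -
  have u: "- (u * ln u) \<le> 1" if "0 \<le> u" for u :: real using that by (rule neg_mult_ln_le_1)
  have "(\<integral>\<^sup>+t. ennreal (l1 t) * ennreal (g t) \<partial>lborel) \<le> (\<integral>\<^sup>+t. ennreal (real d) * indicator {0..1 :: real} t \<partial>lborel)"
  proof (rule nn_integral_mono)
    fix t
    have "l1 t * g t = real d * - (g t / real d * ln (g t / real d))" using d_ge_2 by (simp add: l1_def)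
    also have "\<dots> \<le> real d * 1" by (intro mult_left_mono u g_div_range) auto
    finally have "ennreal (l1 t) * ennreal (g t) \<le> ennreal (real d)"
      by (simp add: ennreal_mult[symmetric] l1_nonneg g_nonneg)
    then show "ennreal (l1 t) * ennreal (g t) \<le> ennreal (real d) * indicator {0..1} t"
      using g_outside[of t] by (cases "t \<in> {0<..<1}") auto
  qed
  also have "\<dots> < \<infinity>" by (simp add: nn_integral_cmult_indicator)
  finally have 1: "(\<integral>\<^sup>+t. ennreal (l1 t) * ennreal (g t) \<partial>lborel) < \<infinity>" .
  have "(\<integral>\<^sup>+t\<in>{0..1}. ennreal (l2 t) * ennreal (real d - g t) \<partial>lborel) \<le> (\<integral>\<^sup>+t. ennreal (real d) * indicator {0..1 :: real} t \<partial>lborel)"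
  proof (intro nn_integral_mono mult_right_mono)
    fix t
    have "l2 t * (real d - g t) = real d * - ((1 - g t / real d) * ln (1 - g t / real d))"
      using d_ge_2 by (simp add: l2_def field_simps)
    also have "\<dots> \<le> real d * 1" using g_div_range[of t] by (intro mult_left_mono u) auto
    finally show "ennreal (l2 t) * ennreal (real d - g t) \<le> ennreal (real d)"
      using g_le[of t] by (simp add: ennreal_mult[symmetric] l2_nonneg)
  qed simp
  also have "\<dots> < \<infinity>" by (simp add: nn_integral_cmult_indicator)
  finally have 2: "(\<integral>\<^sup>+t\<in>{0..1}. ennreal (l2 t) * ennreal (real d - g t) \<partial>lborel) < \<infinity>" .
  from 1 2 show ?thesis by (simp add: loss_integral_def)
qed

text \<open>Intended for finite J(\<delta>), since \<open>enn2real\<close> sends infinity to 0; then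
  it is the value of the minimum.\<close>

definition min_info :: real where
  "min_info = enn2real (of_nat (d - 1) * log_gap_integral \<delta>) - enn2real loss_integral"

end

text \<open>A competitor C in the class together with one of its densities c; \<open>C_delta\<close>
  itself is later an instance, with whichever density \<open>info\<close> selects.\<close>

locale copula_with_diagonal = diagonal_density \<delta> g "CARD('n::finite)"
  for \<delta> g :: "real \<Rightarrow> real" and c :: "real ^ 'n \<Rightarrow> real" and C :: "real ^ 'n \<Rightarrow> real" +
  assumes density_c: "has_copula_density C c" and diag_C: "diag C = \<delta>"
begin

section \<open>Integrals of gain and loss against the density of a competitor\<close>

lemma copula_density_c: "copula_density c"
  by (rule copula_density_if_has_copula_density(1)[OF density_c])

lemma c_measurable[measurable]: "c \<in> borel_measurable borel"
  by (rule copula_densityD(2)[OF copula_density_c])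

lemma c_nonneg: "0 \<le> c x"
  by (rule copula_densityD(1)[OF copula_density_c])

lemmas nn_integral_nth = copula_densityD(3)[OF copula_density_c]
lemmas nn_integral_max = nn_integral_max_copula[OF density_c diag_C]
lemmas AE_cube = copula_density_AE_cube[OF copula_density_c]

text \<open>The d coordinates contribute (1 - 1/d) J(\<delta>) each. In \<open>ennreal\<close> this
  also covers J(\<delta>) = infinity.\<close>

lemma nn_integral_gain:
  "(\<integral>\<^sup>+x. ennreal (gain x) * ennreal (c x) \<partial>lborel) = of_nat (CARD('n) - 1) * log_gap_integral \<delta>"
proof -
  have d1: "0 \<le> 1 - 1 / real CARD('n)" using d_ge_2 by simp
  have "(\<integral>\<^sup>+x. ennreal (gain x) * ennreal (c x) \<partial>lborel) =
    (\<integral>\<^sup>+x. (\<Sum>i\<in>UNIV. ennreal (1 - 1 / real CARD('n)) * ennreal (neg_ln_h (x $ i)) * ennreal (c x)) \<partial>lborel)"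
    by (intro nn_integral_cong)
      (simp add: gain_def ennreal_mult d1 sum_nonneg neg_ln_h_nonneg sum_ennreal[symmetric] sum_distrib_left sum_distrib_right)
  also have "\<dots> = (\<Sum>i\<in>(UNIV :: 'n set). \<integral>\<^sup>+x. ennreal (1 - 1 / real CARD('n)) * ennreal (neg_ln_h (x $ i)) * ennreal (c x) \<partial>lborel)"
    by (rule nn_integral_sum) measurable
  also have "\<dots> = (\<Sum>i\<in>(UNIV :: 'n set). \<integral>\<^sup>+t\<in>{0..1}. ennreal (1 - 1 / real CARD('n)) * ennreal (neg_ln_h t) \<partial>lborel)"
    by (intro sum.cong refl nn_integral_nth[of "\<lambda>t. ennreal (1 - 1 / real CARD('n)) * ennreal (neg_ln_h t)"]) measurable
  also have "(\<integral>\<^sup>+t\<in>{0..1}. ennreal (1 - 1 / real CARD('n)) * ennreal (neg_ln_h t) \<partial>lborel) = ennreal (1 - 1 / real CARD('n)) * log_gap_integral \<delta>"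
    unfolding log_gap_integral_eq mult.assoc by (rule nn_integral_cmult) measurable
  also have "(\<Sum>i\<in>(UNIV :: 'n set). ennreal (1 - 1 / real CARD('n)) * log_gap_integral \<delta>) = (of_nat CARD('n) * ennreal (1 - 1 / real CARD('n))) * log_gap_integral \<delta>"
    by (simp add: mult.assoc)
  also have "of_nat CARD('n) * ennreal (1 - 1 / real CARD('n)) = of_nat (CARD('n) - 1)"
    using d_ge_2 by (simp add: ennreal_of_nat_eq_real_of_nat ennreal_mult[symmetric] field_simps of_nat_diff)
  finally show ?thesis .
qed

text \<open>The factor 1/h s cancels against the probability h s, which leaves the constant (d-1)/d
  on (0,1); so the value is finite although F is unbounded.\<close>

lemma nn_integral_F_diff:
  "(\<integral>\<^sup>+x. ennreal (F0 (max_coord x) - F0 (x $ i)) * ennreal (c x) \<partial>lborel) = ennreal ((real CARD('n) - 1) / real CARD('n))"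
proof -
  let ?J = "\<lambda>s x. if x $ i \<le> s \<and> s < max_coord x then 1 else 0 :: ennreal"
  define k where "k s = (real CARD('n) - 1) / real CARD('n) / (if s \<in> {0<..<1} then h s else 0)" for s
  have [measurable]: "k \<in> borel_measurable borel" unfolding k_def by measurable
  have "(\<integral>\<^sup>+x. ennreal (F0 (max_coord x) - F0 (x $ i)) * ennreal (c x) \<partial>lborel) =
    (\<integral>\<^sup>+x. \<integral>\<^sup>+s. ennreal (k s) * (?J s x * ennreal (c x)) \<partial>lborel \<partial>lborel)"
    using AE_cube
  proof (intro nn_integral_cong_AE, eventually_elim)
    case (elim x)
    show ?case
    proof (cases "c x = 0")
      case False
      then have cube: "0 < x $ j \<and> x $ j < 1" for j using elim by blast
      obtain j where j: "max_coord x = x $ j" using max_coord_attained by blast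
      have le: "x $ i \<le> max_coord x" by (rule nth_le_max_coord)
      have "ennreal (F0 (max_coord x) - F0 (x $ i)) = (\<integral>\<^sup>+s\<in>{x $ i..<max_coord x}. ennreal ((real CARD('n) - 1) / real CARD('n) / h s) \<partial>lborel)"
        using cube[of i] cube[of j] le j by (subst F_diff[symmetric]) (auto simp: F0_def)
      also have "\<dots> = (\<integral>\<^sup>+s. ennreal (k s) * ?J s x \<partial>lborel)"
        using cube[of i] cube[of j] j by (intro nn_integral_cong) (auto simp: k_def split: split_indicator)
      finally have "ennreal (F0 (max_coord x) - F0 (x $ i)) * ennreal (c x)
        = (\<integral>\<^sup>+s. ennreal (k s) * ?J s x * ennreal (c x) \<partial>lborel)"
        by (subst nn_integral_multc) auto
      then show ?thesis by (simp only: mult.assoc)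
    qed simp
  qed
  also have "\<dots> = (\<integral>\<^sup>+s. \<integral>\<^sup>+x. ennreal (k s) * (?J s x * ennreal (c x)) \<partial>lborel \<partial>lborel)"
    by (rule lborel_pair.Fubini'[symmetric]) measurable
  also have "\<dots> = (\<integral>\<^sup>+s. ennreal ((real CARD('n) - 1) / real CARD('n)) * indicator {0<..<1 :: real} s \<partial>lborel)"
  proof (rule nn_integral_cong)
    fix s :: real
    have m: "(\<lambda>x. ?J s x * ennreal (c x)) \<in> borel_measurable lborel" by measurable
    show "(\<integral>\<^sup>+x. ennreal (k s) * (?J s x * ennreal (c x)) \<partial>lborel) =
      ennreal ((real CARD('n) - 1) / real CARD('n)) * indicator {0<..<1} s"
    proof (cases "s \<in> {0<..<1}")
      case True
      then have hs: "0 < h s" using h_pos by auto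
      define I where "I = (\<integral>\<^sup>+x. ?J s x * ennreal (c x) \<partial>lborel)"
      have "ennreal s = (\<integral>\<^sup>+t\<in>{0..1}. indicator {..s} t \<partial>lborel)"
      proof -
        have "(\<integral>\<^sup>+t\<in>{0..1}. indicator {..s} t \<partial>lborel) = (\<integral>\<^sup>+t. indicator {0..s} t \<partial>lborel)"
          using True by (intro nn_integral_cong) (auto split: split_indicator)
        then show ?thesis using True by simp
      qed
      also have "\<dots> = (\<integral>\<^sup>+x. indicator {..s} (x $ i) * ennreal (c x) \<partial>lborel)"
        by (rule nn_integral_nth[symmetric]) measurable
      \<comment> \<open>Since x_i \<le> M, the event x_i \<le> s splits into x_i \<le> s < M and M
        \<le> s, of which the latter has probability \<delta> s.\<close>
      also have "\<dots> = (\<integral>\<^sup>+x. ?J s x * ennreal (c x) +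
          indicator {..s} (max_coord x) * ennreal (c x) \<partial>lborel)"
        using nth_le_max_coord[of _ i] by (intro nn_integral_cong) (auto split: split_indicator dest: order_trans)
      also have "\<dots> = I + (\<integral>\<^sup>+x. indicator {..s} (max_coord x) * ennreal (c x) \<partial>lborel)"
        unfolding I_def using m by (intro nn_integral_add) measurable
      also have "(\<integral>\<^sup>+x. indicator {..s} (max_coord x) * ennreal (c x) \<partial>lborel) = ennreal (\<delta> s)"
        using diag_eq_measure_max(1)[OF density_c, of s] True diag_C by simp
      finally have "I = ennreal s - ennreal (\<delta> s)" by simp
      also have "\<dots> = ennreal (h s)" using delta_nonneg[of s] True by (simp add: ennreal_minus h_fun_def)
      finally have I: "I = ennreal (h s)" .
      have "(\<integral>\<^sup>+x. ennreal (k s) * (?J s x * ennreal (c x)) \<partial>lborel) = ennreal (k s) * I"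
        unfolding I_def using m by (rule nn_integral_cmult)
      also have "\<dots> = ennreal ((real CARD('n) - 1) / real CARD('n))"
        unfolding I k_def using True hs d_ge_2 by (simp add: ennreal_mult[symmetric])
      finally show ?thesis using True by simp
    qed (auto simp: k_def)
  qed
  also have "\<dots> = ennreal ((real CARD('n) - 1) / real CARD('n))" by (simp add: nn_integral_cmult_indicator)
  finally show ?thesis .
qed

text \<open>All coordinates together give d times the integral of \<phi> over [0,1], the maximum
  alone gives that of \<phi> g; the difference is what the others contribute. Boundedness makes the
  term of the maximum finite, so it can be cancelled in \<open>ennreal\<close>.\<close>

lemma nn_integral_nonmax_bounded:
  assumes \<phi>[measurable]: "\<phi> \<in> borel_measurable borel" and bound: "\<And>t. 0 \<le> \<phi> t" "\<And>t. \<phi> t \<le> B"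
  shows "(\<integral>\<^sup>+x. nonmax_sum \<phi> x * ennreal (c x) \<partial>lborel) =
    (\<integral>\<^sup>+t\<in>{0..1}. ennreal (\<phi> t) * ennreal (real CARD('n) - g t) \<partial>lborel)" (is "?I = ?R")
proof -
  define G where "G = (\<integral>\<^sup>+t. ennreal (\<phi> t) * ennreal (g t) \<partial>lborel)"
  have B: "0 \<le> B" using bound[of 0] by linarith
  have "G \<le> (\<integral>\<^sup>+t. ennreal B * ennreal (g t) \<partial>lborel)"
    unfolding G_def using bound by (intro nn_integral_mono mult_right_mono ennreal_leI) auto
  also have "\<dots> = ennreal B * (\<integral>\<^sup>+x. ennreal (c x) \<partial>lborel)"
    using nn_integral_max[of "\<lambda>_. 1"] by (simp add: nn_integral_cmult)
  also have "\<dots> < \<infinity>" by (simp add: nn_integral_copula_density[OF copula_density_c])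
  finally have G: "G < \<infinity>" .
  have "?I + G = (\<integral>\<^sup>+x. nonmax_sum \<phi> x * ennreal (c x)
      + ennreal (\<phi> (max_coord x)) * ennreal (c x) \<partial>lborel)"
    unfolding G_def nn_integral_max[of "\<lambda>t. ennreal (\<phi> t)", symmetric, simplified]
    by (rule nn_integral_add[symmetric]) measurable
  also have "\<dots> = (\<integral>\<^sup>+x. (\<Sum>i\<in>UNIV. ennreal (\<phi> (x $ i)) * ennreal (c x)) \<partial>lborel)"
    using AE_distinct_coords[where 'n='n]
  proof (intro nn_integral_cong_AE, eventually_elim)
    case (elim x)
    obtain k where k: "max_coord x = x $ k" using max_coord_attained by blast
    have "nonmax_sum \<phi> x = (\<Sum>i\<in>-{k}. ennreal (\<phi> (x $ i)))"
      unfolding k using elim by (intro sum.mono_neutral_cong_right) auto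
    moreover have "(\<Sum>i\<in>UNIV. ennreal (\<phi> (x $ i))) = ennreal (\<phi> (x $ k)) + (\<Sum>i\<in>-{k}. ennreal (\<phi> (x $ i)))"
      by (subst sum.remove[of _ k]) (auto simp: Compl_eq_Diff_UNIV)
    ultimately show ?case unfolding k
      by (simp add: sum_distrib_right[symmetric] distrib_right[symmetric] add.commute)
  qed
  also have "\<dots> = (\<Sum>i\<in>(UNIV :: 'n set). \<integral>\<^sup>+x. ennreal (\<phi> (x $ i)) * ennreal (c x) \<partial>lborel)"
    by (rule nn_integral_sum) measurable
  also have "\<dots> = (\<Sum>i\<in>(UNIV :: 'n set). \<integral>\<^sup>+t\<in>{0..1}. ennreal (\<phi> t) \<partial>lborel)"
    by (intro sum.cong refl nn_integral_nth[of "\<lambda>t. ennreal (\<phi> t)"]) measurable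
  also have "\<dots> = of_nat CARD('n) * (\<integral>\<^sup>+t\<in>{0..1}. ennreal (\<phi> t) \<partial>lborel)" by simp
  also have "\<dots> = (\<integral>\<^sup>+t. of_nat CARD('n) * (ennreal (\<phi> t) * indicator {0..1} t) \<partial>lborel)"
    by (rule nn_integral_cmult[symmetric]) measurable
  also have "\<dots> = (\<integral>\<^sup>+t. ennreal (\<phi> t) * ennreal (real CARD('n) - g t) * indicator {0..1} t + ennreal (\<phi> t) * ennreal (g t) \<partial>lborel)"
  proof (rule nn_integral_cong)
    fix t
    have s: "of_nat CARD('n) = ennreal (real CARD('n) - g t) + ennreal (g t)"
      using g_le[of t] g_nonneg[of t] by (simp add: ennreal_of_nat_eq_real_of_nat ennreal_plus[symmetric] del: ennreal_plus)
    have "of_nat CARD('n) * ennreal (\<phi> t) = ennreal (\<phi> t) * ennreal (real CARD('n) - g t) + ennreal (\<phi> t) * ennreal (g t)"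
      unfolding s by (simp add: distrib_left distrib_right mult.commute)
    then show "of_nat CARD('n) * (ennreal (\<phi> t) * indicator {0..1} t) =
      ennreal (\<phi> t) * ennreal (real CARD('n) - g t) * indicator {0..1} t + ennreal (\<phi> t) * ennreal (g t)"
      using g_outside[of t] by (cases "t \<in> {0..1}") auto
  qed
  also have "\<dots> = ?R + G" unfolding G_def by (rule nn_integral_add) measurable
  finally have "G + ?I = G + ?R" by (simp add: add.commute)
  then show ?thesis using G by (subst (asm) ennreal_add_left_cancel) auto
qed

text \<open>The bound is removed by truncating \<phi> at n and monotone convergence; the intended
  \<open>l2\<close> may be unbounded.\<close>

lemma nn_integral_nonmax:
  assumes \<phi>[measurable]: "\<phi> \<in> borel_measurable borel" and nonneg: "\<And>t. 0 \<le> \<phi> t"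
  shows "(\<integral>\<^sup>+x. nonmax_sum \<phi> x * ennreal (c x) \<partial>lborel) =
    (\<integral>\<^sup>+t\<in>{0..1}. ennreal (\<phi> t) * ennreal (real CARD('n) - g t) \<partial>lborel)" (is "integral\<^sup>N lborel ?u = integral\<^sup>N lborel ?v")
proof -
  define \<psi> where "\<psi> n t = min (\<phi> t) (real n)" for n t
  have [measurable]: "\<psi> n \<in> borel_measurable borel" for n unfolding \<psi>_def by measurable
  have \<psi>0: "0 \<le> \<psi> n t" for n t using nonneg by (simp add: \<psi>_def)
  have \<psi>_mono: "\<psi> m t \<le> \<psi> n t" if "m \<le> n" for m n t using that by (simp add: \<psi>_def)
  have "(\<lambda>n. \<psi> n t) \<longlonglongrightarrow> \<phi> t" for t
  proof (rule tendsto_eventually)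
    obtain N where "\<phi> t \<le> real N" using real_arch_simple by blast
    then show "eventually (\<lambda>n. \<psi> n t = \<phi> t) sequentially"
      unfolding \<psi>_def eventually_sequentially by (intro exI[of _ N]) auto
  qed
  then have \<psi>_lim: "(\<lambda>n. ennreal (\<psi> n t)) \<longlonglongrightarrow> ennreal (\<phi> t)" for t by (intro tendsto_ennrealI)
  define u where "u n x = nonmax_sum (\<psi> n) x * ennreal (c x)"
    for n and x :: "real ^ 'n"
  define v where "v n t = ennreal (\<psi> n t) * ennreal (real CARD('n) - g t) * indicator {0..1} t" for n t
  have "(\<lambda>n. integral\<^sup>N lborel (u n)) \<longlonglongrightarrow> integral\<^sup>N lborel ?u"
  proof (rule nn_integral_LIMSEQ)
    show "incseq u" unfolding u_def
      by (intro incseq_SucI le_funI mult_right_mono sum_mono ennreal_leI \<psi>_mono) auto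
    show "(\<lambda>n. u n x) \<longlonglongrightarrow> ?u x" for x unfolding u_def
      by (intro tendsto_mult_ennreal tendsto_sum tendsto_const \<psi>_lim) (auto simp: sum_eq_0_iff)
    show "u n \<in> borel_measurable lborel" for n unfolding u_def by measurable
  qed
  moreover have "(\<lambda>n. integral\<^sup>N lborel (v n)) \<longlonglongrightarrow> integral\<^sup>N lborel ?v"
  proof (rule nn_integral_LIMSEQ)
    show "incseq v" unfolding v_def
      by (intro incseq_SucI le_funI mult_right_mono ennreal_leI \<psi>_mono) auto
    show "(\<lambda>n. v n t) \<longlonglongrightarrow> ?v t" for t
    proof (cases "t \<in> {0..1}")
      case True
      have "(\<lambda>n. ennreal (\<psi> n t) * ennreal (real CARD('n) - g t)) \<longlonglongrightarrow> ennreal (\<phi> t) * ennreal (real CARD('n) - g t)"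
        by (intro tendsto_mult_ennreal tendsto_const \<psi>_lim) auto
      then show ?thesis using True by (simp add: v_def)
    qed (simp add: v_def)
    show "v n \<in> borel_measurable lborel" for n unfolding v_def by measurable
  qed
  moreover have "integral\<^sup>N lborel (u n) = integral\<^sup>N lborel (v n)" for n
    unfolding u_def v_def by (rule nn_integral_nonmax_bounded[OF _ \<psi>0, where B="real n"]) (auto simp: \<psi>_def)
  ultimately show ?thesis using LIMSEQ_unique by simp
qed

text \<open>The measure with density c does not charge the zeros of \<open>dens\<close>: M has
  density g, so g(M) > 0 almost surely, and the coordinates below the maximum have total density d -
  g, so g is less than d at them.\<close>

lemma AE_good:
  "AE x in lborel. c x \<noteq> 0 \<longrightarrow> (\<forall>i. 0 < x $ i \<and> x $ i < 1) \<and> (\<forall>i j. x $ i = x $ j \<longrightarrow> i = j) \<and>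
     0 < g (max_coord x) \<and> (\<forall>i. x $ i \<noteq> max_coord x \<longrightarrow> g (x $ i) < real CARD('n))"
proof -
  define \<zeta> :: "real \<Rightarrow> ennreal" where "\<zeta> t = (if g t = 0 then 1 else 0)" for t
  have [measurable]: "\<zeta> \<in> borel_measurable borel" unfolding \<zeta>_def by measurable
  define S where "S = {t. g t = real CARD('n)}"
  have [measurable]: "S \<in> sets borel" unfolding S_def by measurable
  have "(\<integral>\<^sup>+x. \<zeta> (max_coord x) * ennreal (c x) \<partial>lborel) = (\<integral>\<^sup>+t. \<zeta> t * ennreal (g t) \<partial>lborel)"
    by (rule nn_integral_max[of \<zeta>]) measurable
  also have "\<dots> = (\<integral>\<^sup>+(t::real). 0 \<partial>lborel)" by (intro nn_integral_cong) (auto simp: \<zeta>_def)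
  finally have int0: "(\<integral>\<^sup>+x. \<zeta> (max_coord x) * ennreal (c x) \<partial>lborel) = 0" by simp
  have meas: "(\<lambda>x. \<zeta> (max_coord x) * ennreal (c x)) \<in> borel_measurable lborel" by measurable
  have AE_max: "AE x in lborel. \<zeta> (max_coord x) * ennreal (c x) = 0"
    by (rule nn_integral_0_iff_AE[OF meas, THEN iffD1, OF int0])
  have "(\<integral>\<^sup>+x. nonmax_sum (indicator S) x * ennreal (c x) \<partial>lborel)
    = (\<integral>\<^sup>+t\<in>{0..1}. ennreal (indicator S t) * ennreal (real CARD('n) - g t) \<partial>lborel)"
    by (rule nn_integral_nonmax) auto
  also have "\<dots> = (\<integral>\<^sup>+(t::real). 0 \<partial>lborel)" by (intro nn_integral_cong) (auto simp: S_def split: split_indicator)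
  finally have int1: "(\<integral>\<^sup>+x. nonmax_sum (indicator S) x * ennreal (c x) \<partial>lborel) = 0"
    by simp
  have meas1: "(\<lambda>x. nonmax_sum (indicator S) x * ennreal (c x)) \<in> borel_measurable lborel"
    by measurable
  have AE_nonmax: "AE x in lborel. nonmax_sum (indicator S) x * ennreal (c x) = 0"
    by (rule nn_integral_0_iff_AE[OF meas1, THEN iffD1, OF int1])
  have pos: "0 < g (max_coord x)" if "\<zeta> (max_coord x) * ennreal (c x) = 0" "c x \<noteq> 0" for x
  proof -
    have "ennreal (c x) \<noteq> 0" using that(2) c_nonneg[of x] by simp
    then have "g (max_coord x) \<noteq> 0" using that(1) by (auto simp: \<zeta>_def)
    then show ?thesis using g_nonneg[of "max_coord x"] by simp
  qed
  have less: "g (x $ i) < real CARD('n)"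
    if "nonmax_sum (indicator S) x * ennreal (c x) = 0"
      "c x \<noteq> 0" "x $ i \<noteq> max_coord x" for x i
  proof -
    have "ennreal (c x) \<noteq> 0" using that(2) c_nonneg[of x] by simp
    then have "g (x $ i) \<noteq> real CARD('n)" using that(1,3) by (auto simp: S_def indicator_def sum_eq_0_iff split: if_splits)
    then show ?thesis using g_le[of "x $ i"] by simp
  qed
  have "AE x in lborel. c x \<noteq> 0 \<longrightarrow> 0 < g (max_coord x)"
    using AE_max by (rule AE_mp, intro AE_I2 impI pos)
  moreover have "AE x in lborel. c x \<noteq> 0 \<longrightarrow> (\<forall>i. x $ i \<noteq> max_coord x \<longrightarrow> g (x $ i) < real CARD('n))"
    using AE_nonmax by (rule AE_mp, intro AE_I2 impI allI less)
  ultimately show ?thesis using AE_cube AE_distinct_coords[where 'n='n]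
    by eventually_elim blast
qed

lemma loss_terms_nonneg:
  assumes "\<forall>i. 0 < x $ i \<and> x $ i < 1"
  shows "0 \<le> F0 (max_coord x) - F0 (x $ i)"
proof -
  obtain k where "max_coord x = x $ k" using max_coord_attained by blast
  then show ?thesis using assms F_mono[of "x $ i" "max_coord x"] nth_le_max_coord[of x i] by (simp add: F0_def)
qed

text \<open>Monotonicity of F on (0,1) makes all three parts of the loss nonnegative where c is
  positive, which is what additivity in \<open>ennreal\<close> requires.\<close>

lemma nn_integral_loss: "(\<integral>\<^sup>+x. ennreal (loss x) * ennreal (c x) \<partial>lborel) = loss_integral"
proof -
  define u where "u x = (\<Sum>i\<in>UNIV. ennreal (F0 (max_coord x) - F0 (x $ i)) * ennreal (c x))" for x :: "real ^ 'n"
  define v where "v x = ennreal (l1 (max_coord x)) * ennreal (c x)" for x :: "real ^ 'n"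
  define w where "w x = nonmax_sum l2 x * ennreal (c x)" for x :: "real ^ 'n"
  have [measurable]: "u \<in> borel_measurable borel" "v \<in> borel_measurable borel" "w \<in> borel_measurable borel"
    unfolding u_def v_def w_def by measurable
  have "(\<integral>\<^sup>+x. ennreal (loss x) * ennreal (c x) \<partial>lborel) = (\<integral>\<^sup>+x. u x + v x + w x \<partial>lborel)"
    using AE_cube
  proof (intro nn_integral_cong_AE, eventually_elim)
    case (elim x)
    show ?case
    proof (cases "c x = 0")
      case True
      then show ?thesis by (simp add: u_def v_def w_def)
    next
      case False
      then have cube: "\<forall>i. 0 < x $ i \<and> x $ i < 1" using elim by blast
      note F = loss_terms_nonneg[OF cube]
      have l2: "ennreal (\<Sum>i\<in>UNIV. if x $ i \<noteq> max_coord x then l2 (x $ i) else 0)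
        = nonmax_sum l2 x"
      proof -
        have "ennreal (\<Sum>i\<in>UNIV. if x $ i \<noteq> max_coord x then l2 (x $ i) else 0)
          = (\<Sum>i\<in>UNIV. ennreal (if x $ i \<noteq> max_coord x then l2 (x $ i) else 0))"
          by (rule sum_ennreal[symmetric]) (simp add: l2_nonneg)
        also have "\<dots> = nonmax_sum l2 x"
          by (rule sum.cong) auto
        finally show ?thesis .
      qed
      have "ennreal (loss x) = (\<Sum>i\<in>UNIV. ennreal (F0 (max_coord x) - F0 (x $ i))) + ennreal (l1 (max_coord x))
        + nonmax_sum l2 x"
        unfolding loss_def l2[symmetric] sum_ennreal[OF F]
        using F by (simp add: sum_nonneg l1_nonneg l2_nonneg ennreal_plus del: sum_subtractf)
      then show ?thesis
        by (simp add: u_def v_def w_def distrib_right sum_distrib_right)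
    qed
  qed
  also have "\<dots> = (\<integral>\<^sup>+x. u x \<partial>lborel) + (\<integral>\<^sup>+x. v x \<partial>lborel) + (\<integral>\<^sup>+x. w x \<partial>lborel)"
    by (simp add: nn_integral_add)
  also have "(\<integral>\<^sup>+x. u x \<partial>lborel) = (\<Sum>i\<in>(UNIV :: 'n set). ennreal ((real CARD('n) - 1) / real CARD('n)))"
    unfolding u_def by (subst nn_integral_sum) (measurable, simp only: nn_integral_F_diff)
  also have "\<dots> = ennreal (real CARD('n) - 1)"
    using d_ge_2 by (simp add: ennreal_of_nat_eq_real_of_nat ennreal_mult[symmetric])
  also have "(\<integral>\<^sup>+x. v x \<partial>lborel) = (\<integral>\<^sup>+t. ennreal (l1 t) * ennreal (g t) \<partial>lborel)"
    unfolding v_def by (rule nn_integral_max[of "\<lambda>t. ennreal (l1 t)"]) measurable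
  also have "(\<integral>\<^sup>+x. w x \<partial>lborel) = (\<integral>\<^sup>+t\<in>{0..1}. ennreal (l2 t) * ennreal (real CARD('n) - g t) \<partial>lborel)"
    unfolding w_def by (rule nn_integral_nonmax) (auto simp: l2_nonneg)
  finally show ?thesis by (simp add: loss_integral_def)
qed

text \<open>All factors of \<open>dens\<close> are positive on the good set, so the logarithm
  splits. The exponent 1/d - 1 of h is the same in a and b; therefore the h-terms form a sum over
  all coordinates regardless of which one is the maximum, and the integral of the gain follows from
  the uniform marginals alone.\<close>

lemma AE_ln_dens:
  "AE x in lborel. c x \<noteq> 0 \<longrightarrow> 0 < dens x \<and> ln (dens x) = gain x - loss x \<and> 0 \<le> loss x"
  using AE_good
proof (rule AE_mp, intro AE_I2 impI)
  fix x
  assume c: "c x \<noteq> 0" and good: "c x \<noteq> 0 \<longrightarrow> (\<forall>i. 0 < x $ i \<and> x $ i < 1) \<and> (\<forall>i j. x $ i = x $ j \<longrightarrow> i = j) \<and>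
     0 < g (max_coord x) \<and> (\<forall>i. x $ i \<noteq> max_coord x \<longrightarrow> g (x $ i) < real CARD('n))"
  from good[rule_format, OF c] have cube: "\<forall>i. 0 < x $ i \<and> x $ i < 1" and dist: "\<forall>i j. x $ i = x $ j \<longrightarrow> i = j"
    and gm: "0 < g (max_coord x)" and gi: "\<forall>i. x $ i \<noteq> max_coord x \<longrightarrow> g (x $ i) < real CARD('n)" by auto
  obtain k where k: "max_coord x = x $ k" using max_coord_attained by blast
  have nonmax: "{i. x $ i \<noteq> max_coord x} = - {k}" using dist k by auto
  have d0: "0 < real CARD('n)" using d_ge_2 by simp
  have hp: "0 < h (x $ i)" for i using cube h_pos by auto
  have b: "0 < b (x $ k)" "ln (b (x $ k)) = - l1 (x $ k) + (1 / real CARD('n) - 1) * ln (h (x $ k)) - (real CARD('n) - 1) * F (x $ k)"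
  proof -
    have b: "b (x $ k) = g (x $ k) / real CARD('n) * exp ((1 / real CARD('n) - 1) * ln (h (x $ k)) + - (real CARD('n) - 1) * F (x $ k))"
      using cube by (simp add: b_def expo_def)
    have p: "0 < g (x $ k) / real CARD('n)" using gm k d0 by simp
    show "0 < b (x $ k)" unfolding b using p by (intro mult_pos_pos) auto
    show "ln (b (x $ k)) = - l1 (x $ k) + (1 / real CARD('n) - 1) * ln (h (x $ k)) - (real CARD('n) - 1) * F (x $ k)"
      unfolding b ln_mult_pos[OF p exp_gt_zero] ln_exp l1_def by (simp add: algebra_simps)
  qed
  have a: "0 < a (x $ i)" "ln (a (x $ i)) = - l2 (x $ i) + (1 / real CARD('n) - 1) * ln (h (x $ i)) + F (x $ i)"
    if i: "i \<noteq> k" for i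
  proof -
    have "g (x $ i) < real CARD('n)" using gi dist i k by metis
    then have p: "0 < 1 - g (x $ i) / real CARD('n)" using d0 by simp
    have a: "a (x $ i) = (1 - g (x $ i) / real CARD('n)) * exp ((1 / real CARD('n) - 1) * ln (h (x $ i)) + 1 * F (x $ i))"
      using cube d0 by (simp add: a_def expo_def diff_divide_distrib)
    show "0 < a (x $ i)" unfolding a using p by (intro mult_pos_pos) auto
    show "ln (a (x $ i)) = - l2 (x $ i) + (1 / real CARD('n) - 1) * ln (h (x $ i)) + F (x $ i)"
      unfolding a ln_mult_pos[OF p exp_gt_zero] ln_exp l2_def by simp
  qed
  have dens: "dens x = b (x $ k) * (\<Prod>i\<in>-{k}. a (x $ i))" unfolding dens_def nonmax unfolding k ..
  have pp: "0 < (\<Prod>i\<in>-{k}. a (x $ i))" using a by (intro prod_pos) auto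
  have pos: "0 < dens x" unfolding dens using b(1) pp by simp
  have split: "(\<Sum>i\<in>UNIV. f i) = f k + (\<Sum>i\<in>-{k}. f i)" for f :: "'n \<Rightarrow> real"
    by (subst sum.remove[of _ k]) (auto simp: Compl_eq_Diff_UNIV)
  have "ln (dens x) = ln (b (x $ k)) + ln (\<Prod>i\<in>-{k}. a (x $ i))"
    unfolding dens by (rule ln_mult_pos[OF b(1) pp])
  also have "ln (\<Prod>i\<in>-{k}. a (x $ i)) = (\<Sum>i\<in>-{k}. ln (a (x $ i)))"
  proof (rule ln_prod)
    show "a (x $ i) \<noteq> 0" if "i \<in> - {k}" for i using a(1)[of i] that by auto
  qed simp
  also have "\<dots> = (\<Sum>i\<in>-{k}. - l2 (x $ i) + (1 / real CARD('n) - 1) * ln (h (x $ i)) + F (x $ i))"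
    using a by (intro sum.cong) auto
  also have "\<dots> = - (\<Sum>i\<in>-{k}. l2 (x $ i)) + (1 / real CARD('n) - 1) * (\<Sum>i\<in>-{k}. ln (h (x $ i))) + (\<Sum>i\<in>-{k}. F (x $ i))"
    by (simp only: sum.distrib sum_negf sum_distrib_left)
  finally have ln_dens: "ln (dens x) = - l1 (x $ k) + (1 / real CARD('n) - 1) * ln (h (x $ k)) - (real CARD('n) - 1) * F (x $ k)
    + (- (\<Sum>i\<in>-{k}. l2 (x $ i)) + (1 / real CARD('n) - 1) * (\<Sum>i\<in>-{k}. ln (h (x $ i))) + (\<Sum>i\<in>-{k}. F (x $ i)))"
    unfolding b(2) .
  have gain: "gain x = (1 / real CARD('n) - 1) * (ln (h (x $ k)) + (\<Sum>i\<in>-{k}. ln (h (x $ i))))"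
  proof -
    have "(\<Sum>i\<in>UNIV. neg_ln_h (x $ i)) = - (ln (h (x $ k)) + (\<Sum>i\<in>-{k}. ln (h (x $ i))))"
      unfolding split[of "\<lambda>i. neg_ln_h (x $ i)"] using cube by (simp add: neg_ln_h_def sum_negf)
    then have "gain x = (1 - 1 / real CARD('n)) * - (ln (h (x $ k)) + (\<Sum>i\<in>-{k}. ln (h (x $ i))))"
      unfolding gain_def by (simp only:)
    also have "\<dots> = (1 / real CARD('n) - 1) * (ln (h (x $ k)) + (\<Sum>i\<in>-{k}. ln (h (x $ i))))"
      by (simp only: mult_minus_right mult_minus_left[symmetric] minus_diff_eq)
    finally show ?thesis .
  qed
  have loss: "loss x = ((real CARD('n) - 1) * F (x $ k) - (\<Sum>i\<in>-{k}. F (x $ i))) + l1 (x $ k) + (\<Sum>i\<in>-{k}. l2 (x $ i))"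
  proof -
    have "(\<Sum>i\<in>UNIV. F0 (max_coord x) - F0 (x $ i)) = (\<Sum>i\<in>-{k}. F (x $ k) - F (x $ i))"
      unfolding k split[of "\<lambda>i. F0 (x $ k) - F0 (x $ i)"] using cube by (simp add: F0_def)
    also have "\<dots> = (real CARD('n) - 1) * F (x $ k) - (\<Sum>i\<in>-{k}. F (x $ i))"
      using d_ge_2 by (simp add: sum_subtractf card_Compl_singleton of_nat_diff)
    finally have 1: "(\<Sum>i\<in>UNIV. F0 (max_coord x) - F0 (x $ i)) = (real CARD('n) - 1) * F (x $ k) - (\<Sum>i\<in>-{k}. F (x $ i))" .
    have 2: "(\<Sum>i\<in>UNIV. if x $ i \<noteq> max_coord x then l2 (x $ i) else 0) = (\<Sum>i\<in>-{k}. l2 (x $ i))"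
    proof -
      have "(\<Sum>i\<in>-{k}. if x $ i \<noteq> x $ k then l2 (x $ i) else 0) = (\<Sum>i\<in>-{k}. l2 (x $ i))"
        using dist by (intro sum.cong refl if_P) blast
      then show ?thesis unfolding k split[of "\<lambda>i. if x $ i \<noteq> x $ k then l2 (x $ i) else 0"] by simp
    qed
    show ?thesis unfolding loss_def 1 2 unfolding k ..
  qed
  have "0 \<le> loss x" unfolding loss_def
    by (intro add_nonneg_nonneg sum_nonneg loss_terms_nonneg[OF cube] l1_nonneg) (simp add: l2_nonneg)
  moreover have "ln (dens x) = gain x - loss x"
    unfolding ln_dens gain loss by (simp add: algebra_simps)
  ultimately show "0 < dens x \<and> ln (dens x) = gain x - loss x \<and> 0 \<le> loss x" using pos by simp
qed

lemma AE_mult_ln_ge: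
  "AE x in lborel. c x * (gain x - loss x) + c x - dens x \<le> c x * ln (c x) \<and>
     (c x * ln (c x) = c x * (gain x - loss x) + c x - dens x \<longrightarrow> c x = dens x)"
  using AE_ln_dens
proof eventually_elim
  case (elim x)
  show ?case
  proof (cases "c x = 0")
    case True
    then show ?thesis using dens_nonneg[of x] by simp
  next
    case False
    then show ?thesis using elim mult_ln_ge[of "c x" "dens x"] c_nonneg[of x] by simp
  qed
qed

lemma gain_nonneg: "0 \<le> gain x"
  unfolding gain_def using d_ge_2 by (intro mult_nonneg_nonneg sum_nonneg neg_ln_h_nonneg) auto

text \<open>The Gibbs inequality is rearranged to avoid differences: gain c is at most the positive
  part of c ln c plus dens plus loss c. The left side has infinite integral, while integrability of
  c ln c would make that of the right side finite.\<close>

lemma c_log_c_integral_infinite: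
  assumes "log_gap_integral \<delta> = \<infinity>"
  shows "c_log_c_integral c = \<infinity>"
proof (rule c_log_c_integral_eq(2)[OF copula_density_c], rule notI)
  assume int: "integrable lborel (\<lambda>x. c x * ln (c x))"
  have "AE x in lborel. ennreal (gain x) * ennreal (c x) \<le>
      ennreal (c x * ln (c x)) + (ennreal (dens x) + ennreal (loss x) * ennreal (c x))"
    using AE_mult_ln_ge AE_ln_dens
  proof eventually_elim
    case (elim x)
    show ?case
    proof (cases "c x = 0")
      case False
      then have l: "0 \<le> loss x" using elim by blast
      have "gain x * c x \<le> c x * ln (c x) + (dens x + loss x * c x)"
        using elim(1) c_nonneg[of x] by (simp add: algebra_simps)
      then have "ennreal (gain x * c x) \<le> ennreal (c x * ln (c x) + (dens x + loss x * c x))" by (rule ennreal_leI)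
      also have "\<dots> \<le> ennreal (c x * ln (c x)) + ennreal (dens x + loss x * c x)"
      proof -
        have "0 \<le> dens x + loss x * c x" using dens_nonneg[of x] l c_nonneg[of x] by simp
        then show ?thesis
          by (cases "0 \<le> c x * ln (c x)") (simp_all add: ennreal_plus[symmetric] ennreal_neg ennreal_leI del: ennreal_plus)
      qed
      also have "\<dots> = ennreal (c x * ln (c x)) + (ennreal (dens x) + ennreal (loss x) * ennreal (c x))"
        using dens_nonneg[of x] l c_nonneg[of x] by (simp add: ennreal_mult)
      finally show ?thesis using gain_nonneg[of x] c_nonneg[of x] by (simp add: ennreal_mult)
    qed simp
  qed
  then have "(\<integral>\<^sup>+x. ennreal (gain x) * ennreal (c x) \<partial>lborel) \<le>
    (\<integral>\<^sup>+x. ennreal (c x * ln (c x)) + (ennreal (dens x) + ennreal (loss x) * ennreal (c x)) \<partial>lborel)"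
    by (rule nn_integral_mono_AE)
  also have "\<dots> = (\<integral>\<^sup>+x. ennreal (c x * ln (c x)) \<partial>lborel) + ((\<integral>\<^sup>+(x :: real ^ 'n). ennreal (dens x) \<partial>lborel)
      + (\<integral>\<^sup>+x. ennreal (loss x) * ennreal (c x) \<partial>lborel))"
    by (simp add: nn_integral_add)
  also have "\<dots> < \<infinity>"
    using int loss_integral_finite nn_integral_copula_density[OF copula_density_dens[OF refl]]
    unfolding nn_integral_loss real_integrable_def by (simp add: less_top)
  finally show False
    using assms d_ge_2 unfolding nn_integral_gain by (simp add: ennreal_mult_top)
qed

section \<open>Finite J(\<delta>): the lower bound and the case of equality\<close>

context
  assumes finite_gap: "log_gap_integral \<delta> < \<infinity>"
begin

lemma integrable_gain_loss:
  "integrable lborel (\<lambda>x. c x * (gain x - loss x))"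
  "(LINT x|lborel. c x * (gain x - loss x)) = min_info"
proof -
  have 1: "has_bochner_integral lborel (\<lambda>x. c x * gain x) (enn2real (of_nat (CARD('n) - 1) * log_gap_integral \<delta>))"
  proof (rule has_bochner_integral_nn_integral)
    have "(\<integral>\<^sup>+x. ennreal (c x * gain x) \<partial>lborel) = of_nat (CARD('n) - 1) * log_gap_integral \<delta>"
      unfolding nn_integral_gain[symmetric]
      by (intro nn_integral_cong) (simp add: ennreal_mult gain_nonneg c_nonneg mult.commute)
    then show "(\<integral>\<^sup>+x. ennreal (c x * gain x) \<partial>lborel) = ennreal (enn2real (of_nat (CARD('n) - 1) * log_gap_integral \<delta>))"
      using finite_gap by (simp add: ennreal_mult_less_top of_nat_less_top)
  qed (auto simp: gain_nonneg c_nonneg)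
  \<comment> \<open>The loss is known to be nonnegative only where c is nonzero;
    \<open>max 0\<close> repairs the rest and changes the product with c at most on a null
    set.\<close>
  have 2: "has_bochner_integral lborel (\<lambda>x. c x * max 0 (loss x)) (enn2real loss_integral)"
  proof (rule has_bochner_integral_nn_integral)
    have "(\<integral>\<^sup>+x. ennreal (c x * max 0 (loss x)) \<partial>lborel) = (\<integral>\<^sup>+x. ennreal (loss x) * ennreal (c x) \<partial>lborel)"
      by (intro nn_integral_cong) (auto simp: ennreal_mult c_nonneg max_def ennreal_neg mult.commute)
    then show "(\<integral>\<^sup>+x. ennreal (c x * max 0 (loss x)) \<partial>lborel) = ennreal (enn2real loss_integral)"
      using loss_integral_finite by (simp add: nn_integral_loss)
  qed (auto simp: c_nonneg)
  have "has_bochner_integral lborel (\<lambda>x. c x * gain x - c x * max 0 (loss x)) min_info"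
    unfolding min_info_def by (rule has_bochner_integral_diff[OF 1 2])
  moreover have "AE x in lborel. c x * gain x - c x * max 0 (loss x) = c x * (gain x - loss x)"
    using AE_ln_dens
  proof eventually_elim
    case (elim x)
    then show ?case by (cases "c x = 0") (auto simp: right_diff_distrib max_absorb2)
  qed
  ultimately have "has_bochner_integral lborel (\<lambda>x. c x * (gain x - loss x)) min_info"
    by (subst (asm) has_bochner_integral_cong_AE) auto
  then show "integrable lborel (\<lambda>x. c x * (gain x - loss x))"
    "(LINT x|lborel. c x * (gain x - loss x)) = min_info"
    by (auto simp: has_bochner_integral_iff)
qed

lemma integral_copula_density:
  assumes "copula_density (f :: real ^ 'n \<Rightarrow> real)"
  shows "integrable lborel f" "(LINT x|lborel. f x) = 1"
proof -
  have "has_bochner_integral lborel f 1"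
    using nn_integral_copula_density[OF assms] copula_densityD(1,2)[OF assms]
    by (intro has_bochner_integral_nn_integral) auto
  then show "integrable lborel f" "(LINT x|lborel. f x) = 1" by (auto simp: has_bochner_integral_iff)
qed

text \<open>\<open>D\<close> is the defect in the Gibbs inequality. As c and \<open>dens\<close>
  both integrate to 1, its integral is the excess of the information over \<open>min_info\<close>;
  it is nonnegative and vanishes only if \<open>D\<close> is 0 almost everywhere.\<close>

lemma c_log_c_integral_ge:
  "ereal min_info \<le> c_log_c_integral c"
  and AE_eq_dens_if_minimal: "c_log_c_integral c = ereal min_info \<Longrightarrow> AE x in lborel. c x = dens x"
proof -
  note cd = integral_copula_density[OF copula_density_c] integral_copula_density[OF copula_density_dens[OF refl]]
  define D where "D x = c x * ln (c x) - (c x * (gain x - loss x) + c x - dens x)" for x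
  have D0: "AE x in lborel. 0 \<le> D x" using AE_mult_ln_ge by eventually_elim (simp add: D_def)
  have D: "integrable lborel D" "(LINT x|lborel. D x) = (LINT x|lborel. c x * ln (c x)) - min_info"
    if int: "integrable lborel (\<lambda>x. c x * ln (c x))"
    unfolding D_def using int integrable_gain_loss cd by auto
  show "ereal min_info \<le> c_log_c_integral c"
  proof (cases "integrable lborel (\<lambda>x. c x * ln (c x))")
    case True
    have "0 \<le> (LINT x|lborel. D x)" by (rule integral_nonneg_AE[OF D0])
    then show ?thesis using D(2)[OF True] c_log_c_integral_eq(1)[OF copula_density_c True] by simp
  qed (simp add: c_log_c_integral_eq(2)[OF copula_density_c])
  show "AE x in lborel. c x = dens x" if eq: "c_log_c_integral c = ereal min_info"
  proof -
    have int: "integrable lborel (\<lambda>x. c x * ln (c x))"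
      using eq c_log_c_integral_eq(2)[OF copula_density_c] by fastforce
    then have "(LINT x|lborel. D x) = 0"
      using D(2)[OF int] eq c_log_c_integral_eq(1)[OF copula_density_c int] by simp
    then have "AE x in lborel. D x = 0"
      using integral_nonneg_eq_0_iff_AE[OF D(1)[OF int] D0] by simp
    with AE_mult_ln_ge show ?thesis by eventually_elim (simp add: D_def)
  qed
qed

text \<open>Formulated for any density equal to \<open>dens\<close> almost everywhere, since
  \<open>info\<close> evaluates a density that it selects itself.\<close>

lemma c_log_c_integral_dens:
  assumes eq: "AE x in lborel. c x = dens x"
  shows "c_log_c_integral c = ereal min_info"
proof -
  have ae: "AE x in lborel. c x * (gain x - loss x) = c x * ln (c x)"
    using eq AE_ln_dens
  proof eventually_elim
    case (elim x)
    then show ?case by (cases "c x = 0") auto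
  qed
  have "integrable lborel (\<lambda>x. c x * ln (c x)) \<longleftrightarrow> integrable lborel (\<lambda>x. c x * (gain x - loss x))"
    using ae by (intro integrable_cong_AE) auto
  then have int: "integrable lborel (\<lambda>x. c x * ln (c x))" using integrable_gain_loss(1) by simp
  have "(LINT x|lborel. c x * ln (c x)) = (LINT x|lborel. c x * (gain x - loss x))"
    using ae by (intro integral_cong_AE) auto
  then show ?thesis using c_log_c_integral_eq(1)[OF copula_density_c int] integrable_gain_loss(2) by simp
qed

end

end

lemma info_eq_c_log_c_integral:
  assumes "abs_cont_copula C"
  obtains c where "has_copula_density C c" "info C = c_log_c_integral c"
  using assms someI_ex[of "has_copula_density C"] by (auto simp: info_def abs_cont_copula_def)

theorem theorem2p3:
  fixes \<delta> :: "real \<Rightarrow> real"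
  assumes d_ge_2: "CARD('n::finite) \<ge> 2"
    and delta: "\<delta> \<in> ac_diagonals TYPE('n)"
    and fixpoints: "{t \<in> {0..1}. \<delta> t = t} = {0, 1}"
  shows "(log_gap_integral \<delta> = \<infinity> \<longrightarrow>
            is_minimum info (copulas_with_diag \<delta> :: (real ^ 'n \<Rightarrow> real) set) \<infinity>) \<and>
         (log_gap_integral \<delta> < \<infinity> \<longrightarrow>
            (\<exists>m < \<infinity>. is_minimum info (copulas_with_diag \<delta> :: (real ^ 'n \<Rightarrow> real) set) m \<and>
               (\<forall>C :: real ^ 'n \<Rightarrow> real.
                  C \<in> copulas_with_diag \<delta> \<and> info C = m \<longleftrightarrow> C = C_delta \<delta>)))"
proof -
  obtain g where "diagonal_density \<delta> g CARD('n)"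
    using diagonal_density_exists[OF d_ge_2 delta fixpoints] by blast
  then interpret diagonal_density \<delta> g "CARD('n)" .
  have ext: "\<delta> \<in> extensional {0..1}" using delta by (auto simp: ac_diagonals_def diag_def)
  note dens = has_copula_density_C_delta[OF refl]
  have C_delta: "(C_delta \<delta> :: real ^ 'n \<Rightarrow> real) \<in> copulas_with_diag \<delta>"
    using dens(2) diag_C_delta[OF refl ext] by (simp add: copulas_with_diag_def)
  have loc: "copula_with_diagonal \<delta> g c C" if "has_copula_density C c" "C \<in> copulas_with_diag \<delta>"
    for C c :: "real ^ 'n \<Rightarrow> real"
    using that by unfold_locales (auto simp: copulas_with_diag_def)
  show ?thesis
  proof (intro conjI impI)
    assume inf: "log_gap_integral \<delta> = \<infinity>"
    have "info C = \<infinity>" if C: "C \<in> copulas_with_diag \<delta>" for C :: "real ^ 'n \<Rightarrow> real"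
    proof (cases "abs_cont_copula C")
      case True
      then obtain c where c: "has_copula_density C c" "info C = c_log_c_integral c"
        by (rule info_eq_c_log_c_integral)
      interpret copula_with_diagonal \<delta> g c C by (rule loc[OF c(1) C])
      show ?thesis unfolding c(2) by (rule c_log_c_integral_infinite[OF inf])
    qed (simp add: info_def)
    \<comment> \<open>All values are infinite, by definition also those of copulas without a
      density; \<open>C_delta\<close> shows that the class is nonempty, so the minimum is
      attained.\<close>
    then show "is_minimum info (copulas_with_diag \<delta> :: (real ^ 'n \<Rightarrow> real) set) \<infinity>"
      using C_delta unfolding is_minimum_def by (metis image_eqI order_refl)
  next
    assume fin: "log_gap_integral \<delta> < \<infinity>"
    define m where "m = min_info"
    have ge: "ereal m \<le> info C" and eq: "info C = ereal m \<Longrightarrow> C = C_delta \<delta>"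
      if C: "C \<in> copulas_with_diag \<delta>" for C :: "real ^ 'n \<Rightarrow> real"
    proof -
      have "ereal m \<le> info C \<and> (info C = ereal m \<longrightarrow> C = C_delta \<delta>)"
      proof (cases "abs_cont_copula C")
        case True
        then obtain c where c: "has_copula_density C c" "info C = c_log_c_integral c"
          by (rule info_eq_c_log_c_integral)
        interpret copula_with_diagonal \<delta> g c C by (rule loc[OF c(1) C])
        have "C = C_delta \<delta>" if "info C = ereal m"
        proof -
          have "AE x in lborel. c x = dens x"
            using that unfolding c(2) m_def by (rule AE_eq_dens_if_minimal[OF fin])
          \<comment> \<open>Densities that agree almost everywhere define the same law, and the law
            determines C as a function on the cube.\<close>
          then have "AE x in lborel. ennreal (c x) = ennreal (dens x)" by eventually_elim simp
          then have "law c = law dens"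
            by (intro density_cong) auto
          then show ?thesis
            using copula_density_if_has_copula_density(2)[OF c(1)] copula_density_if_has_copula_density(2)[OF dens(1)]
            by simp
        qed
        then show ?thesis using c_log_c_integral_ge[OF fin] c(2) by (simp add: m_def)
      qed (simp add: info_def)
      then show "ereal m \<le> info C" "info C = ereal m \<Longrightarrow> C = C_delta \<delta>" by auto
    qed
    have info_C_delta: "info (C_delta \<delta> :: real ^ 'n \<Rightarrow> real) = ereal m"
    proof -
      have "abs_cont_copula (C_delta \<delta> :: real ^ 'n \<Rightarrow> real)" using dens(1) by (auto simp: abs_cont_copula_def)
      then obtain c :: "real ^ 'n \<Rightarrow> real" where c: "has_copula_density (C_delta \<delta>) c" "info (C_delta \<delta> :: real ^ 'n \<Rightarrow> real) = c_log_c_integral c"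
        by (rule info_eq_c_log_c_integral)
      interpret copula_with_diagonal \<delta> g c "C_delta \<delta>" by (rule loc[OF c(1) C_delta])
      \<comment> \<open>The density behind \<open>info\<close> may differ from \<open>dens\<close>
        on a null set; uniqueness of densities bridges this.\<close>
      show ?thesis unfolding c(2) m_def
        by (rule c_log_c_integral_dens[OF fin copula_density_unique[OF c(1) dens(1)]])
    qed
    show "\<exists>m < \<infinity>. is_minimum info (copulas_with_diag \<delta> :: (real ^ 'n \<Rightarrow> real) set) m \<and>
      (\<forall>C :: real ^ 'n \<Rightarrow> real. C \<in> copulas_with_diag \<delta> \<and> info C = m \<longleftrightarrow> C = C_delta \<delta>)"
    proof (intro exI[of _ "ereal m"] conjI allI iffI)
      show "is_minimum info (copulas_with_diag \<delta> :: (real ^ 'n \<Rightarrow> real) set) (ereal m)"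
        unfolding is_minimum_def using ge C_delta info_C_delta by (metis image_eqI)
      show "ereal m < \<infinity>" by simp
      show "C = C_delta \<delta>" if "C \<in> copulas_with_diag \<delta> \<and> info C = ereal m" for C :: "real ^ 'n \<Rightarrow> real"
        using eq[of C] that by blast
      show "C \<in> copulas_with_diag \<delta>" "info C = ereal m" if "C = C_delta \<delta>" for C :: "real ^ 'n \<Rightarrow> real"
        unfolding that by (rule C_delta, rule info_C_delta)
    qed
  qed
qed

end
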